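(* Let $1\le k<n$ be integers and let $\boldsymbol{\beta}=(\beta^1,\dots,\beta^\ell)$, $\ell\ge 1$, be a Schubert problem on $\mathrm{Gr}(k,V)$, $V=\mathbb{C}^n$; that is, each $\beta^i\in\binom{[n]}{k}$ and $\sum_{i=1}^{\ell}|\beta^i|=k(n-k)$. Then for sufficiently general flags (i.e. for all $\ell$-tuples $(F^1_\bullet,\dots,F^\ell_\bullet)$ of complete flags in $V$ in some nonempty Zariski open subset of the $\ell$-fold product of the variety of complete flags of $V$) the instance $$X_{\beta^1}F^1_\bullet\cap\cdots\cap X_{\beta^\ell}F^\ell_\bullet$$ is reformulated as a complete intersection of bilinear equations in the coordinates $(M_{\beta^1},M_{\beta^{2\perp}},\dots,M_{\beta^{\ell\perp}})$, in the following sense. Let $\Phi_1$ be an $n\times n$ matrix representing $F^1_\bullet$ and, for $i=2,\dots,\ell$, let $\Psi_i$ be an $n\times n$ matrix representing the dual flag $(F^i_\bullet)^\perp$. On the affine space $M_{\beta^1}\times M_{\beta^{2\perp}}\times\cdots\times M_{\beta^{\ell\perp}}$, with points $(P,Q_2,\dots,Q_\ell)$, consider the system of equations $$ (P\,\Phi_1)\,(Q_i\,\Psi_i)^{T}=0_{k\times(n-k)},\qquad i=2,\dots,\ell. $$ (1) This is a system of $k(n-k)(\ell-1)$ equations in $k(n-k)(\ell-1)$ variables, where each equation of the $i$-th block is bilinear (has degree at most one in the entries of $P$ and degree at most one in the entries of $Q_i$), and its set of solutions is finite (possibly empty). (2) The map $$(P,Q_2,\dots,Q_\ell)\mapsto(\text{row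 space of }P\Phi_1,\ \text{row space of }Q_2\Psi_2,\ \dots,\ \text{row space of }Q_\ell\Psi_\ell)$$ restricts to a bijection from the set of solutions of the system onto $\Delta^\ell\bigl(X_{\beta^1}F^1_\bullet\cap\cdots\cap X_{\beta^\ell}F^\ell_\bullet\bigr)$.
   Context: Notation. $V=\mathbb{C}^n$ with ordered basis $e_1,\dots,e_n$; $V^*$ is the dual space with dual basis $e_1^*,\dots,e_n^*$; vectors of $V$ and of $V^*$ are written as row vectors in these bases. $\mathrm{Gr}(k,V)$ is the set of $k$-dimensional linear subspaces of $V$. $\binom{[n]}{k}$ is the set of increasing lists $\beta=(\beta_1<\dots<\beta_k)$ of elements of $[n]=\{1,\dots,n\}$. A complete flag is $F_\bullet:F_1\subset F_2\subset\cdots\subset F_n=V$ with $\dim F_i=i$. An invertible $n\times n$ matrix represents $F_\bullet$ if, for every $j$, its first $j$ rows span $F_j$. The dual flag $F_\bullet^\perp$ in $V^*$ is $(F_{n-1})^\perp\subset(F_{n-2})^\perp\subset\cdots\subset(F_1)^\perp\subset V^*$, where $\perp$ of a subspace of $V$ is its annihilator in $V^*$; so its $j$-dimensional member is $(F_{n-j})^\perp$. Schubert variety: $X_\beta F_\bullet=\{H\in\mathrm{Gr}(k,V): \dim(H\cap F_{\beta_i})\ge i,\ i=1,\dots,k\}$. Codimension: $|\beta|=k(n-k)-\sum_{i=1}^k(\beta_i-i)$. For $\beta\in\binom{[n]}{k}$, $\beta^\perp\in\binom{[n]}{n-k}$ is the increasing list of all $j\in[n]$ with $n+1-j\notin\beta$;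 $\beta^{i\perp}$ means $(\beta^i)^\perp$. For $\beta\in\binom{[n]}{r}$, $M_\beta$ is the affine space of $r\times n$ complex matrices $(m_{i,j})$ with $m_{i,\beta_j}=\delta_{i,j}$ for all $i,j$, with $m_{i,j}=0$ whenever $j>\beta_i$, and with all other entries unconstrained; the unconstrained entries are the coordinates (variables), and there are $\sum_i(\beta_i-i)$ of them. Thus $M_{\beta^1}$ consists of $k\times n$ matrices, and $M_{\beta^{i\perp}}$ of $(n-k)\times n$ matrices. $\Delta^\ell:\mathrm{Gr}(k,V)\to\mathrm{Gr}(k,V)\times(\mathrm{Gr}(n-k,V^* ))^{\ell-1}$ is the map $H\mapsto(H,H^\perp,\dots,H^\perp)$. *)

theory Defs
  imports Complex_Main "HOL-Library.FuncSet" "Jordan_Normal_Form.VS_Connect"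
begin

text \<open>
  Both \<open>V = \<complex>\<^sup>n\<close> and its dual are modelled by \<^term>\<open>carrier_vec n :: complex vec set\<close>:
  row vectors in the basis \<open>e\<^sub>1, \<dots>, e\<^sub>n\<close>, resp. in the dual basis.
  The evaluation pairing is then the scalar product of \<^theory>\<open>Jordan_Normal_Form.Matrix\<close>, which is
  bilinear (it involves no complex conjugation).

  Elements of \<open>[n]\<close>, and hence the entries of the lists \<open>\<beta>\<close>, are numbered from 1; rows and
  columns of matrices and positions in lists are numbered from 0. Families indexed by the members of
  a Schubert problem are functions on \<open>{1..l}\<close> or \<open>{2..l}\<close>.
\<close>

subsection \<open>Linear algebra\<close>

abbreviation space_V :: "nat \<Rightarrow> (complex, complex vec) module" where
  "space_V n \<equiv> module_vec TYPE(complex) n"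

definition sdim :: "nat \<Rightarrow> complex vec set \<Rightarrow> nat" where
  "sdim n W = vectorspace.dim class_ring ((space_V n)\<lparr>carrier := W\<rparr>)"

definition Gr :: "nat \<Rightarrow> nat \<Rightarrow> complex vec set set" where
  "Gr k n = {H. VectorSpace.subspace class_ring H (space_V n) \<and> sdim n H = k}"

definition annihilator :: "nat \<Rightarrow> complex vec set \<Rightarrow> complex vec set" where
  "annihilator n W = {\<phi> \<in> carrier_vec n. \<forall>w\<in>W. \<phi> \<bullet> w = 0}"

definition row_span :: "nat \<Rightarrow> complex mat \<Rightarrow> complex vec set" where
  "row_span n A = LinearCombinations.module.span class_ring (space_V n) (set (rows A))"

subsection \<open>Flags\<close>

text \<open>
  A complete flag is stored as the list \<open>[F\<^sub>0, F\<^sub>1, \<dots>, F\<^sub>n]\<close> with the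
  (redundant) zero space \<open>F\<^sub>0\<close> in front, so that \<open>F ! j\<close> is \<open>F\<^sub>j\<close> and the
  \<open>j\<close>-dimensional member of the dual flag is the annihilator of \<open>F ! (n - j)\<close> for all \<open>j\<close>.
\<close>

definition complete_flags :: "nat \<Rightarrow> complex vec set list set" where
  "complete_flags n =
     {F. length F = n + 1 \<and> (\<forall>j\<le>n. F ! j \<in> Gr j n) \<and> (\<forall>j<n. F ! j \<subseteq> F ! Suc j)}"

definition dual_flag :: "nat \<Rightarrow> complex vec set list \<Rightarrow> complex vec set list" where
  "dual_flag n F = map (\<lambda>j. annihilator n (F ! (n - j))) [0..<n + 1]"

definition represents :: "nat \<Rightarrow> complex mat \<Rightarrow> complex vec set list \<Rightarrow> bool" where
  "represents n A F \<longleftrightarrow> A \<in> carrier_mat n n \<and> invertible_mat A \<and>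
     (\<forall>j\<in>{1..n}. LinearCombinations.module.span class_ring (space_V n)
                    (set (take j (rows A))) = F ! j)"

subsection \<open>The Zariski topology on tuples of flags\<close>

definition GL_tuples :: "nat \<Rightarrow> nat \<Rightarrow> (nat \<Rightarrow> complex mat) set" where
  "GL_tuples n l = {1..l} \<rightarrow>\<^sub>E {A \<in> carrier_mat n n. invertible_mat A}"

inductive_set poly_fun :: "nat \<Rightarrow> nat \<Rightarrow> ((nat \<Rightarrow> complex mat) \<Rightarrow> complex) set"
  for n l :: nat
where
  const: "(\<lambda>A. c) \<in> poly_fun n l"
| coord: "\<lbrakk>i \<in> {1..l}; a < n; b < n\<rbrakk> \<Longrightarrow> (\<lambda>A. A i $$ (a, b)) \<in> poly_fun n l"
| add: "\<lbrakk>f \<in> poly_fun n l; g \<in> poly_fun n l\<rbrakk> \<Longrightarrow> (\<lambda>A. f A + g A) \<in> poly_fun n l"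
| mult: "\<lbrakk>f \<in> poly_fun n l; g \<in> poly_fun n l\<rbrakk> \<Longrightarrow> (\<lambda>A. f A * g A) \<in> poly_fun n l"

definition zariski_open_GL :: "nat \<Rightarrow> nat \<Rightarrow> (nat \<Rightarrow> complex mat) set \<Rightarrow> bool" where
  "zariski_open_GL n l W \<longleftrightarrow>
     (\<exists>S \<subseteq> poly_fun n l. W = {A \<in> GL_tuples n l. \<exists>f\<in>S. f A \<noteq> 0})"

text \<open>
  The variety of complete flags is the quotient of \<open>GL\<^sub>n\<close> by the Borel subgroup of lower
  triangular matrices, with quotient map sending a matrix to the flag it represents, and the
  \<open>l\<close>-fold product is likewise a quotient of \<open>(GL\<^sub>n)\<^sup>l\<close>. Its Zariski topology is
  the quotient topology.
\<close>

definition zariski_open_flags :: "nat \<Rightarrow> nat \<Rightarrow> (nat \<Rightarrow> complex vec set list) set \<Rightarrow> bool" where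
  "zariski_open_flags n l U \<longleftrightarrow> U \<subseteq> {1..l} \<rightarrow>\<^sub>E complete_flags n \<and>
     zariski_open_GL n l {A \<in> GL_tuples n l. \<exists>F\<in>U. \<forall>i\<in>{1..l}. represents n (A i) (F i)}"

subsection \<open>Schubert varieties and Schubert problems\<close>

definition increasing_lists :: "nat \<Rightarrow> nat \<Rightarrow> nat list set" where
  "increasing_lists n k = {\<beta>. length \<beta> = k \<and> sorted_wrt (<) \<beta> \<and> set \<beta> \<subseteq> {1..n}}"

definition schubert_variety ::
    "nat \<Rightarrow> nat \<Rightarrow> nat list \<Rightarrow> complex vec set list \<Rightarrow> complex vec set set" where
  "schubert_variety n k \<beta> F =
     {H \<in> Gr k n. \<forall>i\<in>{1..k}. i \<le> sdim n (H \<inter> F ! (\<beta> ! (i - 1)))}"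

text \<open>No subtraction is truncated when \<open>\<beta> \<in> increasing_lists n k\<close> and \<open>k \<le> n\<close>.\<close>

definition codimension :: "nat \<Rightarrow> nat \<Rightarrow> nat list \<Rightarrow> nat" where
  "codimension n k \<beta> = k * (n - k) - (\<Sum>i=1..k. \<beta> ! (i - 1) - i)"

definition schubert_problem :: "nat \<Rightarrow> nat \<Rightarrow> nat \<Rightarrow> (nat \<Rightarrow> nat list) \<Rightarrow> bool" where
  "schubert_problem n k l \<beta> \<longleftrightarrow> (\<forall>i\<in>{1..l}. \<beta> i \<in> increasing_lists n k) \<and>
     (\<Sum>i=1..l. codimension n k (\<beta> i)) = k * (n - k)"

definition instance_of ::
    "nat \<Rightarrow> nat \<Rightarrow> nat \<Rightarrow> (nat \<Rightarrow> nat list) \<Rightarrow> (nat \<Rightarrow> complex vec set list) \<Rightarrow> complex vec set set"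
where
  "instance_of n k l \<beta> F = (\<Inter>i\<in>{1..l}. schubert_variety n k (\<beta> i) (F i))"

definition perp_list :: "nat \<Rightarrow> nat list \<Rightarrow> nat list" where
  "perp_list n \<beta> = filter (\<lambda>j. n + 1 - j \<notin> set \<beta>) [1..<n + 1]"

definition Delta :: "nat \<Rightarrow> nat \<Rightarrow> complex vec set \<Rightarrow> complex vec set \<times> (nat \<Rightarrow> complex vec set)" where
  "Delta n l H = (H, \<lambda>i\<in>{2..l}. annihilator n H)"

subsection \<open>The bilinear system\<close>

definition M :: "nat \<Rightarrow> nat list \<Rightarrow> complex mat set" where
  "M n \<beta> = {A \<in> carrier_mat (length \<beta>) n.
     (\<forall>i<length \<beta>. \<forall>j<length \<beta>. A $$ (i, \<beta> ! j - 1) = (if i = j then 1 else 0)) \<and>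
     (\<forall>i<length \<beta>. \<forall>j\<in>{1..n}. j > \<beta> ! i \<longrightarrow> A $$ (i, j - 1) = 0)}"

text \<open>The positions of the unconstrained entries, i.e. the coordinates of \<^term>\<open>M n \<beta>\<close>.\<close>

definition coords :: "nat \<Rightarrow> nat list \<Rightarrow> (nat \<times> nat) set" where
  "coords n \<beta> = {(i, j - 1) | i j. i < length \<beta> \<and> j \<in> {1..n} \<and> j \<notin> set \<beta> \<and> j \<le> \<beta> ! i}"

type_synonym point = "complex mat \<times> (nat \<Rightarrow> complex mat)"

definition affine_space :: "nat \<Rightarrow> nat \<Rightarrow> (nat \<Rightarrow> nat list) \<Rightarrow> point set" where
  "affine_space n l \<beta> = M n (\<beta> 1) \<times> (\<Pi>\<^sub>E i\<in>{2..l}. M n (perp_list n (\<beta> i)))"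

text \<open>A variable is a pair of the index of a factor of the affine space and a position in it.\<close>

definition variables :: "nat \<Rightarrow> nat \<Rightarrow> (nat \<Rightarrow> nat list) \<Rightarrow> (nat \<times> nat \<times> nat) set" where
  "variables n l \<beta> = {1} \<times> coords n (\<beta> 1) \<union> (SIGMA i:{2..l}. coords n (perp_list n (\<beta> i)))"

definition block :: "complex mat \<Rightarrow> (nat \<Rightarrow> complex mat) \<Rightarrow> nat \<Rightarrow> point \<Rightarrow> complex mat" where
  "block \<Phi> \<Psi> i = (\<lambda>(P, Q). (P * \<Phi>) * (Q i * \<Psi> i)\<^sup>T)"

text \<open>
  The equation with index \<open>(i, a, b)\<close> asks for the entry \<open>(a, b)\<close> of the \<open>i\<close>-th block to vanish.
\<close>

definition equations :: "nat \<Rightarrow> nat \<Rightarrow> nat \<Rightarrow> (nat \<times> nat \<times> nat) set" where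
  "equations n k l = {2..l} \<times> {..<k} \<times> {..<n - k}"

definition lhs :: "complex mat \<Rightarrow> (nat \<Rightarrow> complex mat) \<Rightarrow> nat \<times> nat \<times> nat \<Rightarrow> point \<Rightarrow> complex" where
  "lhs \<Phi> \<Psi> = (\<lambda>(i, a, b) x. block \<Phi> \<Psi> i x $$ (a, b))"

definition solutions ::
    "nat \<Rightarrow> nat \<Rightarrow> nat \<Rightarrow> (nat \<Rightarrow> nat list) \<Rightarrow> complex mat \<Rightarrow> (nat \<Rightarrow> complex mat) \<Rightarrow> point set" where
  "solutions n k l \<beta> \<Phi> \<Psi> =
     {x \<in> affine_space n l \<beta>. \<forall>i\<in>{2..l}. block \<Phi> \<Psi> i x = 0\<^sub>m k (n - k)}"

text \<open>
  \<open>bilinear_in n l \<beta> i f\<close>: on the affine space, \<open>f\<close> is a polynomial in the coordinates of \<open>P\<close>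
  and of \<open>Q\<^sub>i\<close> only, of degree at most one in the former and at most one in the latter.
  The terms of lower degree come from the constant entries 1 of \<open>P\<close> and \<open>Q\<^sub>i\<close>.
\<close>

definition bilinear_in :: "nat \<Rightarrow> nat \<Rightarrow> (nat \<Rightarrow> nat list) \<Rightarrow> nat \<Rightarrow> (point \<Rightarrow> complex) \<Rightarrow> bool" where
  "bilinear_in n l \<beta> i f \<longleftrightarrow>
     (let X = coords n (\<beta> 1); Y = coords n (perp_list n (\<beta> i)) in
      \<exists>(c :: complex) (p :: nat \<times> nat \<Rightarrow> complex) (q :: nat \<times> nat \<Rightarrow> complex)
        (r :: nat \<times> nat \<Rightarrow> nat \<times> nat \<Rightarrow> complex).
        \<forall>(P, Q) \<in> affine_space n l \<beta>.
          f (P, Q) = c + (\<Sum>x\<in>X. p x * P $$ x) + (\<Sum>y\<in>Y. q y * Q i $$ y)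
                       + (\<Sum>x\<in>X. \<Sum>y\<in>Y. r x y * P $$ x * Q i $$ y))"

definition row_space_map ::
    "nat \<Rightarrow> nat \<Rightarrow> complex mat \<Rightarrow> (nat \<Rightarrow> complex mat) \<Rightarrow> point \<Rightarrow>
     complex vec set \<times> (nat \<Rightarrow> complex vec set)" where
  "row_space_map n l \<Phi> \<Psi> =
     (\<lambda>(P, Q). (row_span n (P * \<Phi>), \<lambda>i\<in>{2..l}. row_span n (Q i * \<Psi> i)))"

end

theory Submission
  imports Defs "Jordan_Normal_Form.DL_Rank"
begin

text \<open>
  Let the rows of an invertible matrix \<open>A\<close> represent a flag \<open>F\<close>. Every \<open>k\<close>-dimensional subspace \<open>H\<close>
  has a unique reduced echelon form with respect to \<open>A\<close>: it is the row space of \<open>P * A\<close> for one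
  increasing list \<open>\<gamma>\<close> of pivots and one \<open>P \<in> M n \<gamma>\<close>. The pivots are the indices at which
  \<open>dim (H \<inter> F\<^sub>j)\<close> jumps, so \<open>H\<close> lies in the Schubert variety of \<open>\<beta>\<close> iff \<open>\<gamma> \<le> \<beta>\<close> entrywise
  (\<open>schubert_variety_iff_pivots_le\<close>), and the subspaces with \<open>\<gamma> = \<beta>\<close> form its big cell, which
  \<open>M n \<beta>\<close> parametrizes. The theorem rests on two facts: for general flags the instance is finite and
  lies in the big cells of all the Schubert varieties, and orthogonality of two echelon forms
  determines the pivots of one by those of the other, which lets the bilinear equations replace the
  Schubert conditions.

  The first fact is a dimension count. If \<open>H\<close> lies in the cell of \<open>\<gamma>\<^sub>i\<close> with respect to \<open>A\<^sub>i\<close> for all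
  \<open>i\<close>, then \<open>P\<^sub>i * A\<^sub>i = G\<^sub>i * (P\<^sub>1 * A\<^sub>1)\<close> for some \<open>k \<times> k\<close> matrices \<open>G\<^sub>i\<close>, because all these row
  spaces are \<open>H\<close>. The pivot columns of \<open>P\<^sub>i\<close> form an identity matrix, so this equation
  expresses the rows of \<open>A\<^sub>i\<close> in pivot position as polynomials in the other data. Hence, along such
  configurations, all entries of all \<open>A\<^sub>i\<close> are polynomials in
  \<open>(\<Sum>i. dim (M n \<gamma>\<^sub>i)) + n\<^sup>2 + (l - 1) * (n\<^sup>2 - k * (n - k))\<close> parameters
  (\<open>incident_A_entry\<close>). For a Schubert problem this number is the number \<open>l * n\<^sup>2\<close> of entries, and it
  is smaller as soon as some \<open>\<gamma>\<^sub>i\<close> lies strictly below \<open>\<beta>\<^sub>i\<close>. Now more than \<open>N\<close> polynomials in \<open>N\<close>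
  parameters are algebraically dependent (\<open>algebraic_dependence\<close>). In the smaller case, the
  relation is a nonzero polynomial in the entries of the \<open>A\<^sub>i\<close> that vanishes wherever the cells
  meet, so generically they do not meet (\<open>generic_not_incident\<close>). In the case of equality, adjoin an
  entry of \<open>P\<^sub>1\<close> to the entries of the \<open>A\<^sub>i\<close>: where one coefficient of the resulting relation does not
  vanish, only finitely many values are left for that entry (\<open>generic_finitely_many_incident\<close>).
  Finitely many nonzero polynomials and the determinants have a common point of nonvanishing
  (\<open>common_nonvanishing_poly_fun\<close>), and the flags represented by the points at which their product
  does not vanish form the open set of the theorem (\<open>flags_of_nonvanishing_open\<close>).

  The second fact is about leading terms. Represent the dual flag of \<open>F\<close> by \<open>\<Psi>\<close>. The matrix of
  pairings between the rows of \<open>A\<close> and of \<open>\<Psi>\<close> is zero above its antidiagonal and nonzero on it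
  (\<open>pairing_with_dual_flag\<close>). If a row of \<open>P \<in> M n \<gamma>\<close> and a row of \<open>Q \<in> M n \<delta>\<close> have pivots with sum
  \<open>n + 1\<close>, their pairing consists of one nonzero term. So \<open>(P * A) * (Q * \<Psi>)\<^sup>T = 0\<close> forces
  \<open>\<delta> = perp_list n \<gamma>\<close> (\<open>orthogonal_echelon_forms\<close>). Therefore a solution of the system, whose \<open>Q\<^sub>i\<close>
  has the pivots dual to \<open>\<beta>\<^sub>i\<close>, comes from an \<open>H\<close> in the big cell of every \<open>\<beta>\<^sub>i\<close>, and conversely the
  annihilator of such an \<open>H\<close> has echelon forms \<open>Q\<^sub>i\<close> of the required shapes
  (\<open>solution_row_spaces\<close>, \<open>solution_exists\<close>). Uniqueness of echelon forms makes the correspondence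
  bijective.
\<close>

section \<open>Polynomial functions and algebraic dependence\<close>

text \<open>
  Gaussian elimination: an equation with a nonzero coefficient at \<open>e0\<close> eliminates the unknown \<open>e0\<close>
  from the remaining equations.
\<close>

lemma homogeneous_system_nontrivial_solution:
  fixes a :: "'e \<Rightarrow> 't \<Rightarrow> complex"
  assumes "finite T" "finite E" "card T < card E"
  shows "\<exists>c. (\<exists>e\<in>E. c e \<noteq> 0) \<and> (\<forall>t\<in>T. (\<Sum>e\<in>E. c e * a e t) = 0)"
  using assms
proof (induction T arbitrary: E a rule: finite_induct)
  case empty
  then have "E \<noteq> {}" by auto
  then show ?case by (intro exI[of _ "\<lambda>_. 1"]) auto
next
  case (insert t T)
  show ?case
  proof (cases "\<forall>e\<in>E. a e t = 0")
    case True
    have "card T < card E" using insert by auto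
    from insert.IH[OF insert.prems(1) this, of a] True show ?thesis by auto
  next
    case False
    then obtain e0 where e0: "e0 \<in> E" "a e0 t \<noteq> 0" by auto
    define E' where "E' = E - {e0}"
    have E': "finite E'" "card T < card E'" "e0 \<notin> E'" "E = insert e0 E'"
      using insert e0 by (auto simp: E'_def)
    define a' where "a' e s = a e s - a e t / a e0 t * a e0 s" for e s
    obtain c where c: "\<exists>e\<in>E'. c e \<noteq> 0" "\<And>s. s \<in> T \<Longrightarrow> (\<Sum>e\<in>E'. c e * a' e s) = 0"
      using insert.IH[OF E'(1,2), of a'] by auto
    define c0 where "c0 = - (\<Sum>e\<in>E'. c e * a e t) / a e0 t"
    define d where "d = c(e0 := c0)"
    have split: "(\<Sum>e\<in>E. d e * a e s) = c0 * a e0 s + (\<Sum>e\<in>E'. c e * a e s)" for s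
    proof -
      have "(\<Sum>e\<in>E'. d e * a e s) = (\<Sum>e\<in>E'. c e * a e s)"
        using E' by (intro sum.cong) (auto simp: d_def)
      then show ?thesis using E' by (simp add: d_def)
    qed
    have "(\<Sum>e\<in>E. d e * a e s) = 0" if "s \<in> insert t T" for s
    proof (cases "s = t")
      case True
      then show ?thesis using e0 by (simp add: split c0_def)
    next
      case False
      with that have "s \<in> T" by simp
      from c(2)[OF this] have "(\<Sum>e\<in>E'. c e * a e s) = (\<Sum>e\<in>E'. c e * a e t) / a e0 t * a e0 s"
        by (simp add: a'_def algebra_simps sum_subtractf sum_distrib_left sum_distrib_right sum_divide_distrib)
      then show ?thesis by (simp add: split c0_def)
    qed
    moreover have "\<exists>e\<in>E. d e \<noteq> 0" using c(1) E' by (auto simp: d_def)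
    ultimately show ?thesis by blast
  qed
qed

definition monomial :: "'i set \<Rightarrow> ('i \<Rightarrow> complex) \<Rightarrow> ('i \<Rightarrow> nat) \<Rightarrow> complex" where
  "monomial I u e = (\<Prod>i\<in>I. u i ^ e i)"

abbreviation exponents :: "'i set \<Rightarrow> nat \<Rightarrow> ('i \<Rightarrow> nat) set" where
  "exponents I d \<equiv> I \<rightarrow>\<^sub>E {..d}"

text \<open>
  The functions on \<open>D\<close> that are polynomials in the parameters \<open>u p i\<close>. Closing under agreement on \<open>D\<close>
  lets a polynomial identity that holds only on a parametrized set, such as the incidence variety
  below, be used to show that a quantity is polynomial in the parameters.
\<close>

inductive_set polys_on :: "'p set \<Rightarrow> 'i set \<Rightarrow> ('p \<Rightarrow> 'i \<Rightarrow> complex) \<Rightarrow> ('p \<Rightarrow> complex) set"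
  for D :: "'p set" and I :: "'i set" and u :: "'p \<Rightarrow> 'i \<Rightarrow> complex"
where
  const: "(\<lambda>p. c) \<in> polys_on D I u"
| gen: "i \<in> I \<Longrightarrow> (\<lambda>p. u p i) \<in> polys_on D I u"
| add: "\<lbrakk>f \<in> polys_on D I u; g \<in> polys_on D I u\<rbrakk> \<Longrightarrow> (\<lambda>p. f p + g p) \<in> polys_on D I u"
| mult: "\<lbrakk>f \<in> polys_on D I u; g \<in> polys_on D I u\<rbrakk> \<Longrightarrow> (\<lambda>p. f p * g p) \<in> polys_on D I u"
| cong: "\<lbrakk>f \<in> polys_on D I u; \<And>p. p \<in> D \<Longrightarrow> f p = g p\<rbrakk> \<Longrightarrow> g \<in> polys_on D I u"

lemma polys_on_sum:
  assumes "\<And>x. x \<in> X \<Longrightarrow> f x \<in> polys_on D I u"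
  shows "(\<lambda>p. \<Sum>x\<in>X. f x p) \<in> polys_on D I u"
  using assms by (induction X rule: infinite_finite_induct) (auto intro: polys_on.intros)

lemma polys_on_diff:
  assumes "f \<in> polys_on D I u" "g \<in> polys_on D I u"
  shows "(\<lambda>p. f p - g p) \<in> polys_on D I u"
proof -
  have "(\<lambda>p. f p + (-1) * g p) \<in> polys_on D I u"
    using assms by (intro polys_on.add polys_on.mult polys_on.const)
  then show ?thesis by simp
qed

text \<open>
  Polynomials of degree at most \<open>d\<close> in each parameter separately. This grading is
  multiplicative, and the monomials up to degree \<open>d\<close> in \<open>N\<close> parameters are simply counted by \<open>(d + 1)\<^sup>N\<close>.
\<close>

definition bounded_degree :: "'p set \<Rightarrow> 'i set \<Rightarrow> ('p \<Rightarrow> 'i \<Rightarrow> complex) \<Rightarrow> nat \<Rightarrow> ('p \<Rightarrow> complex) set" where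
  "bounded_degree D I u d =
     {f. \<exists>a. \<forall>p\<in>D. f p = (\<Sum>e\<in>exponents I d. a e * monomial I (u p) e)}"

lemma bounded_degree_mono:
  assumes "finite I" "d \<le> d'" "f \<in> bounded_degree D I u d"
  shows "f \<in> bounded_degree D I u d'"
proof -
  obtain a where a: "\<And>p. p \<in> D \<Longrightarrow> f p = (\<Sum>e\<in>exponents I d. a e * monomial I (u p) e)"
    using assms by (auto simp: bounded_degree_def)
  have sub: "exponents I d \<subseteq> exponents I d'" using assms(2) by (intro PiE_mono) auto
  define b where "b e = (if e \<in> exponents I d then a e else 0)" for e
  have "f p = (\<Sum>e\<in>exponents I d'. b e * monomial I (u p) e)" if "p \<in> D" for p
    unfolding a[OF that] using assms(1) sub
    by (intro sum.mono_neutral_cong_left) (auto simp: b_def intro!: finite_PiE)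
  then show ?thesis by (auto simp: bounded_degree_def)
qed

lemma bounded_degree_const:
  assumes "finite I"
  shows "(\<lambda>p. c) \<in> bounded_degree D I u 0"
proof -
  have "exponents I 0 = {\<lambda>i\<in>I. 0}" by (auto simp: PiE_def extensional_def)
  then show ?thesis
    by (auto simp: bounded_degree_def monomial_def intro!: exI[of _ "\<lambda>_. c"])
qed

lemma bounded_degree_gen:
  assumes "finite I" "i \<in> I"
  shows "(\<lambda>p. u p i) \<in> bounded_degree D I u 1"
proof -
  define e0 where "e0 = (\<lambda>j\<in>I. if j = i then 1 else 0 :: nat)"
  have e0: "e0 \<in> exponents I 1" by (auto simp: e0_def)
  have mon: "monomial I v e0 = v i" for v
  proof -
    have "monomial I v e0 = (\<Prod>j\<in>I. if j = i then v j else 1)"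
      unfolding monomial_def e0_def by (intro prod.cong) auto
    then show ?thesis using assms by simp
  qed
  have "u p i = (\<Sum>e\<in>exponents I 1. (if e = e0 then 1 else 0) * monomial I (u p) e)" for p
  proof -
    have "(\<Sum>e\<in>exponents I 1. (if e = e0 then 1 else 0) * monomial I (u p) e) =
        (\<Sum>e\<in>exponents I 1. if e = e0 then monomial I (u p) e else 0)"
      by (intro sum.cong) auto
    also have "\<dots> = monomial I (u p) e0"
      using e0 assms(1) by (simp add: finite_PiE del: PiE_iff)
    finally show ?thesis using mon by simp
  qed
  then show ?thesis by (auto simp: bounded_degree_def intro!: exI[of _ "\<lambda>e. if e = e0 then 1 else 0"])
qed

lemma bounded_degree_add:
  assumes "f \<in> bounded_degree D I u d" "g \<in> bounded_degree D I u d"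
  shows "(\<lambda>p. f p + g p) \<in> bounded_degree D I u d"
proof -
  obtain a b where ab: "\<And>p. p \<in> D \<Longrightarrow> f p = (\<Sum>e\<in>exponents I d. a e * monomial I (u p) e)"
     "\<And>p. p \<in> D \<Longrightarrow> g p = (\<Sum>e\<in>exponents I d. b e * monomial I (u p) e)"
    using assms by (auto simp: bounded_degree_def)
  have "f p + g p = (\<Sum>e\<in>exponents I d. (a e + b e) * monomial I (u p) e)" if "p \<in> D" for p
    unfolding ab[OF that] distrib_right sum.distrib ..
  then show ?thesis unfolding bounded_degree_def by (intro CollectI exI[of _ "\<lambda>e. a e + b e"]) auto
qed

lemma bounded_degree_mult:
  assumes "finite I" "f \<in> bounded_degree D I u d" "g \<in> bounded_degree D I u d'"
  shows "(\<lambda>p. f p * g p) \<in> bounded_degree D I u (d + d')"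
proof -
  obtain a b where a: "\<And>p. p \<in> D \<Longrightarrow> f p = (\<Sum>e\<in>exponents I d. a e * monomial I (u p) e)"
     and b: "\<And>p. p \<in> D \<Longrightarrow> g p = (\<Sum>e\<in>exponents I d'. b e * monomial I (u p) e)"
    using assms by (auto simp: bounded_degree_def)
  define plus where "plus = (\<lambda>(e, e'). \<lambda>i\<in>I. e i + e' i :: nat)"
  define S where "S = exponents I d \<times> exponents I d'"
  have S: "finite S"
    using assms(1) by (auto simp: S_def intro!: finite_PiE)
  have plus: "plus ` S \<subseteq> exponents I (d + d')"
    by (auto simp: S_def plus_def PiE_def Pi_def intro!: add_mono)
  define c where "c t = (\<Sum>x\<in>{x\<in>S. plus x = t}. a (fst x) * b (snd x))" for t
  have "f p * g p = (\<Sum>t\<in>exponents I (d + d'). c t * monomial I (u p) t)" if "p \<in> D" for p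
  proof -
    have mon: "monomial I (u p) (fst x) * monomial I (u p) (snd x) = monomial I (u p) (plus x)" for x
      unfolding monomial_def plus_def case_prod_beta prod.distrib[symmetric]
      by (intro prod.cong) (auto simp: power_add)
    have "f p * g p = (\<Sum>x\<in>S. (a (fst x) * b (snd x)) * monomial I (u p) (plus x))"
      unfolding a[OF that] b[OF that] sum_product S_def sum.cartesian_product mon[symmetric]
      by (intro sum.cong) auto
    also have "\<dots> = (\<Sum>t\<in>exponents I (d + d'). \<Sum>x\<in>{x\<in>S. plus x = t}.
        (a (fst x) * b (snd x)) * monomial I (u p) (plus x))"
      using S plus assms(1) by (intro sum.group[symmetric] finite_PiE) auto
    also have "\<dots> = (\<Sum>t\<in>exponents I (d + d'). c t * monomial I (u p) t)"
      unfolding c_def sum_distrib_right by (intro sum.cong refl) auto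
    finally show ?thesis .
  qed
  then show ?thesis by (auto simp: bounded_degree_def)
qed

lemma bounded_degree_power:
  assumes "finite I" "f \<in> bounded_degree D I u d"
  shows "(\<lambda>p. f p ^ m) \<in> bounded_degree D I u (m * d)"
proof (induction m)
  case 0
  then show ?case using bounded_degree_const[OF assms(1), of 1] by simp
next
  case (Suc m)
  then show ?case using bounded_degree_mult[OF assms(1) assms(2) Suc] by simp
qed

lemma bounded_degree_prod:
  assumes "finite I" "finite J" "\<And>j. j \<in> J \<Longrightarrow> f j \<in> bounded_degree D I u (d j)"
  shows "(\<lambda>p. \<Prod>j\<in>J. f j p) \<in> bounded_degree D I u (\<Sum>j\<in>J. d j)"
  using assms(2,3)
proof (induction J rule: finite_induct)
  case empty
  then show ?case using bounded_degree_const[OF assms(1), of 1] by simp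
next
  case (insert j J)
  then show ?case using bounded_degree_mult[OF assms(1), of "f j" D u "d j"] by simp
qed

lemma polys_on_bounded_degree:
  assumes "finite I" "f \<in> polys_on D I u"
  shows "\<exists>d. f \<in> bounded_degree D I u d"
  using assms(2)
proof induction
  case (const c)
  then show ?case using bounded_degree_const[OF assms(1)] by blast
next
  case (gen i)
  then show ?case using bounded_degree_gen[OF assms(1)] by blast
next
  case (add f g)
  then obtain d d' where "f \<in> bounded_degree D I u d" "g \<in> bounded_degree D I u d'" by auto
  then have "f \<in> bounded_degree D I u (max d d')" "g \<in> bounded_degree D I u (max d d')"
    using bounded_degree_mono[OF assms(1) max.cobounded1] bounded_degree_mono[OF assms(1) max.cobounded2]
    by blast+
  then show ?case using bounded_degree_add by blast
next
  case (mult f g)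
  then show ?case using bounded_degree_mult[OF assms(1)] by blast
next
  case (cong f g)
  then obtain d a where "\<forall>p\<in>D. f p = (\<Sum>e\<in>exponents I d. a e * monomial I (u p) e)"
    by (auto simp: bounded_degree_def)
  then have "\<forall>p\<in>D. g p = (\<Sum>e\<in>exponents I d. a e * monomial I (u p) e)"
    using cong.hyps(2) by simp
  then show ?case unfolding bounded_degree_def by blast
qed

text \<open>
  Counting monomials: the \<open>(d + 1)\<^sup>M\<close> monomials up to degree \<open>d\<close> in the \<open>y\<^sub>j\<close> lie in the span of
  \<open>O (d\<^sup>N)\<close> monomials in the parameters, where \<open>M > N\<close> are the numbers of functions and of
  parameters. For large \<open>d\<close> they are linearly dependent.
\<close>

theorem algebraic_dependence:
  assumes "finite I" "finite J" "card I < card J"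
    and y: "\<And>j. j \<in> J \<Longrightarrow> (\<lambda>p. y p j) \<in> polys_on D I u"
  shows "\<exists>d c. (\<exists>e\<in>exponents J d. c e \<noteq> 0) \<and>
           (\<forall>p\<in>D. (\<Sum>e\<in>exponents J d. c e * monomial J (y p) e) = 0)"
proof -
  have "\<forall>j\<in>J. \<exists>d. (\<lambda>p. y p j) \<in> bounded_degree D I u d"
    using polys_on_bounded_degree[OF assms(1)] y by blast
  then obtain d0 where d0: "\<And>j. j \<in> J \<Longrightarrow> (\<lambda>p. y p j) \<in> bounded_degree D I u (d0 j)" by metis
  define d1 where "d1 = (\<Sum>j\<in>J. d0 j)"
  have d1: "(\<lambda>p. y p j) \<in> bounded_degree D I u d1" if "j \<in> J" for j
    using bounded_degree_mono[OF assms(1) _ d0[OF that]] assms(2) that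
    by (auto simp: d1_def intro: member_le_sum)
  (* The monomials in the parameters have degree at most card J * d * d1, which is below (d + 1) * B;
     with d = B ^ card I the count (d + 1) ^ card I * d stays below (d + 1) ^ card J. *)
  define B where "B = card J * d1 + 1"
  define d where "d = B ^ card I"
  have mon: "(\<lambda>p. monomial J (y p) e) \<in> bounded_degree D I u (card J * d * d1)"
    if "e \<in> exponents J d" for e
  proof -
    have "(\<lambda>p. monomial J (y p) e) \<in> bounded_degree D I u (\<Sum>j\<in>J. e j * d1)"
      unfolding monomial_def
      by (intro bounded_degree_prod bounded_degree_power assms d1)
    moreover have "(\<Sum>j\<in>J. e j * d1) \<le> (\<Sum>j\<in>J. d * d1)"
      using that by (intro sum_mono mult_right_mono) (auto simp: PiE_def Pi_def)
    ultimately show ?thesis using bounded_degree_mono[OF assms(1)] by (simp add: mult.assoc)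
  qed
  define T where "T = exponents I (card J * d * d1)"
  define E where "E = exponents J d"
  have "\<forall>e\<in>E. \<exists>a. \<forall>p\<in>D. monomial J (y p) e = (\<Sum>t\<in>T. a t * monomial I (u p) t)"
    using mon by (auto simp: bounded_degree_def T_def E_def)
  then obtain a where a: "\<And>e p. e \<in> E \<Longrightarrow> p \<in> D \<Longrightarrow> 
      monomial J (y p) e = (\<Sum>t\<in>T. a e t * monomial I (u p) t)"
    by metis
  have "card T = (card J * d * d1 + 1) ^ card I"
    using assms(1) by (simp add: T_def card_PiE)
  also have "\<dots> \<le> ((d + 1) * B) ^ card I"
    by (intro power_mono) (auto simp: B_def algebra_simps)
  also have "\<dots> = (d + 1) ^ card I * d" by (simp only: power_mult_distrib d_def)
  also have "\<dots> < (d + 1) ^ (card I + 1)" by simp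
  also have "\<dots> \<le> (d + 1) ^ card J" using assms(3) by (intro power_increasing) auto
  also have "\<dots> = card E" using assms(2) by (simp add: E_def card_PiE)
  finally have "card T < card E" .
  moreover have "finite T" "finite E" using assms by (auto simp: T_def E_def intro!: finite_PiE)
  ultimately obtain c where c: "\<exists>e\<in>E. c e \<noteq> 0" "\<And>t. t \<in> T \<Longrightarrow> (\<Sum>e\<in>E. c e * a e t) = 0"
    using homogeneous_system_nontrivial_solution[of T E a] by auto
  have "(\<Sum>e\<in>E. c e * monomial J (y p) e) = 0" if "p \<in> D" for p
  proof -
    have "(\<Sum>e\<in>E. c e * monomial J (y p) e) = (\<Sum>e\<in>E. \<Sum>t\<in>T. c e * a e t * monomial I (u p) t)"
      using a[OF _ that] by (intro sum.cong) (auto simp: sum_distrib_left mult.assoc)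
    also have "\<dots> = (\<Sum>t\<in>T. (\<Sum>e\<in>E. c e * a e t) * monomial I (u p) t)"
      by (subst sum.swap) (simp add: sum_distrib_right)
    finally show ?thesis using c(2) by simp
  qed
  then show ?thesis using c(1) by (auto simp: E_def)
qed

lemma expand_in_one_variable:
  assumes "finite J" "j \<notin> J"
  shows "(\<Sum>e\<in>exponents (insert j J) d. c e * monomial (insert j J) v e) =
    (\<Sum>k\<le>d. (\<Sum>e\<in>exponents J d. c (e(j := k)) * monomial J v e) * v j ^ k)"
proof -
  have bij: "bij_betw (\<lambda>(k, e). e(j := k)) ({..d} \<times> exponents J d) (exponents (insert j J) d)"
    using assms(2) by (auto simp: bij_betw_def PiE_insert_eq intro!: inj_combinator[of j J "\<lambda>_. {..d}", simplified])
  have "(\<Sum>e\<in>exponents (insert j J) d. c e * monomial (insert j J) v e) =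
    (\<Sum>(k, e)\<in>{..d} \<times> exponents J d. c (e(j := k)) * monomial (insert j J) v (e(j := k)))"
    by (subst sum.reindex_bij_betw[OF bij, symmetric]) (simp add: case_prod_beta)
  also have "\<dots> = (\<Sum>(k, e)\<in>{..d} \<times> exponents J d. c (e(j := k)) * monomial J v e * v j ^ k)"
  proof (intro sum.cong refl, clarify)
    fix k e
    have "(\<Prod>i\<in>J. v i ^ (e(j := k)) i) = (\<Prod>i\<in>J. v i ^ e i)"
      using assms by (intro prod.cong) auto
    then show "c (e(j := k)) * monomial (insert j J) v (e(j := k)) =
      c (e(j := k)) * monomial J v e * v j ^ k"
      using assms by (simp add: monomial_def del: fun_upd_apply) simp
  qed
  finally show ?thesis by (simp add: sum.cartesian_product[symmetric] sum_distrib_right)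
qed

lemma monomial_cong: "(\<And>i. i \<in> I \<Longrightarrow> v i = w i) \<Longrightarrow> monomial I v e = monomial I w e"
  unfolding monomial_def by (intro prod.cong) auto

lemma nonzero_coefficient_in_one_variable:
  assumes "j \<notin> J" "e0 \<in> exponents (insert j J) d" "c e0 \<noteq> (0 :: complex)"
  shows "\<exists>k\<le>d. \<exists>e\<in>exponents J d. c (e(j := k)) \<noteq> 0"
  using assms
  by (intro exI[of _ "e0 j"] conjI bexI[of _ "e0(j := undefined)"]) (auto simp: PiE_def extensional_def)

lemma polynomial_nonvanishing_point:
  assumes "finite J" "\<exists>e\<in>exponents J d. c e \<noteq> 0"
  shows "\<exists>v. (\<Sum>e\<in>exponents J d. c e * monomial J v e) \<noteq> 0"
  using assms
proof (induction J arbitrary: c rule: finite_induct)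
  case empty
  then show ?case by (auto simp: monomial_def)
next
  case (insert j J)
  obtain m where m: "m \<le> d" "\<exists>e\<in>exponents J d. c (e(j := m)) \<noteq> 0"
    using nonzero_coefficient_in_one_variable[OF insert.hyps(2)] insert.prems by metis
  obtain v where v: "(\<Sum>e\<in>exponents J d. c (e(j := m)) * monomial J v e) \<noteq> 0"
    using insert.IH[of "\<lambda>e. c (e(j := m))"] m(2) by auto
  define q where "q k = (\<Sum>e\<in>exponents J d. c (e(j := k)) * monomial J v e)" for k
  have "monomial J (v(j := t)) e = monomial J v e" for t e
    using insert.hyps by (intro monomial_cong) auto
  then have eq: "(\<Sum>e\<in>exponents (insert j J) d. c e * monomial (insert j J) (v(j := t)) e) =
      (\<Sum>k\<le>d. q k * t ^ k)" for t
    by (simp add: expand_in_one_variable[OF insert.hyps] q_def)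
  have "\<exists>t. (\<Sum>k\<le>d. q k * t ^ k) \<noteq> 0"
  proof (rule ccontr)
    assume "\<not> ?thesis"
    then have "\<forall>k\<le>d. q k = 0" using polyfun_eq_0[of q d] by auto
    then show False using v m(1) by (simp add: q_def)
  qed
  then show ?case unfolding eq[symmetric] by blast
qed

text \<open>
  Adjoining \<open>z\<close> to the \<open>y\<^sub>j\<close> gives too many functions to be independent. A relation between them,
  read as a polynomial in \<open>z\<close> whose coefficients are polynomials in the \<open>y\<^sub>j\<close>, is a nonzero
  polynomial in \<open>z\<close> wherever one chosen nonzero coefficient does not vanish, and then \<open>z\<close> is
  one of its finitely many roots. The index \<open>j0\<close> names the adjoined function.
\<close>

theorem generic_fibre_finite:
  assumes "finite I" "finite J" "card I \<le> card J" "j0 \<notin> J"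
    and y: "\<And>j. j \<in> J \<Longrightarrow> (\<lambda>p. y p j) \<in> polys_on D I u" and z: "z \<in> polys_on D I u"
  shows "\<exists>d c. (\<exists>e\<in>exponents J d. c e \<noteq> 0) \<and>
    (\<forall>v. (\<Sum>e\<in>exponents J d. c e * monomial J v e) \<noteq> 0 \<longrightarrow>
      finite {z p | p. p \<in> D \<and> (\<forall>j\<in>J. y p j = v j)})"
proof -
  define y' where "y' p = (y p)(j0 := z p)" for p
  have y': "(\<lambda>p. y' p j) \<in> polys_on D I u" if "j \<in> insert j0 J" for j
  proof (cases "j = j0")
    case True
    then show ?thesis using z by (simp add: y'_def)
  next
    case False
    then have "j \<in> J" "(\<lambda>p. y' p j) = (\<lambda>p. y p j)" using that by (auto simp: y'_def)
    then show ?thesis using y[of j] by simp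
  qed
  have card: "card I < card (insert j0 J)" using assms by simp
  have fin: "finite (insert j0 J)" using assms by simp
  have "\<exists>d c. (\<exists>e\<in>exponents (insert j0 J) d. c e \<noteq> 0) \<and>
      (\<forall>p\<in>D. (\<Sum>e\<in>exponents (insert j0 J) d. c e * monomial (insert j0 J) (y' p) e) = 0)"
    by (rule algebraic_dependence[OF assms(1) fin card]) (rule y')
  then obtain d c where c: "\<exists>e\<in>exponents (insert j0 J) d. c e \<noteq> 0" and
    rel: "\<forall>p\<in>D. (\<Sum>e\<in>exponents (insert j0 J) d. c e * monomial (insert j0 J) (y' p) e) = 0"
    by (elim exE conjE)
  obtain m where m: "m \<le> d" "\<exists>e\<in>exponents J d. c (e(j0 := m)) \<noteq> 0"
    using nonzero_coefficient_in_one_variable[OF assms(4)] c by metis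
  have "finite {z p | p. p \<in> D \<and> (\<forall>j\<in>J. y p j = v j)}"
    if v: "(\<Sum>e\<in>exponents J d. c (e(j0 := m)) * monomial J v e) \<noteq> 0" for v
  proof -
    define q where "q k = (\<Sum>e\<in>exponents J d. c (e(j0 := k)) * monomial J v e)" for k
    have root: "(\<Sum>k\<le>d. q k * z p ^ k) = 0" if "p \<in> D" "\<forall>j\<in>J. y p j = v j" for p
    proof -
      have "monomial J (y' p) e = monomial J v e" for e
        using that(2) assms(4) by (intro monomial_cong) (auto simp: y'_def)
      moreover have "y' p j0 = z p" by (simp add: y'_def)
      ultimately show ?thesis using bspec[OF rel that(1)]
        by (simp add: expand_in_one_variable[OF assms(2,4)] q_def)
    qed
    have "finite {t. (\<Sum>k\<le>d. q k * t ^ k) = 0}"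
      using polyfun_roots_finite[of q m d] v m(1) by (simp add: q_def)
    moreover have "{z p | p. p \<in> D \<and> (\<forall>j\<in>J. y p j = v j)} \<subseteq> {t. (\<Sum>k\<le>d. q k * t ^ k) = 0}"
    proof
      fix t assume "t \<in> {z p | p. p \<in> D \<and> (\<forall>j\<in>J. y p j = v j)}"
      then obtain p where "p \<in> D" "\<forall>j\<in>J. y p j = v j" "t = z p" by blast
      then show "t \<in> {t. (\<Sum>k\<le>d. q k * t ^ k) = 0}" using root by simp
    qed
    ultimately show ?thesis by (rule finite_subset[rotated])
  qed
  then show ?thesis using m(2)
    by (intro exI[of _ d] exI[of _ "\<lambda>e. c (e(j0 := m))"] conjI allI impI)
qed

section \<open>Row spaces, dimensions and flags\<close>

abbreviation row_comb :: "complex mat \<Rightarrow> complex vec \<Rightarrow> complex vec" where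
  "row_comb B c \<equiv> B\<^sup>T *\<^sub>v c"

lemma row_comb_carrier:
  assumes "B \<in> carrier_mat d n" shows "row_comb B c \<in> carrier_vec n"
  by (rule carrier_vecI) (use assms in simp)

lemma row_comb_index:
  assumes "B \<in> carrier_mat d n" "c \<in> carrier_vec d" "j < n"
  shows "row_comb B c $ j = (\<Sum>i<d. c $ i * B $$ (i, j))"
proof -
  have "row_comb B c $ j = (\<Sum>i\<in>{0..<d}. B $$ (i, j) * c $ i)"
    using assms by (simp add: scalar_prod_def)
  then show ?thesis by (simp add: mult.commute lessThan_atLeast0)
qed

lemma row_comb_mult:
  assumes "P \<in> carrier_mat d m" "A \<in> carrier_mat m n" "c \<in> carrier_vec d"
  shows "row_comb (P * A) c = row_comb A (row_comb P c)"
proof -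
  have "A\<^sup>T \<in> carrier_mat n m" "P\<^sup>T \<in> carrier_mat m d" using assms by auto
  from assoc_mult_mat_vec[OF this assms(3)] show ?thesis
    by (simp add: transpose_mult[OF assms(1,2)])
qed

lemma row_comb_unit:
  assumes "B \<in> carrier_mat d n" "i < d"
  shows "row_comb B (unit_vec d i) = row B i"
proof (rule eq_vecI)
  show "dim_vec (row_comb B (unit_vec d i)) = dim_vec (row B i)" using assms by simp
next
  fix j assume "j < dim_vec (row B i)"
  then have j: "j < n" using assms by simp
  have "row_comb B (unit_vec d i) $ j = (\<Sum>t<d. if t = i then B $$ (t, j) else 0)"
    unfolding row_comb_index[OF assms(1) unit_vec_carrier j]
    by (intro sum.cong) (auto simp: unit_vec_def)
  then show "row_comb B (unit_vec d i) $ j = row B i $ j" using assms j by simp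
qed

lemma row_comb_diff:
  assumes "B \<in> carrier_mat d n" "c \<in> carrier_vec d" "c' \<in> carrier_vec d"
  shows "row_comb B (c - c') = row_comb B c - row_comb B c'"
  using assms by (intro mult_minus_distrib_mat_vec[of _ n d]) auto

lemma subspace_iff:
  "VectorSpace.subspace class_ring W (space_V n) \<longleftrightarrow>
     W \<subseteq> carrier_vec n \<and> 0\<^sub>v n \<in> W \<and> (\<forall>v\<in>W. \<forall>w\<in>W. v + w \<in> W) \<and> (\<forall>c. \<forall>v\<in>W. c \<cdot>\<^sub>v v \<in> W)"
proof -
  have "module (class_ring :: complex ring) (space_V n)" "vectorspace (class_ring :: complex ring) (space_V n)"
    by (rule vec_module, rule vec_vs)
  then show ?thesis
    by (auto simp: VectorSpace.subspace_def submodule_def module_vec_simps class_ring_simps)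
qed

lemma subspace_diff:
  assumes "VectorSpace.subspace class_ring W (space_V n)" "v \<in> W" "w \<in> W"
  shows "v - w \<in> W"
proof -
  have W: "W \<subseteq> carrier_vec n" using assms by (simp add: subspace_iff)
  have "v + (-1) \<cdot>\<^sub>v w \<in> W" using assms by (simp add: subspace_iff)
  also have "v + (-1) \<cdot>\<^sub>v w = v - w"
    using W assms by (intro eq_vecI) auto
  finally show ?thesis .
qed

lemma row_span_eq:
  assumes "B \<in> carrier_mat d n"
  shows "row_span n B = row_comb B ` carrier_vec d"
proof -
  interpret vec_space "TYPE(complex)" n .
  have "row_span n B = row_space B" by (simp add: row_span_def row_space_def)
  then show ?thesis using assms by (auto simp: row_space_eq[OF assms])
qed

lemma row_span_subspace:
  assumes "B \<in> carrier_mat d n"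
  shows "VectorSpace.subspace class_ring (row_span n B) (space_V n)"
  unfolding subspace_iff row_span_eq[OF assms]
proof (intro conjI ballI allI)
  show "row_comb B ` carrier_vec d \<subseteq> carrier_vec n" using row_comb_carrier[OF assms] by blast
  show "0\<^sub>v n \<in> row_comb B ` carrier_vec d"
    by (rule image_eqI[of _ _ "0\<^sub>v d"], rule eq_vecI) (use assms in simp_all)
next
  fix v w assume "v \<in> row_comb B ` carrier_vec d" "w \<in> row_comb B ` carrier_vec d"
  then obtain a b where "a \<in> carrier_vec d" "b \<in> carrier_vec d" "v = row_comb B a" "w = row_comb B b"
    by auto
  then show "v + w \<in> row_comb B ` carrier_vec d"
    using assms mult_add_distrib_mat_vec[of "B\<^sup>T" n d a b] by (intro image_eqI[of _ _ "a + b"]) simp_all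
next
  fix c v assume "v \<in> row_comb B ` carrier_vec d"
  then obtain a where "a \<in> carrier_vec d" "v = row_comb B a" by auto
  then show "c \<cdot>\<^sub>v v \<in> row_comb B ` carrier_vec d"
    using assms mult_mat_vec[of "B\<^sup>T" n d a c] by (intro image_eqI[of _ _ "c \<cdot>\<^sub>v a"]) simp_all
qed

lemma distinct_rows_if_trivial_kernel:
  assumes B: "B \<in> carrier_mat d n"
    and ker: "\<And>c. c \<in> carrier_vec d \<Longrightarrow> row_comb B c = 0\<^sub>v n \<Longrightarrow> c = 0\<^sub>v d"
  shows "distinct (cols B\<^sup>T)"
  unfolding distinct_conv_nth
proof (intro allI impI)
  fix i j assume ij: "i < length (cols B\<^sup>T)" "j < length (cols B\<^sup>T)" "i \<noteq> j"
  then have ij': "i < d" "j < d" using B by auto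
  show "cols B\<^sup>T ! i \<noteq> cols B\<^sup>T ! j"
  proof
    assume "cols B\<^sup>T ! i = cols B\<^sup>T ! j"
    then have "row B i = row B j" using ij' B by simp
    then have "row_comb B (unit_vec d i - unit_vec d j) = 0\<^sub>v n"
      using B ij' row_comb_unit[OF B]
      by (subst row_comb_diff[OF B]) (auto intro!: eq_vecI)
    from ker[OF _ this] have "(unit_vec d i - unit_vec d j :: complex vec) $ i = 0" using ij' by simp
    then show False using ij' ij(3) by (simp add: unit_vec_def)
  qed
qed

text \<open>
  A full rank criterion that avoids bases: linear independence of the rows is stated as triviality
  of the kernel of \<open>row_comb B\<close>, which is how it is always verified below.
\<close>

lemma sdim_row_span:
  assumes B: "B \<in> carrier_mat d n"
    and ker: "\<And>c. c \<in> carrier_vec d \<Longrightarrow> row_comb B c = 0\<^sub>v n \<Longrightarrow> c = 0\<^sub>v d"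
  shows "sdim n (row_span n B) = d"
proof -
  interpret vec_space "TYPE(complex)" n .
  have Bt: "B\<^sup>T \<in> carrier_mat n d" using B by simp
  note dist = distinct_rows_if_trivial_kernel[OF B ker]
  have "lin_indpt (set (cols B\<^sup>T))"
    using lin_depE[OF Bt _ dist] ker by blast
  from lin_indpt_full_rank[OF Bt dist this] show ?thesis
    by (simp add: rank_def sdim_def row_span_def)
qed

definition standard_flag :: "nat \<Rightarrow> nat \<Rightarrow> complex vec set" where
  "standard_flag n j = {c \<in> carrier_vec n. \<forall>i<n. j \<le> i \<longrightarrow> c $ i = 0}"

definition first_rows :: "nat \<Rightarrow> complex mat \<Rightarrow> complex mat" where
  "first_rows m B = mat m (dim_col B) (\<lambda>(i, j). B $$ (i, j))"

lemma row_comb_first_rows: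
  assumes "B \<in> carrier_mat d n" "m \<le> d" "c \<in> carrier_vec m"
  shows "row_comb (first_rows m B) c = row_comb B (vec d (\<lambda>i. if i < m then c $ i else 0))"
proof (rule eq_vecI)
  have B': "first_rows m B \<in> carrier_mat m n" using assms by (simp add: first_rows_def)
  show "dim_vec (row_comb (first_rows m B) c) =
      dim_vec (row_comb B (vec d (\<lambda>i. if i < m then c $ i else 0)))" using assms B' by simp
  fix j assume "j < dim_vec (row_comb B (vec d (\<lambda>i. if i < m then c $ i else 0)))"
  then have j: "j < n" using assms by simp
  have "(\<Sum>i<d. (if i < m then c $ i else 0) * B $$ (i, j)) = (\<Sum>i<m. c $ i * B $$ (i, j))"
    using assms(2) by (intro sum.mono_neutral_cong_right) auto
  then show "row_comb (first_rows m B) c $ j =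
      row_comb B (vec d (\<lambda>i. if i < m then c $ i else 0)) $ j"
    using assms j unfolding row_comb_index[OF B' assms(3) j] row_comb_index[OF assms(1) vec_carrier j]
    by (simp add: first_rows_def)
qed

lemma row_span_first_rows:
  assumes "B \<in> carrier_mat d n" "m \<le> d"
  shows "row_span n (first_rows m B) = row_comb B ` standard_flag d m"
proof -
  have B': "first_rows m B \<in> carrier_mat m n" using assms by (simp add: first_rows_def)
  show ?thesis unfolding row_span_eq[OF B']
  proof (intro equalityI subsetI)
    fix v assume "v \<in> row_comb (first_rows m B) ` carrier_vec m"
    then obtain c where "c \<in> carrier_vec m" "v = row_comb (first_rows m B) c" by auto
    then have "v = row_comb B (vec d (\<lambda>i. if i < m then c $ i else 0))"
      using row_comb_first_rows[OF assms] by simp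
    then show "v \<in> row_comb B ` standard_flag d m"
      by (rule image_eqI) (simp add: standard_flag_def)
  next
    fix v assume "v \<in> row_comb B ` standard_flag d m"
    then obtain c where c: "c \<in> standard_flag d m" "v = row_comb B c" by auto
    have "c = vec d (\<lambda>i. if i < m then vec m (($) c) $ i else 0)"
      using c(1) by (intro eq_vecI) (auto simp: standard_flag_def)
    then have "v = row_comb (first_rows m B) (vec m (($) c))"
      using c row_comb_first_rows[OF assms, of "vec m (($) c)"] by simp
    then show "v \<in> row_comb (first_rows m B) ` carrier_vec m" by (rule image_eqI) simp
  qed
qed

lemma row_comb_standard_flag_Gr:
  assumes B: "B \<in> carrier_mat d n" and "m \<le> d"
    and ker: "\<And>c. c \<in> carrier_vec d \<Longrightarrow> row_comb B c = 0\<^sub>v n \<Longrightarrow> c = 0\<^sub>v d"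
  shows "row_comb B ` standard_flag d m \<in> Gr m n"
proof -
  have B': "first_rows m B \<in> carrier_mat m n" using assms by (simp add: first_rows_def)
  have "sdim n (row_span n (first_rows m B)) = m"
  proof (rule sdim_row_span[OF B'])
    fix c assume c: "c \<in> carrier_vec m" "row_comb (first_rows m B) c = 0\<^sub>v n"
    then have "vec d (\<lambda>i. if i < m then c $ i else 0) = 0\<^sub>v d"
      using row_comb_first_rows[OF B assms(2)] ker by simp
    then have zero: "vec d (\<lambda>i. if i < m then c $ i else 0) $ i = 0" if "i < d" for i
      using that by simp
    have "c $ i = 0" if "i < m" for i
      using zero[of i] that assms(2) by simp
    then show "c = 0\<^sub>v m" using c
      by (intro eq_vecI) auto
  qed
  then show ?thesis using row_span_subspace[OF B']
    by (simp add: Gr_def row_span_first_rows[OF B assms(2)])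
qed

lemma standard_flag_full: "standard_flag d d = carrier_vec d"
  by (auto simp: standard_flag_def)

lemma row_span_Gr:
  assumes B: "B \<in> carrier_mat d n"
    and ker: "\<And>c. c \<in> carrier_vec d \<Longrightarrow> row_comb B c = 0\<^sub>v n \<Longrightarrow> c = 0\<^sub>v d"
  shows "row_span n B \<in> Gr d n"
  using row_comb_standard_flag_Gr[OF B le_refl ker] row_span_eq[OF B] by (simp add: standard_flag_full)

lemma invertible_inverse:
  assumes "A \<in> carrier_mat n n" "invertible_mat A"
  obtains A' where "A' \<in> carrier_mat n n" "A * A' = 1\<^sub>m n" "A' * A = 1\<^sub>m n"
proof -
  obtain A' where A': "A * A' = 1\<^sub>m n" "A' * A = 1\<^sub>m (dim_row A')"
    using assms by (auto simp: invertible_mat_def inverts_mat_def)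
  have "dim_col A' = n" by (metis A'(1) index_mult_mat(3) index_one_mat(3))
  moreover have "dim_row A' = n" by (metis A'(2) assms(1) carrier_matD(2) index_mult_mat(3) index_one_mat(3))
  ultimately show ?thesis using A' by (intro that[of A']) auto
qed

lemma invertible_row_comb:
  assumes "A \<in> carrier_mat n n" "invertible_mat A"
  shows "bij_betw (row_comb A) (carrier_vec n) (carrier_vec n)"
proof -
  obtain A' where A': "A' \<in> carrier_mat n n" "A * A' = 1\<^sub>m n" "A' * A = 1\<^sub>m n"
    using invertible_inverse[OF assms] .
  have "row_comb A' (row_comb A v) = v" "row_comb A (row_comb A' v) = v" if "v \<in> carrier_vec n" for v
    using row_comb_mult[OF assms(1) A'(1) that] row_comb_mult[OF A'(1) assms(1) that] A' that by auto
  then show ?thesis using assms A'(1)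
    by (intro bij_betwI[of _ _ _ "row_comb A'"]) auto
qed

lemma invertible_row_comb_inj:
  assumes "A \<in> carrier_mat n n" "invertible_mat A" "v \<in> carrier_vec n" "w \<in> carrier_vec n"
    "row_comb A v = row_comb A w"
  shows "v = w"
  using invertible_row_comb[OF assms(1,2)] assms(3-5) by (auto simp: bij_betw_def inj_on_def)

lemma invertible_row_comb_ker:
  assumes "A \<in> carrier_mat n n" "invertible_mat A" "v \<in> carrier_vec n" "row_comb A v = 0\<^sub>v n"
  shows "v = 0\<^sub>v n"
proof (rule invertible_row_comb_inj[OF assms(1-3) zero_carrier_vec])
  have "row_comb A (0\<^sub>v n) = 0\<^sub>v n" using assms(1) by (intro eq_vecI) auto
  then show "row_comb A v = row_comb A (0\<^sub>v n)" using assms(4) by simp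
qed

text \<open>
  In the coordinates given by the rows of \<open>A\<close>, the flag represented by \<open>A\<close> is the standard flag. All
  statements about \<open>H \<inter> F\<^sub>j\<close> are thus reduced to vanishing of coordinates.
\<close>

lemma represents_flag_member:
  assumes "represents n A F" "1 \<le> j" "j \<le> n"
  shows "F ! j = row_comb A ` standard_flag n j"
proof -
  have A: "A \<in> carrier_mat n n" using assms by (simp add: represents_def)
  have "rows (first_rows j A) = take j (rows A)"
    using A assms(3) by (intro nth_equalityI) (auto simp: first_rows_def intro!: eq_vecI)
  then have "F ! j = row_span n (first_rows j A)"
    using assms by (simp add: represents_def row_span_def)
  then show ?thesis by (simp add: row_span_first_rows[OF A assms(3)])
qed

section \<open>Echelon forms and Schubert varieties\<close>

lemma increasing_listsD:
  assumes "\<gamma> \<in> increasing_lists n k"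
  shows "length \<gamma> = k" and "\<And>i. i < k \<Longrightarrow> 1 \<le> \<gamma> ! i \<and> \<gamma> ! i \<le> n"
    and "\<And>i j. i < j \<Longrightarrow> j < k \<Longrightarrow> \<gamma> ! i < \<gamma> ! j"
    and "\<And>i j. i < k \<Longrightarrow> j < k \<Longrightarrow> \<gamma> ! i \<le> \<gamma> ! j \<longleftrightarrow> i \<le> j"
    and "distinct \<gamma>"
proof -
  show len: "length \<gamma> = k" using assms by (simp add: increasing_lists_def)
  have sub: "set \<gamma> \<subseteq> {1..n}" using assms by (simp add: increasing_lists_def)
  show "1 \<le> \<gamma> ! i \<and> \<gamma> ! i \<le> n" if "i < k" for i
    using subsetD[OF sub nth_mem[of i \<gamma>]] that len by simp
  show less: "\<gamma> ! i < \<gamma> ! j" if "i < j" "j < k" for i j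
    using assms that by (auto simp: increasing_lists_def sorted_wrt_iff_nth_less)
  show "\<gamma> ! i \<le> \<gamma> ! j \<longleftrightarrow> i \<le> j" if "i < k" "j < k" for i j
    using less[of i j] less[of j i] that by (cases i j rule: linorder_cases) auto
  show "distinct \<gamma>" using assms by (auto simp: increasing_lists_def strict_sorted_iff)
qed

lemma M_carrier: "P \<in> M n \<gamma> \<Longrightarrow> length \<gamma> = k \<Longrightarrow> P \<in> carrier_mat k n"
  by (simp add: M_def)

lemma M_pivot:
  assumes "P \<in> M n \<gamma>" "i < length \<gamma>" "j < length \<gamma>"
  shows "P $$ (i, \<gamma> ! j - 1) = (if i = j then 1 else 0)"
  using assms by (simp add: M_def)

lemma M_zero:
  assumes "P \<in> M n \<gamma>" "i < length \<gamma>" "\<gamma> ! i \<le> x" "x < n"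
  shows "P $$ (i, x) = 0"
proof -
  have "Suc x \<in> {1..n}" "\<gamma> ! i < Suc x" using assms by auto
  then have "P $$ (i, Suc x - 1) = 0" using assms by (auto simp only: M_def)
  then show ?thesis by simp
qed

text \<open>
  The pivot columns of \<open>P\<close> form an identity matrix, so a linear combination of the rows shows its own
  coefficients in the pivot positions. Independence of the rows and uniqueness of echelon forms
  follow from this.
\<close>

lemma row_comb_pivot:
  assumes "\<gamma> \<in> increasing_lists n k" "P \<in> M n \<gamma>" "c \<in> carrier_vec k" "i < k"
  shows "row_comb P c $ (\<gamma> ! i - 1) = c $ i"
proof -
  note \<gamma> = increasing_listsD[OF assms(1)]
  have "\<gamma> ! i - 1 < n" using \<gamma>(2)[OF assms(4)] by linarith
  then have "row_comb P c $ (\<gamma> ! i - 1) = (\<Sum>t<k. c $ t * P $$ (t, \<gamma> ! i - 1))"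
    by (rule row_comb_index[OF M_carrier[OF assms(2) \<gamma>(1)] assms(3)])
  also have "\<dots> = (\<Sum>t<k. if t = i then c $ t else 0)"
    using assms \<gamma>(1) by (intro sum.cong) (auto simp: M_pivot simp del: One_nat_def)
  finally show ?thesis using assms by simp
qed

lemma row_comb_M_in_standard_flag:
  assumes "\<gamma> \<in> increasing_lists n k" "P \<in> M n \<gamma>" "c \<in> carrier_vec k"
  shows "row_comb P c \<in> standard_flag n j \<longleftrightarrow> (\<forall>i<k. j < \<gamma> ! i \<longrightarrow> c $ i = 0)"
proof
  note \<gamma> = increasing_listsD[OF assms(1)]
  assume L: "row_comb P c \<in> standard_flag n j"
  show "\<forall>i<k. j < \<gamma> ! i \<longrightarrow> c $ i = 0"
  proof (intro allI impI)
    fix i assume i: "i < k" "j < \<gamma> ! i"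
    then have "\<gamma> ! i - 1 < n" "j \<le> \<gamma> ! i - 1" using \<gamma>(2)[OF i(1)] by auto
    then have "row_comb P c $ (\<gamma> ! i - 1) = 0" using L by (simp add: standard_flag_def)
    then show "c $ i = 0" using row_comb_pivot[OF assms i(1)] by simp
  qed
next
  note \<gamma> = increasing_listsD[OF assms(1)]
  note P = M_carrier[OF assms(2) \<gamma>(1)]
  assume R: "\<forall>i<k. j < \<gamma> ! i \<longrightarrow> c $ i = 0"
  have "row_comb P c $ x = 0" if x: "x < n" "j \<le> x" for x
  proof -
    have "c $ i * P $$ (i, x) = 0" if "i < k" for i
    proof (cases "j < \<gamma> ! i")
      case True
      then show ?thesis using R that by simp
    next
      case False
      then show ?thesis using M_zero[OF assms(2), of i x] x that \<gamma>(1) by simp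
    qed
    then show ?thesis unfolding row_comb_index[OF P assms(3) x(1)] by (intro sum.neutral) simp
  qed
  then show "row_comb P c \<in> standard_flag n j"
    using row_comb_carrier[OF P] by (simp add: standard_flag_def)
qed

lemma M_trivial_kernel:
  assumes "\<gamma> \<in> increasing_lists n k" "P \<in> M n \<gamma>" "c \<in> carrier_vec k" "row_comb P c = 0\<^sub>v n"
  shows "c = 0\<^sub>v k"
proof (rule eq_vecI)
  fix i assume "i < dim_vec (0\<^sub>v k :: complex vec)"
  then have i: "i < k" by simp
  then have "\<gamma> ! i - 1 < n" using increasing_listsD(2)[OF assms(1) i] by linarith
  then show "c $ i = 0\<^sub>v k $ i" using row_comb_pivot[OF assms(1-3) i] assms(4) i by simp
qed (use assms in simp)

lemma M_mult_trivial_kernel: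
  assumes "\<gamma> \<in> increasing_lists n k" "P \<in> M n \<gamma>" "A \<in> carrier_mat n n" "invertible_mat A"
    "c \<in> carrier_vec k" "row_comb (P * A) c = 0\<^sub>v n"
  shows "c = 0\<^sub>v k"
proof -
  note P = M_carrier[OF assms(2) increasing_listsD(1)[OF assms(1)]]
  have "row_comb A (row_comb P c) = 0\<^sub>v n" using row_comb_mult[OF P assms(3,5)] assms(6) by simp
  from invertible_row_comb_ker[OF assms(3,4) row_comb_carrier[OF P] this]
  show ?thesis by (rule M_trivial_kernel[OF assms(1,2,5)])
qed

lemma M_mult_row_span_Gr:
  assumes "\<gamma> \<in> increasing_lists n k" "P \<in> M n \<gamma>" "A \<in> carrier_mat n n" "invertible_mat A"
  shows "row_span n (P * A) \<in> Gr k n"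
proof (rule row_span_Gr)
  show "P * A \<in> carrier_mat k n"
    using M_carrier[OF assms(2) increasing_listsD(1)[OF assms(1)]] assms(3) by simp
qed (rule M_mult_trivial_kernel[OF assms])

lemma row_comb_snoc:
  assumes P: "P \<in> carrier_mat k n" and w: "w \<in> carrier_vec n" and c: "c \<in> carrier_vec (Suc k)"
  defines "P' \<equiv> mat (Suc k) n (\<lambda>(i, x). if i < k then P $$ (i, x) else w $ x)"
  shows "row_comb P' c = row_comb P (vec k (($) c)) + c $ k \<cdot>\<^sub>v w"
proof (rule eq_vecI)
  have P': "P' \<in> carrier_mat (Suc k) n" by (simp add: P'_def)
  show "dim_vec (row_comb P' c) = dim_vec (row_comb P (vec k (($) c)) + c $ k \<cdot>\<^sub>v w)"
    using P' w by simp
  fix x assume "x < dim_vec (row_comb P (vec k (($) c)) + c $ k \<cdot>\<^sub>v w)"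
  then have x: "x < n" using w by simp
  have "row_comb P' c $ x = (\<Sum>i<k. c $ i * P $$ (i, x)) + c $ k * w $ x"
    unfolding row_comb_index[OF P' c x] using x by (simp add: P'_def)
  also have "\<dots> = row_comb P (vec k (($) c)) $ x + (c $ k \<cdot>\<^sub>v w) $ x"
    unfolding row_comb_index[OF P vec_carrier x] using x w by simp
  finally show "row_comb P' c $ x = (row_comb P (vec k (($) c)) + c $ k \<cdot>\<^sub>v w) $ x"
    using x w by simp
qed

text \<open>
  Induction on \<open>j\<close>. If \<open>W\<close> contains a vector with a nonzero coordinate in position \<open>j\<close> (counted from 0),
  normalize it to 1, clear its entries at the pivots of an echelon basis of \<open>W \<inter> standard_flag n j\<close>,
  and append it as a new last row with pivot \<open>Suc j\<close>.
\<close>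

lemma echelon_basis_exists:
  assumes "VectorSpace.subspace class_ring W (space_V n)" "W \<subseteq> standard_flag n j" "j \<le> n"
  shows "\<exists>k \<gamma> P. \<gamma> \<in> increasing_lists n k \<and> set \<gamma> \<subseteq> {1..j} \<and> P \<in> M n \<gamma> \<and> W = row_span n P"
  using assms
proof (induction j arbitrary: W)
  case 0
  have "v = 0\<^sub>v n" if "v \<in> W" for v
  proof (rule eq_vecI)
    have v: "v \<in> standard_flag n 0" using 0(2) that by blast
    then show "dim_vec v = dim_vec (0\<^sub>v n :: complex vec)" by (simp add: standard_flag_def)
    fix i assume "i < dim_vec (0\<^sub>v n :: complex vec)"
    then show "v $ i = 0\<^sub>v n $ i" using v by (simp add: standard_flag_def)
  qed
  moreover have "0\<^sub>v n \<in> W" using 0(1) by (simp add: subspace_iff)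
  ultimately have W: "W = {0\<^sub>v n}" by blast
  define P :: "complex mat" where "P = 0\<^sub>m 0 n"
  have P: "P \<in> carrier_mat 0 n" by (simp add: P_def)
  have zero: "row_comb P c = 0\<^sub>v n" if "c \<in> carrier_vec 0" for c
  proof (rule eq_vecI)
    fix x assume "x < dim_vec (0\<^sub>v n :: complex vec)"
    then show "row_comb P c $ x = 0\<^sub>v n $ x" using row_comb_index[OF P that, of x] by simp
  qed (simp add: P_def)
  have "row_comb P ` carrier_vec 0 = (\<lambda>_. 0\<^sub>v n) ` (carrier_vec 0 :: complex vec set)"
    by (intro image_cong refl zero)
  also have "\<dots> = {0\<^sub>v n}" by (rule image_constant[of "0\<^sub>v 0"]) simp
  finally have "row_comb P ` carrier_vec 0 = {0\<^sub>v n}" .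
  then have "W = row_span n P" using W by (simp add: row_span_eq[OF P])
  moreover have "[] \<in> increasing_lists n 0" "P \<in> M n []"
    by (simp_all add: increasing_lists_def M_def P_def)
  moreover have "set [] \<subseteq> {1..0::nat}" by simp
  ultimately show ?case by blast
next
  case (Suc j)
  note W = Suc.prems(1)[unfolded subspace_iff]
  define W' where "W' = W \<inter> standard_flag n j"
  have W'_sub: "VectorSpace.subspace class_ring W' (space_V n)"
    using W by (auto simp: subspace_iff W'_def standard_flag_def)
  have "W' \<subseteq> standard_flag n j" "j \<le> n" using Suc.prems(3) by (auto simp: W'_def)
  from Suc.IH[OF W'_sub this] obtain k \<gamma> P where
    \<gamma>: "\<gamma> \<in> increasing_lists n k" "set \<gamma> \<subseteq> {1..j}" and P: "P \<in> M n \<gamma>" and WP: "W' = row_span n P"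
    by auto
  note len = increasing_listsD(1)[OF \<gamma>(1)]
  note Pc = M_carrier[OF P len]
  have le: "1 \<le> \<gamma> ! i \<and> \<gamma> ! i \<le> j" if "i < k" for i
    using subsetD[OF \<gamma>(2) nth_mem[of i \<gamma>]] that len by simp
  show ?case
  proof (cases "W = W'")
    case True
    then show ?thesis using \<gamma> P WP by fastforce
  next
    case False
    then obtain w0 where w0: "w0 \<in> W" "w0 \<notin> standard_flag n j" by (auto simp: W'_def)
    have w0c: "w0 \<in> carrier_vec n" using W w0(1) by auto
    have w0f: "w0 \<in> standard_flag n (Suc j)" using Suc.prems(2) w0(1) by auto
    have w0j: "w0 $ j \<noteq> 0"
    proof
      assume 0: "w0 $ j = 0"
      have "w0 $ i = 0" if "i < n" "j \<le> i" for i
        using w0f 0 that by (cases "i = j") (auto simp: standard_flag_def)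
      then show False using w0(2) w0c by (simp add: standard_flag_def)
    qed
    define w1 where "w1 = (1 / w0 $ j) \<cdot>\<^sub>v w0"
    have w1: "w1 \<in> W" "w1 \<in> carrier_vec n" "w1 $ j = 1"
      using W w0 w0c w0j Suc.prems(3) by (auto simp: w1_def)
    (* Subtracting this combination of the rows of P clears the entries of w1 at the old pivots. *)
    define a where "a = vec k (\<lambda>i. w1 $ (\<gamma> ! i - 1))"
    have a: "a \<in> carrier_vec k" by (simp add: a_def)
    define u where "u = row_comb P a"
    have u: "u \<in> W'" "u \<in> carrier_vec n" using a row_comb_carrier[OF Pc]
      by (auto simp: u_def WP row_span_eq[OF Pc])
    define w where "w = w1 - u"
    have wW: "w \<in> W" using subspace_diff[OF Suc.prems(1) w1(1)] u(1) by (simp add: w_def W'_def)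
    have wc: "w \<in> carrier_vec n" using w1 u by (simp add: w_def)
    have wj: "w $ j = 1" using u w1 Suc.prems(3) by (simp add: w_def W'_def standard_flag_def)
    have wpiv: "w $ (\<gamma> ! i - 1) = 0" if "i < k" for i
    proof -
      have x: "\<gamma> ! i - 1 < n" using le[OF that] Suc.prems(3) by linarith
      have "u $ (\<gamma> ! i - 1) = w1 $ (\<gamma> ! i - 1)"
        unfolding u_def row_comb_pivot[OF \<gamma>(1) P a that] using that by (simp add: a_def)
      then show ?thesis using x u(2) w1(2) unfolding w_def by (simp del: One_nat_def)
    qed
    have wz: "w $ x = 0" if "Suc j \<le> x" "x < n" for x
      using subsetD[OF Suc.prems(2) wW] that by (simp add: standard_flag_def)
    define \<gamma>' where "\<gamma>' = \<gamma> @ [Suc j]"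
    define P' where "P' = mat (Suc k) n (\<lambda>(i, x). if i < k then P $$ (i, x) else w $ x)"
    have P'c: "P' \<in> carrier_mat (Suc k) n" by (simp add: P'_def)
    have \<gamma>': "\<gamma>' \<in> increasing_lists n (Suc k)"
      using \<gamma> Suc.prems(3) by (auto simp: increasing_lists_def \<gamma>'_def sorted_wrt_append)
    have len': "length \<gamma>' = Suc k" using len by (simp add: \<gamma>'_def)
    have nth': "\<gamma>' ! i = (if i < k then \<gamma> ! i else Suc j)" if "i < Suc k" for i
      using that len by (auto simp: \<gamma>'_def nth_append less_Suc_eq)
    have "P' \<in> M n \<gamma>'"
      unfolding M_def len'
    proof (intro CollectI conjI allI ballI impI)
      fix i t assume it: "i < Suc k" "t < Suc k"
      have "P $$ (i, j) = 0" if "i < k"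
        using M_zero[OF P, of i j] that len le[OF that] Suc.prems(3) by simp
      then show "P' $$ (i, \<gamma>' ! t - 1) = (if i = t then 1 else 0)"
        using it le[of t] Suc.prems(3) wj wpiv[of t] M_pivot[OF P, of i t] len
        by (auto simp: nth' P'_def less_Suc_eq)
    next
      fix i x assume i: "i < Suc k" and x: "x \<in> {1..n}" "\<gamma>' ! i < x"
      then show "P' $$ (i, x - 1) = 0"
        using M_zero[OF P, of i "x - 1"] wz[of "x - 1"] len by (auto simp: nth' P'_def less_Suc_eq)
    qed (rule P'c)
    moreover have "W = row_span n P'"
      unfolding row_span_eq[OF P'c]
    proof (intro equalityI subsetI)
      fix v assume v: "v \<in> W"
      have vc: "v \<in> carrier_vec n" using v W by auto
      define v' where "v' = v - v $ j \<cdot>\<^sub>v w"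
      have "v' \<in> W" unfolding v'_def
        by (rule subspace_diff[OF Suc.prems(1) v]) (use W wW in blast)
      moreover have "v' \<in> standard_flag n j"
      proof -
        have "v' $ x = 0" if x: "x < n" "j \<le> x" for x
        proof (cases "x = j")
          case True
          then show ?thesis using x vc wc wj by (simp add: v'_def)
        next
          case False
          then have "v $ x = 0" using subsetD[OF Suc.prems(2) v] x by (simp add: standard_flag_def)
          then show ?thesis using x vc wc wz[of x] False by (simp add: v'_def)
        qed
        moreover have "v' \<in> carrier_vec n" using vc wc by (simp add: v'_def)
        ultimately show ?thesis unfolding standard_flag_def by blast
      qed
      ultimately have "v' \<in> W'" by (simp add: W'_def)
      then have "v' \<in> row_comb P ` carrier_vec k" unfolding WP row_span_eq[OF Pc] .
      then obtain b where b: "b \<in> carrier_vec k" "v' = row_comb P b" by auto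
      define c where "c = vec (Suc k) (\<lambda>i. if i < k then b $ i else v $ j)"
      have c: "c \<in> carrier_vec (Suc k)" "vec k (($) c) = b" "c $ k = v $ j"
        using b by (auto simp: c_def intro!: eq_vecI)
      have "row_comb P' c = v' + v $ j \<cdot>\<^sub>v w"
        using row_comb_snoc[OF Pc wc c(1)] c b by (simp add: P'_def)
      also have "\<dots> = v" using vc wc by (auto simp: v'_def intro!: eq_vecI)
      finally show "v \<in> row_comb P' ` carrier_vec (Suc k)" using c(1) by blast
    next
      fix v assume "v \<in> row_comb P' ` carrier_vec (Suc k)"
      then obtain c where c: "c \<in> carrier_vec (Suc k)" "v = row_comb P' c" by auto
      have "row_comb P (vec k (($) c)) \<in> W'" unfolding WP row_span_eq[OF Pc] by simp
      then have "row_comb P (vec k (($) c)) \<in> W" by (simp add: W'_def)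
      moreover have "c $ k \<cdot>\<^sub>v w \<in> W" using W wW by blast
      ultimately show "v \<in> W"
        using W row_comb_snoc[OF Pc wc c(1)] c(2) by (simp add: P'_def)
    qed
    moreover have "set \<gamma>' \<subseteq> {1..Suc j}" using \<gamma>(2) by (auto simp: \<gamma>'_def)
    ultimately show ?thesis using \<gamma>' by blast
  qed
qed

lemma row_span_mult:
  assumes "P \<in> carrier_mat k m" "A \<in> carrier_mat m n"
  shows "row_span n (P * A) = row_comb A ` row_span m P"
proof -
  have PA: "P * A \<in> carrier_mat k n" using assms by simp
  show ?thesis unfolding row_span_eq[OF PA] row_span_eq[OF assms(1)] image_image
    by (intro image_cong refl row_comb_mult[OF assms])
qed

text \<open>
  The echelon basis is taken of the subspace of coordinate vectors of \<open>H\<close> with respect to the rows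
  of \<open>A\<close>.
\<close>

lemma Gr_echelon_form:
  assumes H: "H \<in> Gr k n" and A: "A \<in> carrier_mat n n" "invertible_mat A"
  shows "\<exists>\<gamma> P. \<gamma> \<in> increasing_lists n k \<and> P \<in> M n \<gamma> \<and> H = row_span n (P * A)"
proof -
  have Hs: "H \<subseteq> carrier_vec n" "0\<^sub>v n \<in> H" "\<And>v w. v \<in> H \<Longrightarrow> w \<in> H \<Longrightarrow> v + w \<in> H"
     "\<And>c v. v \<in> H \<Longrightarrow> c \<cdot>\<^sub>v v \<in> H"
    using H by (auto simp: Gr_def subspace_iff)
  have At: "A\<^sup>T \<in> carrier_mat n n" using A by simp
  define W where "W = {v \<in> carrier_vec n. row_comb A v \<in> H}"
  have "row_comb A (0\<^sub>v n) = 0\<^sub>v n" using A(1) by (intro eq_vecI) auto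
  then have "VectorSpace.subspace class_ring W (space_V n)"
    using Hs mult_add_distrib_mat_vec[OF At] mult_mat_vec[OF At]
    by (auto simp: subspace_iff W_def)
  moreover have "W \<subseteq> standard_flag n n" by (auto simp: W_def standard_flag_full)
  ultimately obtain k' \<gamma> P where \<gamma>: "\<gamma> \<in> increasing_lists n k'" and P: "P \<in> M n \<gamma>" and WP: "W = row_span n P"
    using echelon_basis_exists[of W n n] by auto
  note Pc = M_carrier[OF P increasing_listsD(1)[OF \<gamma>]]
  have "H = row_comb A ` W"
    using Hs(1) invertible_row_comb[OF A] by (auto simp: W_def bij_betw_def)
  then have HP: "H = row_span n (P * A)" using row_span_mult[OF Pc A(1)] WP by simp
  then have "H \<in> Gr k' n" using M_mult_row_span_Gr[OF \<gamma> P A] by simp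
  then have "k' = k" using H by (simp add: Gr_def)
  then show ?thesis using \<gamma> P HP by auto
qed

text \<open>
  A combination of the rows of \<open>P * A\<close> lies in \<open>F\<^sub>j\<close> iff it only uses rows with pivot at most \<open>j\<close>. As the
  pivots increase, these are the first rows.
\<close>

lemma sdim_row_span_inter_flag:
  assumes \<gamma>: "\<gamma> \<in> increasing_lists n k" and P: "P \<in> M n \<gamma>" and A: "represents n A F"
    and j: "1 \<le> j" "j \<le> n"
  shows "sdim n (row_span n (P * A) \<inter> F ! j) = card {i. i < k \<and> \<gamma> ! i \<le> j}"
proof -
  have Ac: "A \<in> carrier_mat n n" "invertible_mat A" using A by (auto simp: represents_def)
  note g = increasing_listsD[OF \<gamma>]
  note Pc = M_carrier[OF P g(1)]
  have PA: "P * A \<in> carrier_mat k n" using Pc Ac by simp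
  define m where "m = card {i. i < k \<and> \<gamma> ! i \<le> j}"
  define S where "S = {i. i < k \<and> \<gamma> ! i \<le> j}"
  have S: "i \<in> S \<longleftrightarrow> i < m" if "i < k" for i
  proof
    assume "i \<in> S"
    have "{..i} \<subseteq> S"
    proof
      fix t assume "t \<in> {..i}"
      then show "t \<in> S" using g(4)[of t i] that \<open>i \<in> S\<close> by (simp add: S_def)
    qed
    then have "card {..i} \<le> card S" by (intro card_mono) (auto simp: S_def)
    then show "i < m" by (simp add: m_def S_def)
  next
    assume "i < m"
    show "i \<in> S"
    proof (rule ccontr)
      assume "i \<notin> S"
      have "S \<subseteq> {..<i}"
      proof
        fix t assume t: "t \<in> S"
        then have "\<not> \<gamma> ! i \<le> \<gamma> ! t" using \<open>i \<notin> S\<close> that by (auto simp: S_def)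
        then show "t \<in> {..<i}" using g(4)[of i t] t that by (simp add: S_def)
      qed
      then have "card S \<le> card {..<i}" by (intro card_mono) auto
      then show False using \<open>i < m\<close> by (simp add: m_def S_def)
    qed
  qed
  have mk: "m \<le> k" unfolding m_def by (rule order_trans[OF card_mono[of "{..<k}"]]) auto
  have flag: "standard_flag k m = {c \<in> carrier_vec k. row_comb P c \<in> standard_flag n j}"
  proof -
    have "(\<forall>i<k. m \<le> i \<longrightarrow> c $ i = 0) \<longleftrightarrow> row_comb P c \<in> standard_flag n j"
      if "c \<in> carrier_vec k" for c
      unfolding row_comb_M_in_standard_flag[OF \<gamma> P that]
    proof (intro all_cong1 imp_cong refl)
      fix i assume "i < k"
      then show "m \<le> i \<longleftrightarrow> j < \<gamma> ! i" using S[of i] by (auto simp: S_def)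
    qed
    then show ?thesis unfolding standard_flag_def[of k m] by blast
  qed
  have "row_span n (P * A) \<inter> F ! j = row_comb (P * A) ` standard_flag k m"
    unfolding represents_flag_member[OF A j] row_span_eq[OF PA] flag
  proof (intro equalityI subsetI)
    fix v assume "v \<in> row_comb (P * A) ` carrier_vec k \<inter> row_comb A ` standard_flag n j"
    then obtain c d where c: "c \<in> carrier_vec k" "v = row_comb (P * A) c"
      and d: "d \<in> standard_flag n j" "v = row_comb A d" by auto
    have "row_comb A (row_comb P c) = row_comb A d" using c d row_comb_mult[OF Pc Ac(1) c(1)] by simp
    then have "row_comb P c = d"
      using invertible_row_comb_inj[OF Ac row_comb_carrier[OF Pc]] d(1) by (auto simp: standard_flag_def)
    then show "v \<in> row_comb (P * A) ` {c \<in> carrier_vec k. row_comb P c \<in> standard_flag n j}"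
      using c d by blast
  next
    fix v assume "v \<in> row_comb (P * A) ` {c \<in> carrier_vec k. row_comb P c \<in> standard_flag n j}"
    then obtain c where c: "c \<in> carrier_vec k" "row_comb P c \<in> standard_flag n j" "v = row_comb (P * A) c"
      by auto
    then have "v = row_comb A (row_comb P c)" using row_comb_mult[OF Pc Ac(1) c(1)] by simp
    then show "v \<in> row_comb (P * A) ` carrier_vec k \<inter> row_comb A ` standard_flag n j"
      using c by blast
  qed
  then have "row_span n (P * A) \<inter> F ! j \<in> Gr m n"
    using row_comb_standard_flag_Gr[OF PA mk M_mult_trivial_kernel[OF \<gamma> P Ac]] by simp
  then show ?thesis by (simp add: Gr_def m_def)
qed

text \<open>
  At least \<open>i\<close> pivots are at most \<open>\<beta>\<^sub>i\<close> iff the \<open>i\<close>-th pivot is.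
\<close>

lemma schubert_variety_iff_pivots_le:
  assumes \<gamma>: "\<gamma> \<in> increasing_lists n k" and P: "P \<in> M n \<gamma>" and A: "represents n A F"
    and \<beta>: "\<beta> \<in> increasing_lists n k"
  shows "row_span n (P * A) \<in> schubert_variety n k \<beta> F \<longleftrightarrow> (\<forall>i<k. \<gamma> ! i \<le> \<beta> ! i)"
proof -
  have Ac: "A \<in> carrier_mat n n" "invertible_mat A" using A by (auto simp: represents_def)
  note g = increasing_listsD[OF \<gamma>] and b = increasing_listsD[OF \<beta>]
  have "Suc i \<le> card {t. t < k \<and> \<gamma> ! t \<le> \<beta> ! i} \<longleftrightarrow> \<gamma> ! i \<le> \<beta> ! i" if "i < k" for i
  proof
    assume L: "Suc i \<le> card {t. t < k \<and> \<gamma> ! t \<le> \<beta> ! i}"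
    show "\<gamma> ! i \<le> \<beta> ! i"
    proof (rule ccontr)
      assume R: "\<not> ?thesis"
      have "{t. t < k \<and> \<gamma> ! t \<le> \<beta> ! i} \<subseteq> {..<i}"
      proof
        fix t assume "t \<in> {t. t < k \<and> \<gamma> ! t \<le> \<beta> ! i}"
        then have "t < k" "\<not> \<gamma> ! i \<le> \<gamma> ! t" using R by auto
        then show "t \<in> {..<i}" using g(4)[of i t] that by simp
      qed
      then have "card {t. t < k \<and> \<gamma> ! t \<le> \<beta> ! i} \<le> card {..<i}" by (intro card_mono) auto
      then show False using L by simp
    qed
  next
    assume R: "\<gamma> ! i \<le> \<beta> ! i"
    have "{..i} \<subseteq> {t. t < k \<and> \<gamma> ! t \<le> \<beta> ! i}"
    proof
      fix t assume "t \<in> {..i}"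
      then show "t \<in> {t. t < k \<and> \<gamma> ! t \<le> \<beta> ! i}" using g(4)[of t i] that R by simp
    qed
    then have "card {..i} \<le> card {t. t < k \<and> \<gamma> ! t \<le> \<beta> ! i}" by (intro card_mono) auto
    then show "Suc i \<le> card {t. t < k \<and> \<gamma> ! t \<le> \<beta> ! i}" by simp
  qed
  then have *: "Suc i \<le> sdim n (row_span n (P * A) \<inter> F ! (\<beta> ! i)) \<longleftrightarrow> \<gamma> ! i \<le> \<beta> ! i" if "i < k" for i
    using that sdim_row_span_inter_flag[OF \<gamma> P A] b(2)[OF that] by simp
  have "(\<forall>i\<in>{1..k}. Q i) \<longleftrightarrow> (\<forall>i<k. Q (Suc i))" for Q
    unfolding image_Suc_lessThan[symmetric] by auto
  then show ?thesis using M_mult_row_span_Gr[OF \<gamma> P Ac] * by (simp add: schubert_variety_def)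
qed

lemma echelon_form_unique:
  assumes \<gamma>: "\<gamma> \<in> increasing_lists n k" and P: "P \<in> M n \<gamma>" "P' \<in> M n \<gamma>"
    and A: "A \<in> carrier_mat n n" "invertible_mat A"
    and sub: "row_span n (P * A) \<subseteq> row_span n (P' * A)"
  shows "P = P'"
proof -
  note g = increasing_listsD[OF \<gamma>]
  note Pc = M_carrier[OF P(1) g(1)] M_carrier[OF P(2) g(1)]
  have PA: "P * A \<in> carrier_mat k n" "P' * A \<in> carrier_mat k n" using Pc A by simp_all
  have "row P i = row P' i" if i: "i < k" for i
  proof -
    have u: "unit_vec k i \<in> carrier_vec k" by simp
    have "row_comb (P * A) (unit_vec k i) \<in> row_span n (P' * A)"
      using sub u unfolding row_span_eq[OF PA(1)] by blast
    then obtain c where c: "c \<in> carrier_vec k" "row_comb (P * A) (unit_vec k i) = row_comb (P' * A) c"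
      unfolding row_span_eq[OF PA(2)] by auto
    then have eq: "row_comb P (unit_vec k i) = row_comb P' c"
      using invertible_row_comb_inj[OF A row_comb_carrier[OF Pc(1)] row_comb_carrier[OF Pc(2)]]
        row_comb_mult[OF Pc(1) A(1) u] row_comb_mult[OF Pc(2) A(1) c(1)] by simp
    have "c = unit_vec k i"
      using row_comb_pivot[OF \<gamma> P(1) u] row_comb_pivot[OF \<gamma> P(2) c(1)] eq c(1)
      by (intro eq_vecI) auto
    then show ?thesis using eq row_comb_unit[OF Pc(1) i] row_comb_unit[OF Pc(2) i] by simp
  qed
  then show ?thesis using Pc by (intro eq_rowI) auto
qed

section \<open>Duality\<close>

lemma annihilator_subspace:
  assumes "H \<subseteq> carrier_vec n"
  shows "VectorSpace.subspace class_ring (annihilator n H) (space_V n)"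
  unfolding subspace_iff
proof (intro conjI ballI allI)
  show "annihilator n H \<subseteq> carrier_vec n" by (auto simp: annihilator_def)
  show "0\<^sub>v n \<in> annihilator n H" using assms by (auto simp: annihilator_def intro!: scalar_prod_left_zero)
next
  fix v w assume vw: "v \<in> annihilator n H" "w \<in> annihilator n H"
  have "(v + w) \<bullet> h = 0" if "h \<in> H" for h
    using vw that assms add_scalar_prod_distrib[of v n w h] by (auto simp: annihilator_def)
  then show "v + w \<in> annihilator n H" using vw by (simp add: annihilator_def)
next
  fix c v assume v: "v \<in> annihilator n H"
  have "(c \<cdot>\<^sub>v v) \<bullet> h = 0" if "h \<in> H" for h
    using v that assms by (auto simp: annihilator_def)
  then show "c \<cdot>\<^sub>v v \<in> annihilator n H" using v by (simp add: annihilator_def)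
qed

lemma mult_transpose_index:
  assumes "B \<in> carrier_mat k n" "C \<in> carrier_mat m n" "i < k" "j < m"
  shows "(B * C\<^sup>T) $$ (i, j) = row B i \<bullet> row C j"
  using assms by simp

lemma row_in_row_span:
  assumes "B \<in> carrier_mat k n" "i < k"
  shows "row B i \<in> row_span n B"
  unfolding row_span_eq[OF assms(1)]
  by (rule image_eqI[of _ _ "unit_vec k i"]) (simp_all add: row_comb_unit[OF assms])

lemma annihilator_row_span_iff:
  assumes B: "B \<in> carrier_mat k n" and w: "w \<in> carrier_vec n"
  shows "w \<in> annihilator n (row_span n B) \<longleftrightarrow> (\<forall>i<k. row B i \<bullet> w = 0)"
proof
  assume "w \<in> annihilator n (row_span n B)"
  then have "w \<bullet> row B i = 0" if "i < k" for i
    using row_in_row_span[OF B that] by (simp add: annihilator_def)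
  then show "\<forall>i<k. row B i \<bullet> w = 0"
    using comm_scalar_prod[OF w] row_carrier_vec[OF _ B] by metis
next
  assume "\<forall>i<k. row B i \<bullet> w = 0"
  then have Bw: "B *\<^sub>v w = 0\<^sub>v k" using B by (intro eq_vecI) auto
  have "w \<bullet> v = 0" if v: "v \<in> row_span n B" for v
  proof -
    obtain c where c: "c \<in> carrier_vec k" "v = row_comb B c"
      using v by (auto simp: row_span_eq[OF B])
    have "v \<bullet> w = c \<bullet> (B *\<^sub>v w)"
      unfolding c(2) by (rule transpose_vec_mult_scalar[OF B w c(1)])
    then have "v \<bullet> w = 0" using c(1) by (simp add: Bw)
    then show ?thesis using comm_scalar_prod[OF w, of v] row_comb_carrier[OF B] c(2) by simp
  qed
  then show "w \<in> annihilator n (row_span n B)" using w by (simp add: annihilator_def)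
qed

lemma orthogonal_iff_row_span_subset_annihilator:
  assumes B: "B \<in> carrier_mat k n" and C: "C \<in> carrier_mat m n"
  shows "B * C\<^sup>T = 0\<^sub>m k m \<longleftrightarrow> row_span n C \<subseteq> annihilator n (row_span n B)"
proof
  assume 0: "B * C\<^sup>T = 0\<^sub>m k m"
  show "row_span n C \<subseteq> annihilator n (row_span n B)"
  proof
    fix \<phi> assume "\<phi> \<in> row_span n C"
    then obtain d where d: "d \<in> carrier_vec m" "\<phi> = row_comb C d" by (auto simp: row_span_eq[OF C])
    have \<phi>: "\<phi> \<in> carrier_vec n" using row_comb_carrier[OF C] d by simp
    have "B *\<^sub>v \<phi> = (B * C\<^sup>T) *\<^sub>v d"
      unfolding d(2) by (rule assoc_mult_mat_vec[symmetric]) (use B C d in auto)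
    also have "\<dots> = 0\<^sub>v k" unfolding 0 using d(1) by (intro eq_vecI) auto
    finally have B\<phi>: "B *\<^sub>v \<phi> = 0\<^sub>v k" .
    have "row B i \<bullet> \<phi> = 0" if "i < k" for i
      using arg_cong[OF B\<phi>, of "\<lambda>v. v $ i"] that B by simp
    then show "\<phi> \<in> annihilator n (row_span n B)" using annihilator_row_span_iff[OF B \<phi>] by blast
  qed
next
  assume R: "row_span n C \<subseteq> annihilator n (row_span n B)"
  show "B * C\<^sup>T = 0\<^sub>m k m"
  proof (rule eq_matI)
    fix i j assume "i < dim_row (0\<^sub>m k m :: complex mat)" "j < dim_col (0\<^sub>m k m :: complex mat)"
    then have ij: "i < k" "j < m" by auto
    have "row C j \<in> annihilator n (row_span n B)" using R row_in_row_span[OF C ij(2)] by blast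
    then have "row B i \<bullet> row C j = 0"
      using annihilator_row_span_iff[OF B row_carrier_vec[OF ij(2) C]] ij(1) by blast
    then show "(B * C\<^sup>T) $$ (i, j) = 0\<^sub>m k m $$ (i, j)"
      using mult_transpose_index[OF B C ij] ij by simp
  qed (use B C in auto)
qed

text \<open>
  Let \<open>m\<close> be the dimension of the annihilator, \<open>P\<close> and \<open>Q\<close> echelon forms of \<open>H\<close> and of its annihilator.
  If \<open>m + k < n\<close>, some nonzero vector satisfies the \<open>k\<close> equations of the annihilator and vanishes at
  the \<open>m\<close> pivots of \<open>Q\<close>. If \<open>m + k > n\<close>, some nonzero combination of the rows of \<open>Q\<close> vanishes at
  the \<open>n - k\<close> nonpivots of \<open>P\<close>. The pivot columns being identity matrices, both vectors are zero.
\<close>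

lemma annihilator_Gr:
  assumes "H \<in> Gr k n"
  shows "annihilator n H \<in> Gr (n - k) n"
proof -
  have Hs: "VectorSpace.subspace class_ring H (space_V n)" using assms by (simp add: Gr_def)
  then have Hc: "H \<subseteq> standard_flag n n" "H \<subseteq> carrier_vec n"
    by (auto simp: subspace_iff standard_flag_full)
  obtain k' \<gamma> P where \<gamma>: "\<gamma> \<in> increasing_lists n k'" and P: "P \<in> M n \<gamma>" and HP: "H = row_span n P"
    using echelon_basis_exists[OF Hs Hc(1) le_refl] by auto
  note g = increasing_listsD[OF \<gamma>]
  note Pc = M_carrier[OF P g(1)]
  have "k' = k" using row_span_Gr[OF Pc M_trivial_kernel[OF \<gamma> P]] assms HP by (simp add: Gr_def)
  note As = annihilator_subspace[OF Hc(2)]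
  then have Ac: "annihilator n H \<subseteq> standard_flag n n" by (simp add: subspace_iff standard_flag_full)
  obtain m \<delta> Q where \<delta>: "\<delta> \<in> increasing_lists n m" and Q: "Q \<in> M n \<delta>"
    and AQ: "annihilator n H = row_span n Q"
    using echelon_basis_exists[OF As Ac le_refl] by auto
  note d = increasing_listsD[OF \<delta>]
  note Qc = M_carrier[OF Q d(1)]
  have row_iff: "w \<in> annihilator n H \<longleftrightarrow> (\<forall>i<k. (\<Sum>x<n. w $ x * P $$ (i, x)) = 0)"
    if w: "w \<in> carrier_vec n" for w
  proof -
    have "row P i \<bullet> w = (\<Sum>x<n. w $ x * P $$ (i, x))" if "i < k" for i
      using that \<open>k' = k\<close> Pc w by (simp add: scalar_prod_def mult.commute lessThan_atLeast0)
    then show ?thesis using annihilator_row_span_iff[OF Pc w] \<open>k' = k\<close> HP by simp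
  qed
  have "n \<le> m + k"
  proof (rule ccontr)
    assume "\<not> n \<le> m + k"
    then have card: "card ({..<m} <+> {..<k}) < card {..<n}" by (simp add: card_Plus)
    (* Unknown x is the coordinate in position x; Inl j is the condition at the j-th pivot of Q,
       Inr i the equation given by row i of P. *)
    define a where "a x t = (case t of Inl j \<Rightarrow> if x = \<delta> ! j - 1 then 1 else 0 | Inr i \<Rightarrow> P $$ (i, x))" for x t
    obtain c where c: "\<exists>x<n. c x \<noteq> 0" "\<And>t. t \<in> {..<m} <+> {..<k} \<Longrightarrow> (\<Sum>x<n. c x * a x t) = 0"
      using homogeneous_system_nontrivial_solution[OF _ _ card, of a] by auto
    define w where "w = vec n c"
    have w: "w \<in> carrier_vec n" by (simp add: w_def)
    have "(\<Sum>x<n. w $ x * P $$ (i, x)) = 0" if "i < k" for i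
      using c(2)[OF InrI, of i] that by (simp add: a_def w_def)
    then have "w \<in> row_comb Q ` carrier_vec m"
      using row_iff[OF w] AQ row_span_eq[OF Qc] by simp
    then obtain b where b: "b \<in> carrier_vec m" "w = row_comb Q b" by auto
    have "b $ j = 0" if j: "j < m" for j
    proof -
      have "\<delta> ! j - 1 < n" using d(2)[OF j] by linarith
      moreover have "(\<Sum>x<n. c x * (if x = \<delta> ! j - 1 then 1 else 0)) =
          (\<Sum>x<n. if x = \<delta> ! j - 1 then c x else 0)" by (intro sum.cong) auto
      ultimately have "w $ (\<delta> ! j - 1) = 0"
        using c(2)[OF InlI, of j] j by (simp add: a_def w_def del: One_nat_def)
      then show ?thesis using row_comb_pivot[OF \<delta> Q b(1) j] b(2) by simp
    qed
    then have "b = 0\<^sub>v m" using b(1) by (intro eq_vecI) auto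
    then have w0: "w = 0\<^sub>v n" using b(2) Qc by (intro eq_vecI) auto
    have "c x = 0" if "x < n" for x
      using arg_cong[OF w0, of "\<lambda>v. v $ x"] that by (simp add: w_def)
    then show False using c(1) by auto
  qed
  moreover have "m + k \<le> n"
  proof (rule ccontr)
    assume neg: "\<not> m + k \<le> n"
    define N where "N = {..<n} - (\<lambda>i. \<gamma> ! i - 1) ` {..<k}"
    have inj: "inj_on (\<lambda>i. \<gamma> ! i - 1) {..<k}"
    proof (rule inj_onI)
      fix i t assume it: "i \<in> {..<k}" "t \<in> {..<k}" "\<gamma> ! i - 1 = \<gamma> ! t - 1"
      then have "\<gamma> ! i = \<gamma> ! t" using g(2)[of i] g(2)[of t] \<open>k' = k\<close> by auto
      then show "i = t" using nth_eq_iff_index_eq[OF g(5), of i t] it g(1) \<open>k' = k\<close> by auto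
    qed
    have sub: "(\<lambda>i. \<gamma> ! i - 1) ` {..<k} \<subseteq> {..<n}"
    proof clarify
      fix i assume "i < k"
      then show "\<gamma> ! i - 1 < n" using g(2)[of i] \<open>k' = k\<close> by linarith
    qed
    have "card N = n - k" unfolding N_def using sub
      by (subst card_Diff_subset) (auto simp: card_image[OF inj] simp del: One_nat_def)
    moreover have "k \<le> n" using card_mono[OF _ sub] by (simp add: card_image[OF inj] del: One_nat_def)
    ultimately have card: "card N < card {..<m}" using neg by simp
    obtain c where c: "\<exists>j<m. c j \<noteq> 0" "\<And>x. x \<in> N \<Longrightarrow> (\<Sum>j<m. c j * Q $$ (j, x)) = 0"
      using homogeneous_system_nontrivial_solution[OF _ _ card, of "\<lambda>j x. Q $$ (j, x)"] by (auto simp: N_def)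
    define b where "b = vec m c"
    define w where "w = row_comb Q b"
    have b: "b \<in> carrier_vec m" by (simp add: b_def)
    have w: "w \<in> carrier_vec n" unfolding w_def by (rule row_comb_carrier[OF Qc])
    have wN: "w $ x = 0" if "x \<in> N" for x
    proof -
      have "x < n" using that by (simp add: N_def)
      then show ?thesis using c(2)[OF that] unfolding w_def row_comb_index[OF Qc b \<open>x < n\<close>]
        by (simp add: b_def)
    qed
    have "w \<in> annihilator n H" unfolding AQ row_span_eq[OF Qc] w_def using b by blast
    then have ann: "(\<Sum>x<n. w $ x * P $$ (i, x)) = 0" if "i < k" for i
      using row_iff[OF w] that by blast
    have w\<gamma>: "w $ (\<gamma> ! i - 1) = 0" if i: "i < k" for i
    proof -
      have x: "\<gamma> ! i - 1 < n" using sub i by auto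
      have "(\<Sum>x<n. w $ x * P $$ (i, x)) = (\<Sum>x<n. if x = \<gamma> ! i - 1 then w $ x else 0)"
      proof (intro sum.cong refl)
        fix x assume xn: "x \<in> {..<n}"
        show "w $ x * P $$ (i, x) = (if x = \<gamma> ! i - 1 then w $ x else 0)"
        proof (cases "x \<in> N")
          case True
          then show ?thesis using wN[OF True] by auto
        next
          case False
          then obtain t where t: "t < k" "x = \<gamma> ! t - 1" using xn by (auto simp: N_def)
          have "x = \<gamma> ! i - 1 \<longleftrightarrow> i = t" unfolding t(2)
            using inj_on_eq_iff[OF inj, of t i] t(1) i by (simp del: One_nat_def) blast
          then show ?thesis using M_pivot[OF P, of i t] t i g(1) \<open>k' = k\<close> by simp
        qed
      qed
      then show ?thesis using ann[OF i] x by simp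
    qed
    have "w $ x = 0" if "x < n" for x
      using wN w\<gamma> that by (cases "x \<in> N") (auto simp: N_def)
    then have "w = 0\<^sub>v n" using w by (intro eq_vecI) auto
    then have b0: "b = 0\<^sub>v m" unfolding w_def by (rule M_trivial_kernel[OF \<delta> Q b])
    have "c j = 0" if "j < m" for j
      using arg_cong[OF b0, of "\<lambda>v. v $ j"] that by (simp add: b_def)
    then show False using c(1) by auto
  qed
  ultimately have "m = n - k" by simp
  then show ?thesis using row_span_Gr[OF Qc M_trivial_kernel[OF \<delta> Q]] AQ by simp
qed

lemma dual_flag_nth: "j \<le> n \<Longrightarrow> dual_flag n F ! j = annihilator n (F ! (n - j))"
  unfolding dual_flag_def by (subst nth_map) (auto simp del: upt_Suc)

text \<open>
  The first \<open>b + 1\<close> rows of \<open>\<Psi>\<close> annihilate the first \<open>n - (b + 1)\<close> rows of \<open>A\<close>. If a pairing on the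
  antidiagonal were zero too, row \<open>b\<close> of \<open>\<Psi>\<close> would annihilate one more row of \<open>A\<close> and so lie in the
  span of the \<open>b\<close> rows before it.
\<close>

lemma pairing_with_dual_flag:
  assumes A: "represents n A F" and \<Psi>: "represents n \<Psi> (dual_flag n F)" and ab: "a < n" "b < n"
  shows "a + b + 1 < n \<Longrightarrow> row A a \<bullet> row \<Psi> b = 0"
    and "a + b + 1 = n \<Longrightarrow> row A a \<bullet> row \<Psi> b \<noteq> 0"
proof -
  have Ac: "A \<in> carrier_mat n n" "invertible_mat A" and \<Psi>c: "\<Psi> \<in> carrier_mat n n" "invertible_mat \<Psi>"
    using A \<Psi> by (auto simp: represents_def)
  have comm: "row A t \<bullet> row \<Psi> b = row \<Psi> b \<bullet> row A t" if "t < n" for t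
    using that ab Ac \<Psi>c by (intro comm_scalar_prod[of _ n]) auto
  have unit: "unit_vec n t \<in> standard_flag n j" if "t < j" for t j
    using that by (auto simp: standard_flag_def unit_vec_def)
  have zero: "row A t \<bullet> row \<Psi> b = 0" if t: "t + b + 1 < n" for t
  proof -
    have j: "1 \<le> b + 1" "b + 1 \<le> n" using ab by auto
    have "row \<Psi> b \<in> dual_flag n F ! (b + 1)"
      unfolding represents_flag_member[OF \<Psi> j]
      using row_comb_unit[OF \<Psi>c(1) ab(2)] unit[of b "b + 1"] by (metis image_eqI less_add_one)
    then have "row \<Psi> b \<in> annihilator n (F ! (n - (b + 1)))"
      using ab(2) by (subst (asm) dual_flag_nth) auto
    moreover have "row A t \<in> F ! (n - (b + 1))"
    proof -
      have j: "1 \<le> n - (b + 1)" "n - (b + 1) \<le> n" "t < n - (b + 1)" "t < n" using t by auto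
      show ?thesis unfolding represents_flag_member[OF A j(1,2)]
        using row_comb_unit[OF Ac(1) j(4)] unit[OF j(3)] by (metis image_eqI)
    qed
    ultimately show ?thesis using comm[of t] t by (simp add: annihilator_def)
  qed
  show "a + b + 1 < n \<Longrightarrow> row A a \<bullet> row \<Psi> b = 0" by (rule zero)
  show "row A a \<bullet> row \<Psi> b \<noteq> 0" if n: "a + b + 1 = n"
  proof
    assume "row A a \<bullet> row \<Psi> b = 0"
    then have zero': "row A t \<bullet> row \<Psi> b = 0" if "t \<le> a" for t
      using zero[of t] that n by (cases "t = a") auto
    have "row \<Psi> b \<bullet> v = 0" if v: "v \<in> F ! (a + 1)" for v
    proof -
      have j: "1 \<le> a + 1" "a + 1 \<le> n" using ab by auto
      obtain c where c: "c \<in> standard_flag n (a + 1)" "v = row_comb A c"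
        using v unfolding represents_flag_member[OF A j] by auto
      have cc: "c \<in> carrier_vec n" using c(1) by (simp add: standard_flag_def)
      have \<psi>: "row \<Psi> b \<in> carrier_vec n" using \<Psi>c ab by auto
      have "v \<bullet> row \<Psi> b = c \<bullet> (A *\<^sub>v row \<Psi> b)"
        unfolding c(2) by (rule transpose_vec_mult_scalar[OF Ac(1) \<psi> cc])
      also have "\<dots> = (\<Sum>t\<in>{0..<n}. c $ t * (row A t \<bullet> row \<Psi> b))"
        using Ac cc by (simp add: scalar_prod_def[of c])
      also have "\<dots> = 0"
      proof (intro sum.neutral ballI)
        fix t assume "t \<in> {0..<n}"
        then show "c $ t * (row A t \<bullet> row \<Psi> b) = 0"
          using zero'[of t] c(1) by (cases "t \<le> a") (auto simp: standard_flag_def)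
      qed
      finally show ?thesis using comm_scalar_prod[OF \<psi>, of v] c(2) row_comb_carrier[OF Ac(1)] by simp
    qed
    then have "row \<Psi> b \<in> annihilator n (F ! (a + 1))"
      using \<Psi>c ab by (auto simp: annihilator_def)
    show False
    (* Representing the dual flag says nothing about its member of index 0, so b = 0 is separate:
       there row b annihilates all rows of A and must be zero. *)
    proof (cases "b = 0")
      case False
      have "row \<Psi> b \<in> dual_flag n F ! b"
        using \<open>row \<Psi> b \<in> annihilator n (F ! (a + 1))\<close> n by (subst dual_flag_nth) auto
      then obtain c where c: "c \<in> standard_flag n b" "row \<Psi> b = row_comb \<Psi> c"
        using represents_flag_member[OF \<Psi>, of b] False ab by auto
      have "unit_vec n b = c"
        using invertible_row_comb_inj[OF \<Psi>c unit_vec_carrier _, of c b] c row_comb_unit[OF \<Psi>c(1) ab(2)]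
        by (simp add: standard_flag_def)
      then have "unit_vec n b \<in> standard_flag n b" using c by simp
      then have "(unit_vec n b :: complex vec) $ b = 0" using ab by (simp only: standard_flag_def) blast
      then show False using ab by simp
    next
      case True
      have \<psi>: "row \<Psi> b \<in> carrier_vec n" using \<Psi>c ab by auto
      have "A *\<^sub>v row \<Psi> b = 0\<^sub>v n"
        using zero' True n Ac by (intro eq_vecI) auto
      moreover obtain A' where "A' \<in> carrier_mat n n" "A' * A = 1\<^sub>m n" using invertible_inverse[OF Ac] .
      ultimately have "row \<Psi> b = A' *\<^sub>v 0\<^sub>v n"
        using assoc_mult_mat_vec[of A' n n A n "row \<Psi> b"] Ac \<psi> by simp
      then have "row_comb \<Psi> (unit_vec n b) = 0\<^sub>v n"
        using \<open>A' \<in> carrier_mat n n\<close> row_comb_unit[OF \<Psi>c(1) ab(2)] by (auto intro!: eq_vecI)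
      then have "unit_vec n b = (0\<^sub>v n :: complex vec)"
        using invertible_row_comb_ker[OF \<Psi>c unit_vec_carrier] by simp
      then have "unit_vec n b $ b = (0\<^sub>v n :: complex vec) $ b" by simp
      then show False using ab by simp
    qed
  qed
qed

lemma product_transpose_entry:
  fixes P Q A \<Psi> :: "complex mat"
  assumes "P \<in> carrier_mat k n" "Q \<in> carrier_mat m n" "A \<in> carrier_mat n n" "\<Psi> \<in> carrier_mat n n"
    and "i < k" "j < m"
  shows "((P * A) * (Q * \<Psi>)\<^sup>T) $$ (i, j) =
    (\<Sum>x<n. \<Sum>y<n. P $$ (i, x) * (row A x \<bullet> row \<Psi> y) * Q $$ (j, y))"
proof -
  define T where "T = A * \<Psi>\<^sup>T"
  have T: "T \<in> carrier_mat n n" using assms by (simp add: T_def)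
  have Tent: "T $$ (x, y) = row A x \<bullet> row \<Psi> y" if "x < n" "y < n" for x y
    unfolding T_def by (rule mult_transpose_index[OF assms(3,4) that])
  have "(P * A) * (Q * \<Psi>)\<^sup>T = P * (T * Q\<^sup>T)"
    unfolding T_def using assms by (subst transpose_mult[OF assms(2,4)])
      (simp add: assoc_mult_mat[of _ k n _ n _ m] assoc_mult_mat[of _ n n _ n _ m])
  also have "\<dots> $$ (i, j) = (\<Sum>x\<in>{0..<n}. P $$ (i, x) * (T * Q\<^sup>T) $$ (x, j))"
    using assms T by (simp add: scalar_prod_def)
  also have "\<dots> = (\<Sum>x\<in>{0..<n}. P $$ (i, x) * (\<Sum>y\<in>{0..<n}. T $$ (x, y) * Q $$ (j, y)))"
    using assms T by (intro sum.cong refl) (simp add: scalar_prod_def)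
  also have "\<dots> = (\<Sum>x\<in>{0..<n}. \<Sum>y\<in>{0..<n}. P $$ (i, x) * (row A x \<bullet> row \<Psi> y) * Q $$ (j, y))"
    unfolding sum_distrib_left by (intro sum.cong refl) (simp add: Tent mult.assoc)
  finally show ?thesis by (simp add: lessThan_atLeast0)
qed

text \<open>
  Row \<open>i\<close> of \<open>P\<close> ends with its pivot, and so does row \<open>j\<close> of \<open>Q\<close>. If the pivots add up to \<open>n + 1\<close>, every
  other term of the pairing falls strictly above the antidiagonal of the pairing matrix.
\<close>

lemma orthogonal_pivots:
  assumes A: "represents n A F" and \<Psi>: "represents n \<Psi> (dual_flag n F)"
    and \<gamma>: "\<gamma> \<in> increasing_lists n k" and P: "P \<in> M n \<gamma>"
    and \<delta>: "\<delta> \<in> increasing_lists n m" and Q: "Q \<in> M n \<delta>"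
    and orth: "(P * A) * (Q * \<Psi>)\<^sup>T = 0\<^sub>m k m" and ij: "i < k" "j < m"
  shows "\<gamma> ! i + \<delta> ! j \<noteq> n + 1"
proof
  assume s: "\<gamma> ! i + \<delta> ! j = n + 1"
  note g = increasing_listsD[OF \<gamma>] and d = increasing_listsD[OF \<delta>]
  have c: "A \<in> carrier_mat n n" "\<Psi> \<in> carrier_mat n n" using A \<Psi> by (auto simp: represents_def)
  note Pc = M_carrier[OF P g(1)] and Qc = M_carrier[OF Q d(1)]
  define x0 y0 where "x0 = \<gamma> ! i - 1" and "y0 = \<delta> ! j - 1"
  have x0: "x0 < n" "\<gamma> ! i = Suc x0" and y0: "y0 < n" "\<delta> ! j = Suc y0" and xy: "x0 + y0 + 1 = n"
    using g(2)[OF ij(1)] d(2)[OF ij(2)] s by (auto simp: x0_def y0_def)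
  have zero: "P $$ (i, x) * (row A x \<bullet> row \<Psi> y) * Q $$ (j, y) = 0"
    if "x < n" "y < n" "(x, y) \<noteq> (x0, y0)" for x y
  proof -
    have "x0 < x \<or> y0 < y \<or> x + y + 1 < n" using that xy by auto
    then consider "x0 < x" | "y0 < y" | "x + y + 1 < n" by blast
    then show ?thesis
    proof cases
      case 1
      then show ?thesis using M_zero[OF P, of i x] ij g(1) x0 that by simp
    next
      case 2
      then show ?thesis using M_zero[OF Q, of j y] ij d(1) y0 that by simp
    next
      case 3
      then show ?thesis using pairing_with_dual_flag(1)[OF A \<Psi> that(1,2)] by simp
    qed
  qed
  have "0 = (\<Sum>x<n. \<Sum>y<n. P $$ (i, x) * (row A x \<bullet> row \<Psi> y) * Q $$ (j, y))"
    using product_transpose_entry[OF Pc Qc c ij] orth ij by simp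
  also have "\<dots> = (\<Sum>z\<in>{..<n} \<times> {..<n}. P $$ (i, fst z) * (row A (fst z) \<bullet> row \<Psi> (snd z)) * Q $$ (j, snd z))"
    by (simp add: sum.cartesian_product case_prod_beta)
  also have "\<dots> = (\<Sum>z\<in>{(x0, y0)}. P $$ (i, fst z) * (row A (fst z) \<bullet> row \<Psi> (snd z)) * Q $$ (j, snd z))"
  proof (intro sum.mono_neutral_right ballI)
    fix z assume "z \<in> {..<n} \<times> {..<n} - {(x0, y0)}"
    then have "fst z < n" "snd z < n" "(fst z, snd z) \<noteq> (x0, y0)" by auto
    then show "P $$ (i, fst z) * (row A (fst z) \<bullet> row \<Psi> (snd z)) * Q $$ (j, snd z) = 0" by (rule zero)
  qed (use x0 y0 in auto)
  also have "\<dots> = row A x0 \<bullet> row \<Psi> y0"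
    using M_pivot[OF P, of i i] M_pivot[OF Q, of j j] ij g(1) d(1) x0 y0 by simp
  finally show False using pairing_with_dual_flag(2)[OF A \<Psi> x0(1) y0(1) xy] by simp
qed

lemma set_perp_list: "set (perp_list n \<beta>) = {j \<in> {1..n}. n + 1 - j \<notin> set \<beta>}"
  by (auto simp: perp_list_def)

lemma set_eq_diff_perp:
  assumes "\<beta> \<in> increasing_lists n k"
  shows "set \<beta> = {1..n} - (\<lambda>j. n + 1 - j) ` set (perp_list n \<beta>)"
proof -
  have "set \<beta> \<subseteq> {1..n}" using assms by (simp add: increasing_lists_def)
  moreover have "x \<in> (\<lambda>j. n + 1 - j) ` set (perp_list n \<beta>)" if "x \<in> {1..n}" "x \<notin> set \<beta>" for x
    using that by (intro image_eqI[of _ _ "n + 1 - x"]) (auto simp: set_perp_list)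
  moreover have "x \<notin> (\<lambda>j. n + 1 - j) ` set (perp_list n \<beta>)" if "x \<in> set \<beta>" for x
    using that by (auto simp: set_perp_list)
  ultimately show ?thesis by blast
qed

lemma perp_list_increasing:
  assumes "\<beta> \<in> increasing_lists n k"
  shows "perp_list n \<beta> \<in> increasing_lists n (n - k)"
proof -
  note b = increasing_listsD[OF assms]
  have sorted: "sorted_wrt (<) (perp_list n \<beta>)"
    unfolding perp_list_def by (intro sorted_wrt_filter sorted_wrt_upt)
  then have "length (perp_list n \<beta>) = card (set (perp_list n \<beta>))"
    by (simp add: distinct_card strict_sorted_iff)
  also have "set (perp_list n \<beta>) = {1..n} - (\<lambda>x. n + 1 - x) ` set \<beta>"
  proof -
    have "x \<in> (\<lambda>x. n + 1 - x) ` set \<beta>" if "x \<in> {1..n}" "n + 1 - x \<in> set \<beta>" for x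
      using that by (intro image_eqI[of _ _ "n + 1 - x"]) auto
    moreover have "set \<beta> \<subseteq> {1..n}" using assms by (simp add: increasing_lists_def)
    ultimately show ?thesis by (fastforce simp: set_perp_list)
  qed
  also have "card \<dots> = n - k"
  proof -
    have sub: "set \<beta> \<subseteq> {1..n}" using assms by (simp add: increasing_lists_def)
    then have "inj_on (\<lambda>x. n + 1 - x) (set \<beta>)" by (intro inj_onI) force
    then have "card ((\<lambda>x. n + 1 - x) ` set \<beta>) = k" using b by (simp add: card_image distinct_card)
    moreover have "(\<lambda>x. n + 1 - x) ` set \<beta> \<subseteq> {1..n}" using sub by fastforce
    ultimately show ?thesis by (subst card_Diff_subset) auto
  qed
  finally show ?thesis using sorted by (auto simp: increasing_lists_def set_perp_list)
qed

lemma increasing_lists_eqI: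
  assumes "\<beta> \<in> increasing_lists n k" "\<gamma> \<in> increasing_lists n k" "set \<beta> = set \<gamma>"
  shows "\<beta> = \<gamma>"
  using assms by (intro strict_sorted_equal) (auto simp: increasing_lists_def)

lemma perp_list_inj:
  assumes "\<beta> \<in> increasing_lists n k" "\<gamma> \<in> increasing_lists n k" "perp_list n \<beta> = perp_list n \<gamma>"
  shows "\<beta> = \<gamma>"
  using assms by (intro increasing_lists_eqI[OF assms(1,2)]) (simp add: set_eq_diff_perp[OF assms(1)] set_eq_diff_perp[OF assms(2)])

text \<open>
  The pivots of \<open>Q\<close> avoid the reflections \<open>n + 1 - \<gamma>\<^sub>i\<close>, and there are just \<open>n - k\<close> such positions.
\<close>

lemma orthogonal_echelon_forms:
  assumes A: "represents n A F" and \<Psi>: "represents n \<Psi> (dual_flag n F)"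
    and \<gamma>: "\<gamma> \<in> increasing_lists n k" and P: "P \<in> M n \<gamma>"
    and \<delta>: "\<delta> \<in> increasing_lists n (n - k)" and Q: "Q \<in> M n \<delta>"
    and orth: "(P * A) * (Q * \<Psi>)\<^sup>T = 0\<^sub>m k (n - k)"
  shows "\<delta> = perp_list n \<gamma>"
proof (rule increasing_lists_eqI[OF \<delta> perp_list_increasing[OF \<gamma>]])
  note g = increasing_listsD[OF \<gamma>] and d = increasing_listsD[OF \<delta>]
  have sub: "set \<delta> \<subseteq> set (perp_list n \<gamma>)"
  proof
    fix x assume "x \<in> set \<delta>"
    then obtain j where j: "j < n - k" "x = \<delta> ! j" using d(1) by (auto simp: in_set_conv_nth)
    have "n + 1 - x \<notin> set \<gamma>"
    proof
      assume "n + 1 - x \<in> set \<gamma>"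
      then obtain i where "i < k" "\<gamma> ! i = n + 1 - x" using g(1) by (auto simp: in_set_conv_nth)
      then show False using orthogonal_pivots[OF A \<Psi> \<gamma> P \<delta> Q orth _ j(1), of i] d(2)[OF j(1)] j by simp
    qed
    then show "x \<in> set (perp_list n \<gamma>)" using d(2)[OF j(1)] j by (simp add: set_perp_list)
  qed
  have "card (set \<delta>) = card (set (perp_list n \<gamma>))"
    using increasing_listsD(1,5)[OF \<delta>] increasing_listsD(1,5)[OF perp_list_increasing[OF \<gamma>]]
    by (simp add: distinct_card)
  then show "set \<delta> = set (perp_list n \<gamma>)" using sub by (intro card_subset_eq) auto
qed

section \<open>Counting coordinates\<close>

text \<open>
  The coordinates of \<open>M n \<beta>\<close> correspond to the pairs consisting of an element of \<open>\<beta>\<close> and a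
  smaller element of its complement. The reflection \<open>j \<mapsto> n + 1 - j\<close>, together with the exchange of the two
  components, maps these pairs to those of the dual list.
\<close>

definition inversions :: "nat \<Rightarrow> nat list \<Rightarrow> (nat \<times> nat) set" where
  "inversions n \<beta> = {(b, j). b \<in> set \<beta> \<and> j \<in> {1..n} - set \<beta> \<and> j < b}"

lemma finite_inversions: "finite (inversions n \<beta>)"
  by (rule finite_subset[of _ "set \<beta> \<times> {1..n}"]) (auto simp: inversions_def)

lemma coords_bij_inversions:
  assumes "\<beta> \<in> increasing_lists n k"
  shows "bij_betw (\<lambda>(i, x). (\<beta> ! i, Suc x)) (coords n \<beta>) (inversions n \<beta>)"
proof -
  note b = increasing_listsD[OF assms]
  have inj: "inj_on (\<lambda>(i, x). (\<beta> ! i, Suc x)) (coords n \<beta>)"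
    using nth_eq_iff_index_eq[OF b(5)] by (auto simp: inj_on_def coords_def)
  have "(\<lambda>(i, x). (\<beta> ! i, Suc x)) ` coords n \<beta> = inversions n \<beta>"
  proof (intro equalityI subsetI)
    fix z assume "z \<in> (\<lambda>(i, x). (\<beta> ! i, Suc x)) ` coords n \<beta>"
    then obtain i j where ij: "i < length \<beta>" "j \<in> {1..n}" "j \<notin> set \<beta>" "j \<le> \<beta> ! i" "z = (\<beta> ! i, Suc (j - 1))"
      by (auto simp: coords_def)
    moreover have "j \<noteq> \<beta> ! i" using ij nth_mem by metis
    ultimately show "z \<in> inversions n \<beta>" by (auto simp: inversions_def)
  next
    fix z assume "z \<in> inversions n \<beta>"
    then obtain i j where ij: "i < length \<beta>" "j \<in> {1..n}" "j \<notin> set \<beta>" "j < \<beta> ! i" "z = (\<beta> ! i, j)"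
      by (auto simp: inversions_def in_set_conv_nth)
    then have "(i, j - 1) \<in> coords n \<beta>" unfolding coords_def by (auto intro: less_imp_le)
    then show "z \<in> (\<lambda>(i, x). (\<beta> ! i, Suc x)) ` coords n \<beta>"
      using ij by (intro image_eqI[of _ _ "(i, j - 1)"]) auto
  qed
  then show ?thesis using inj by (simp add: bij_betw_def)
qed

lemma finite_coords:
  assumes "\<beta> \<in> increasing_lists n k" shows "finite (coords n \<beta>)"
  using bij_betw_finite[OF coords_bij_inversions[OF assms]] finite_inversions by blast

lemma card_coords_inversions:
  assumes "\<beta> \<in> increasing_lists n k" shows "card (coords n \<beta>) = card (inversions n \<beta>)"
  using bij_betw_same_card[OF coords_bij_inversions[OF assms]] .

lemma card_coords:
  assumes "\<beta> \<in> increasing_lists n k"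
  shows "card (coords n \<beta>) = (\<Sum>i<k. \<beta> ! i - Suc i)"
proof -
  note b = increasing_listsD[OF assms]
  define R where "R i = {j \<in> {1..n}. j \<notin> set \<beta> \<and> j \<le> \<beta> ! i}" for i
  have inv: "coords n \<beta> = (SIGMA i:{..<k}. (\<lambda>j. j - 1) ` R i)"
    using b(1) by (auto simp: coords_def R_def)
  have "card ((\<lambda>j. j - 1) ` R i) = \<beta> ! i - Suc i" if i: "i < k" for i
  proof -
    have "inj_on (\<lambda>j. j - 1) (R i)" by (rule inj_onI) (auto simp: R_def)
    then have img: "card ((\<lambda>j. j - 1) ` R i) = card (R i)" by (rule card_image)
    have "R i = {1..\<beta> ! i} - (!) \<beta> ` {..i}"
    proof (intro equalityI subsetI)
      fix j assume "j \<in> R i"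
      then have j: "1 \<le> j" "j \<notin> set \<beta>" "j \<le> \<beta> ! i" by (auto simp: R_def)
      then have "j \<notin> (!) \<beta> ` {..i}" using i b(1) by auto
      then show "j \<in> {1..\<beta> ! i} - (!) \<beta> ` {..i}" using j by simp
    next
      fix j assume j: "j \<in> {1..\<beta> ! i} - (!) \<beta> ` {..i}"
      have "j \<notin> set \<beta>"
      proof
        assume "j \<in> set \<beta>"
        then obtain t where t: "t < k" "j = \<beta> ! t" using b(1) by (auto simp: in_set_conv_nth)
        then have "t \<le> i" using j b(4)[OF t(1) i] by simp
        then show False using j t by auto
      qed
      then show "j \<in> R i" using j b(2)[OF i] by (auto simp: R_def)
    qed
    then have "card (R i) = card ({1..\<beta> ! i} - (!) \<beta> ` {..i})" by simp
    also have "\<dots> = card {1..\<beta> ! i} - card ((!) \<beta> ` {..i})"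
    proof (rule card_Diff_subset)
      show "(!) \<beta> ` {..i} \<subseteq> {1..\<beta> ! i}"
      proof clarify
        fix t assume "t \<le> i"
        then show "\<beta> ! t \<in> {1..\<beta> ! i}" using b(2)[of t] b(4)[of t i] i by simp
      qed
    qed simp
    also have "card ((!) \<beta> ` {..i}) = Suc i"
    proof -
      have "inj_on ((!) \<beta>) {..i}" using i b(1) by (intro inj_on_nth b(5)) auto
      then show ?thesis by (simp add: card_image)
    qed
    finally show ?thesis using img by simp
  qed
  then show ?thesis unfolding inv by (subst card_SigmaI) (auto simp: R_def)
qed

lemma card_coords_perp:
  assumes "\<beta> \<in> increasing_lists n k"
  shows "card (coords n (perp_list n \<beta>)) = card (coords n \<beta>)"
proof -
  have sub: "set \<beta> \<subseteq> {1..n}" using assms by (simp add: increasing_lists_def)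
  have "bij_betw (\<lambda>(b, j). (n + 1 - j, n + 1 - b)) (inversions n \<beta>) (inversions n (perp_list n \<beta>))"
  proof (rule bij_betwI[of _ _ _ "\<lambda>(b, j). (n + 1 - j, n + 1 - b)"])
    show "(\<lambda>(b, j). (n + 1 - j, n + 1 - b)) \<in> inversions n \<beta> \<rightarrow> inversions n (perp_list n \<beta>)"
    proof
      fix z assume "z \<in> inversions n \<beta>"
      then obtain b j where z: "z = (b, j)" "b \<in> set \<beta>" "b \<in> {1..n}" "j \<in> {1..n}" "j \<notin> set \<beta>" "j < b"
        using sub by (auto simp: inversions_def)
      then show "(\<lambda>(b, j). (n + 1 - j, n + 1 - b)) z \<in> inversions n (perp_list n \<beta>)"
        by (auto simp: inversions_def set_perp_list Suc_diff_le)
    qed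
    show "(\<lambda>(b, j). (n + 1 - j, n + 1 - b)) \<in> inversions n (perp_list n \<beta>) \<rightarrow> inversions n \<beta>"
    proof
      fix z assume "z \<in> inversions n (perp_list n \<beta>)"
      then obtain b j where z: "z = (b, j)" "b \<in> {1..n}" "n + 1 - b \<notin> set \<beta>" "j \<in> {1..n}"
          "n + 1 - j \<in> set \<beta>" "j < b"
        by (auto simp: inversions_def set_perp_list)
      then show "(\<lambda>(b, j). (n + 1 - j, n + 1 - b)) z \<in> inversions n \<beta>"
        by (auto simp: inversions_def)
    qed
  next
    fix z assume "z \<in> inversions n \<beta>"
    then show "(\<lambda>(b, j). (n + 1 - j, n + 1 - b)) ((\<lambda>(b, j). (n + 1 - j, n + 1 - b)) z) = z"
      using sub by (auto simp: inversions_def)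
  next
    fix z assume "z \<in> inversions n (perp_list n \<beta>)"
    then show "(\<lambda>(b, j). (n + 1 - j, n + 1 - b)) ((\<lambda>(b, j). (n + 1 - j, n + 1 - b)) z) = z"
      by (auto simp: inversions_def set_perp_list)
  qed
  then show ?thesis
    using bij_betw_same_card card_coords_inversions[OF assms]
      card_coords_inversions[OF perp_list_increasing[OF assms]] by metis
qed

lemma card_coords_le:
  assumes "\<beta> \<in> increasing_lists n k"
  shows "card (coords n \<beta>) \<le> k * (n - k)"
proof -
  note b = increasing_listsD[OF assms]
  have sub: "set \<beta> \<subseteq> {1..n}" using assms by (simp add: increasing_lists_def)
  have "card (inversions n \<beta>) \<le> card (set \<beta> \<times> ({1..n} - set \<beta>))"
    by (intro card_mono) (auto simp: inversions_def)
  also have "\<dots> = k * (n - k)"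
    using b sub by (simp add: card_cartesian_product card_Diff_subset distinct_card)
  finally show ?thesis by (simp add: card_coords_inversions[OF assms])
qed

lemma codimension_eq:
  assumes "\<beta> \<in> increasing_lists n k"
  shows "codimension n k \<beta> = k * (n - k) - card (coords n \<beta>)"
proof -
  have "(\<Sum>i=1..k. \<beta> ! (i - 1) - i) = (\<Sum>i<k. \<beta> ! i - Suc i)"
    by (rule sum.reindex_bij_witness[of _ Suc "\<lambda>i. i - 1"]) auto
  then show ?thesis by (simp add: codimension_def card_coords[OF assms])
qed

lemma schubert_problem_sum_coords:
  assumes "schubert_problem n k l \<beta>" "1 \<le> l"
  shows "(\<Sum>i=1..l. card (coords n (\<beta> i))) = (l - 1) * (k * (n - k))"
proof -
  have inc: "\<beta> i \<in> increasing_lists n k" if "i \<in> {1..l}" for i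
    using assms that by (simp add: schubert_problem_def)
  have "k * (n - k) = (\<Sum>i=1..l. k * (n - k) - card (coords n (\<beta> i)))"
    using assms(1) inc by (simp add: schubert_problem_def codimension_eq)
  also have "\<dots> = l * (k * (n - k)) - (\<Sum>i=1..l. card (coords n (\<beta> i)))"
  proof (subst sum_subtractf_nat)
    fix i assume "i \<in> {1..l}"
    then show "card (coords n (\<beta> i)) \<le> k * (n - k)" by (intro card_coords_le inc)
  qed simp
  finally have *: "k * (n - k) = l * (k * (n - k)) - (\<Sum>i=1..l. card (coords n (\<beta> i)))" .
  have "(\<Sum>i=1..l. card (coords n (\<beta> i))) \<le> (\<Sum>i=1..l. k * (n - k))"
    by (intro sum_mono card_coords_le inc)
  then have "(\<Sum>i=1..l. card (coords n (\<beta> i))) \<le> l * (k * (n - k))" by simp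
  then show ?thesis using * by (simp add: diff_mult_distrib)
qed

lemma card_coords_mono:
  assumes "\<gamma> \<in> increasing_lists n k" "\<beta> \<in> increasing_lists n k" "\<And>i. i < k \<Longrightarrow> \<gamma> ! i \<le> \<beta> ! i"
  shows "card (coords n \<gamma>) \<le> card (coords n \<beta>)"
  unfolding card_coords[OF assms(1)] card_coords[OF assms(2)]
  by (intro sum_mono diff_le_mono assms(3)) simp

lemma card_coords_strict_mono:
  assumes "\<gamma> \<in> increasing_lists n k" "\<beta> \<in> increasing_lists n k" "\<And>i. i < k \<Longrightarrow> \<gamma> ! i \<le> \<beta> ! i"
    and "\<gamma> \<noteq> \<beta>"
  shows "card (coords n \<gamma>) < card (coords n \<beta>)"
proof -
  note g = increasing_listsD[OF assms(1)] and b = increasing_listsD[OF assms(2)]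
  obtain i where i: "i < k" "\<gamma> ! i \<noteq> \<beta> ! i" using assms(4) g(1) b(1) nth_equalityI by metis
  have pos: "Suc j \<le> \<gamma> ! j" if "j < k" for j
    using that
  proof (induction j)
    case 0
    then show ?case using g(2)[of 0] by simp
  next
    case (Suc j)
    then show ?case using g(3)[of j "Suc j"] by simp
  qed
  have "\<gamma> ! i - Suc i < \<beta> ! i - Suc i" using pos[OF i(1)] i assms(3)[OF i(1)] by linarith
  then show ?thesis
    unfolding card_coords[OF assms(1)] card_coords[OF assms(2)]
    using i assms(3) by (intro sum_strict_mono_ex1) (auto intro: diff_le_mono)
qed

lemma card_equations: "card (equations n k l) = k * (n - k) * (l - 1)"
  by (simp add: equations_def card_cartesian_product)

lemma card_variables:
  assumes "schubert_problem n k l \<beta>" "1 \<le> l"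
  shows "card (variables n l \<beta>) = k * (n - k) * (l - 1)"
proof -
  have inc: "\<beta> i \<in> increasing_lists n k" if "i \<in> {1..l}" for i
    using assms that by (simp add: schubert_problem_def)
  have fin: "finite (coords n (perp_list n (\<beta> i)))" if "i \<in> {1..l}" for i
    using finite_coords[OF perp_list_increasing[OF inc[OF that]]] .
  have "card (variables n l \<beta>) = card ({1::nat} \<times> coords n (\<beta> 1)) +
      card (SIGMA i:{2..l}. coords n (perp_list n (\<beta> i)))"
    unfolding variables_def using assms(2) fin finite_coords[OF inc]
    by (intro card_Un_disjoint finite_SigmaI finite_cartesian_product) auto
  also have "\<dots> = card (coords n (\<beta> 1)) + (\<Sum>i=2..l. card (coords n (\<beta> i)))"
  proof -
    have "(\<Sum>i=2..l. card (coords n (perp_list n (\<beta> i)))) = (\<Sum>i=2..l. card (coords n (\<beta> i)))"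
    proof (intro sum.cong refl)
      fix i assume "i \<in> {2..l}"
      then have "\<beta> i \<in> increasing_lists n k" by (intro inc) simp
      then show "card (coords n (perp_list n (\<beta> i))) = card (coords n (\<beta> i))" by (rule card_coords_perp)
    qed
    then show ?thesis using fin by (subst card_SigmaI) (auto simp: card_cartesian_product)
  qed
  also have "\<dots> = (\<Sum>i=1..l. card (coords n (\<beta> i)))"
    using assms(2) by (simp add: sum.atLeast_Suc_atMost numeral_2_eq_2)
  finally show ?thesis using schubert_problem_sum_coords[OF assms] by simp
qed

lemma M_entry_affine:
  assumes \<beta>: "\<beta> \<in> increasing_lists n k" and P: "P \<in> M n \<beta>" and "i < k" "x < n"
  shows "P $$ (i, x) = (if Suc x = \<beta> ! i then 1 else 0) +
    (\<Sum>v\<in>coords n \<beta>. (if v = (i, x) then 1 else 0) * P $$ v)"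
proof -
  note b = increasing_listsD[OF \<beta>]
  have "(\<Sum>v\<in>coords n \<beta>. (if v = (i, x) then 1 else 0) * P $$ v) =
      (\<Sum>v\<in>coords n \<beta>. if v = (i, x) then P $$ (i, x) else 0)"
    by (intro sum.cong) auto
  also have "\<dots> = (if (i, x) \<in> coords n \<beta> then P $$ (i, x) else 0)"
    using finite_coords[OF \<beta>] by simp
  finally have s: "(\<Sum>v\<in>coords n \<beta>. (if v = (i, x) then 1 else 0) * P $$ v) =
      (if (i, x) \<in> coords n \<beta> then P $$ (i, x) else 0)" .
  have co: "(i, x) \<in> coords n \<beta> \<longleftrightarrow> Suc x \<notin> set \<beta> \<and> Suc x \<le> \<beta> ! i"
  proof
    assume "(i, x) \<in> coords n \<beta>"
    then obtain j where "x = j - 1" "1 \<le> j" "j \<notin> set \<beta>" "j \<le> \<beta> ! i" by (auto simp: coords_def)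
    then show "Suc x \<notin> set \<beta> \<and> Suc x \<le> \<beta> ! i" by simp
  next
    assume "Suc x \<notin> set \<beta> \<and> Suc x \<le> \<beta> ! i"
    then show "(i, x) \<in> coords n \<beta>"
      using assms b(1) by (auto simp: coords_def intro!: exI[of _ "Suc x"])
  qed
  consider (free) "Suc x \<notin> set \<beta>" "Suc x \<le> \<beta> ! i" | (big) "\<beta> ! i < Suc x" | (piv) j where "j < k" "Suc x = \<beta> ! j"
    using b(1) by (metis in_set_conv_nth not_less)
  then show ?thesis
  proof cases
    case free
    then have "Suc x \<noteq> \<beta> ! i" using nth_mem[of i \<beta>] assms(3) b(1) by auto
    then show ?thesis using free co s by simp
  next
    case big
    then show ?thesis using M_zero[OF P, of i x] assms b(1) co s by auto
  next
    case (piv j)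
    then have "P $$ (i, x) = (if i = j then 1 else 0)" using M_pivot[OF P, of i j] assms(3) b(1)
      by (metis diff_Suc_1)
    moreover have "\<beta> ! j = \<beta> ! i \<longleftrightarrow> i = j" using nth_eq_iff_index_eq[OF b(5), of j i] piv assms(3) b(1) by auto
    moreover have "Suc x \<in> set \<beta>" using piv b(1) by auto
    ultimately show ?thesis using co s piv by simp
  qed
qed

lemma sum_swap_last:
  fixes h :: "nat \<Rightarrow> nat \<Rightarrow> 'z \<Rightarrow> complex"
  shows "(\<Sum>x<n. \<Sum>y<n. \<Sum>z\<in>Z. h x y z) = (\<Sum>z\<in>Z. \<Sum>x<n. \<Sum>y<n. h x y z)"
proof -
  have "(\<Sum>x<n. \<Sum>y<n. \<Sum>z\<in>Z. h x y z) = (\<Sum>x<n. \<Sum>z\<in>Z. \<Sum>y<n. h x y z)"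
    by (intro sum.cong refl sum.swap)
  also have "\<dots> = (\<Sum>z\<in>Z. \<Sum>x<n. \<Sum>y<n. h x y z)" by (rule sum.swap)
  finally show ?thesis .
qed

text \<open>
  Expansion of a bilinear form evaluated at two affine forms; the four sums are the constant part,
  the two linear parts and the bilinear part.
\<close>

lemma double_sum_of_affine_forms:
  fixes T :: "nat \<Rightarrow> nat \<Rightarrow> complex"
  assumes "finite X" "finite Y"
  shows "(\<Sum>x<n. \<Sum>y<n. (p0 x + (\<Sum>v\<in>X. e x v * P v)) * T x y * (q0 y + (\<Sum>w\<in>Y. f y w * Q w))) =
    (\<Sum>x<n. \<Sum>y<n. p0 x * T x y * q0 y) + (\<Sum>v\<in>X. (\<Sum>x<n. \<Sum>y<n. e x v * T x y * q0 y) * P v)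
    + (\<Sum>w\<in>Y. (\<Sum>x<n. \<Sum>y<n. p0 x * T x y * f y w) * Q w)
    + (\<Sum>v\<in>X. \<Sum>w\<in>Y. (\<Sum>x<n. \<Sum>y<n. e x v * T x y * f y w) * P v * Q w)"
proof -
  have "(p0 x + (\<Sum>v\<in>X. e x v * P v)) * T x y * (q0 y + (\<Sum>w\<in>Y. f y w * Q w)) =
     p0 x * T x y * q0 y + (\<Sum>v\<in>X. e x v * T x y * q0 y * P v) + (\<Sum>w\<in>Y. p0 x * T x y * f y w * Q w)
     + (\<Sum>v\<in>X. \<Sum>w\<in>Y. e x v * T x y * f y w * P v * Q w)" for x y
  proof -
    have 1: "(\<Sum>v\<in>X. e x v * P v) * T x y * q0 y = (\<Sum>v\<in>X. e x v * T x y * q0 y * P v)"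
      unfolding sum_distrib_right by (intro sum.cong refl) (simp add: algebra_simps)
    have 2: "p0 x * T x y * (\<Sum>w\<in>Y. f y w * Q w) = (\<Sum>w\<in>Y. p0 x * T x y * f y w * Q w)"
      unfolding sum_distrib_left by (intro sum.cong refl) (simp add: algebra_simps)
    have 3: "(\<Sum>v\<in>X. e x v * P v) * T x y * (\<Sum>w\<in>Y. f y w * Q w) =
        (\<Sum>v\<in>X. \<Sum>w\<in>Y. e x v * T x y * f y w * P v * Q w)"
      unfolding sum_distrib_right[of _ X] sum_product by (intro sum.cong refl) (simp add: algebra_simps)
    show ?thesis unfolding 1[symmetric] 2[symmetric] 3[symmetric] by (simp add: algebra_simps)
  qed
  moreover have "(\<Sum>x<n. \<Sum>y<n. \<Sum>v\<in>X. e x v * T x y * q0 y * P v) =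
      (\<Sum>v\<in>X. (\<Sum>x<n. \<Sum>y<n. e x v * T x y * q0 y) * P v)"
    unfolding sum_swap_last by (simp only: sum_distrib_right)
  moreover have "(\<Sum>x<n. \<Sum>y<n. \<Sum>w\<in>Y. p0 x * T x y * f y w * Q w) =
      (\<Sum>w\<in>Y. (\<Sum>x<n. \<Sum>y<n. p0 x * T x y * f y w) * Q w)"
    unfolding sum_swap_last by (simp only: sum_distrib_right)
  moreover have "(\<Sum>x<n. \<Sum>y<n. \<Sum>v\<in>X. \<Sum>w\<in>Y. e x v * T x y * f y w * P v * Q w) =
      (\<Sum>v\<in>X. \<Sum>w\<in>Y. (\<Sum>x<n. \<Sum>y<n. e x v * T x y * f y w) * P v * Q w)"
    unfolding sum_swap_last[where Z = X] sum_swap_last[where Z = Y] by (simp only: sum_distrib_right)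
  ultimately show ?thesis by (simp only: sum.distrib)
qed

lemma lhs_bilinear:
  assumes inc: "\<And>i. i \<in> {1..l} \<Longrightarrow> \<beta> i \<in> increasing_lists n k" and l: "1 \<le> l"
    and \<Phi>: "\<Phi> \<in> carrier_mat n n" and \<Psi>: "\<And>i. i \<in> {2..l} \<Longrightarrow> \<Psi> i \<in> carrier_mat n n"
    and iab: "(i, a, b) \<in> equations n k l"
  shows "bilinear_in n l \<beta> i (lhs \<Phi> \<Psi> (i, a, b))"
proof -
  have i: "i \<in> {2..l}" "a < k" "b < n - k" using iab by (auto simp: equations_def)
  have \<beta>1: "\<beta> 1 \<in> increasing_lists n k" and \<beta>i: "\<beta> i \<in> increasing_lists n k" using inc l i by auto
  define X Y where "X = coords n (\<beta> 1)" and "Y = coords n (perp_list n (\<beta> i))"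
  have fin: "finite X" "finite Y"
    unfolding X_def Y_def using finite_coords[OF \<beta>1] finite_coords[OF perp_list_increasing[OF \<beta>i]] .
  define T where "T x y = row \<Phi> x \<bullet> row (\<Psi> i) y" for x y
  define p0 where "p0 x = (if Suc x = \<beta> 1 ! a then 1 else 0 :: complex)" for x
  define q0 where "q0 y = (if Suc y = perp_list n (\<beta> i) ! b then 1 else 0 :: complex)" for y
  define e where "e x v = (if v = (a, x) then 1 else 0 :: complex)" for x and v :: "nat \<times> nat"
  define f where "f y w = (if w = (b, y) then 1 else 0 :: complex)" for y and w :: "nat \<times> nat"
  have main: "lhs \<Phi> \<Psi> (i, a, b) (P, Q) =
    (\<Sum>x<n. \<Sum>y<n. p0 x * T x y * q0 y) + (\<Sum>v\<in>X. (\<Sum>x<n. \<Sum>y<n. e x v * T x y * q0 y) * P $$ v)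
    + (\<Sum>w\<in>Y. (\<Sum>x<n. \<Sum>y<n. p0 x * T x y * f y w) * Q i $$ w)
    + (\<Sum>v\<in>X. \<Sum>w\<in>Y. (\<Sum>x<n. \<Sum>y<n. e x v * T x y * f y w) * P $$ v * Q i $$ w)"
    if PQ: "(P, Q) \<in> affine_space n l \<beta>" for P Q
  proof -
    have P: "P \<in> M n (\<beta> 1)" and Q: "Q i \<in> M n (perp_list n (\<beta> i))"
      using PQ i by (auto simp: affine_space_def)
    note perp = perp_list_increasing[OF \<beta>i]
    note Pc = M_carrier[OF P increasing_listsD(1)[OF \<beta>1]]
    note Qc = M_carrier[OF Q increasing_listsD(1)[OF perp]]
    have "lhs \<Phi> \<Psi> (i, a, b) (P, Q) = ((P * \<Phi>) * (Q i * \<Psi> i)\<^sup>T) $$ (a, b)"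
      by (simp add: lhs_def block_def)
    also have "\<dots> = (\<Sum>x<n. \<Sum>y<n. P $$ (a, x) * T x y * Q i $$ (b, y))"
      unfolding T_def by (rule product_transpose_entry[OF Pc Qc \<Phi> \<Psi>[OF i(1)] i(2,3)])
    also have "\<dots> = (\<Sum>x<n. \<Sum>y<n. (p0 x + (\<Sum>v\<in>X. e x v * P $$ v)) * T x y *
        (q0 y + (\<Sum>w\<in>Y. f y w * Q i $$ w)))"
    proof (intro sum.cong refl)
      fix x y assume "x \<in> {..<n}" "y \<in> {..<n}"
      then have xy: "x < n" "y < n" by simp_all
      have "P $$ (a, x) = p0 x + (\<Sum>v\<in>X. e x v * P $$ v)"
        unfolding p0_def e_def X_def by (rule M_entry_affine[OF \<beta>1 P i(2) xy(1)])
      moreover have "Q i $$ (b, y) = q0 y + (\<Sum>w\<in>Y. f y w * Q i $$ w)"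
        unfolding q0_def f_def Y_def by (rule M_entry_affine[OF perp Q i(3) xy(2)])
      ultimately show "P $$ (a, x) * T x y * Q i $$ (b, y) = (p0 x + (\<Sum>v\<in>X. e x v * P $$ v)) * T x y *
        (q0 y + (\<Sum>w\<in>Y. f y w * Q i $$ w))" by (simp only:)
    qed
    finally show ?thesis unfolding double_sum_of_affine_forms[OF fin] .
  qed
  show ?thesis unfolding bilinear_in_def Let_def X_def[symmetric] Y_def[symmetric]
    by (intro exI[of _ "\<Sum>x<n. \<Sum>y<n. p0 x * T x y * q0 y"]
        exI[of _ "\<lambda>v. \<Sum>x<n. \<Sum>y<n. e x v * T x y * q0 y"]
        exI[of _ "\<lambda>w. \<Sum>x<n. \<Sum>y<n. p0 x * T x y * f y w"]
        exI[of _ "\<lambda>v w. \<Sum>x<n. \<Sum>y<n. e x v * T x y * f y w"] ballI)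
      (clarify, rule main)
qed

section \<open>The incidence variety\<close>

lemma poly_fun_sum:
  assumes "\<And>x. x \<in> X \<Longrightarrow> f x \<in> poly_fun n l"
  shows "(\<lambda>A. \<Sum>x\<in>X. f x A) \<in> poly_fun n l"
  using assms by (induction X rule: infinite_finite_induct) (auto intro: poly_fun.intros)

lemma poly_fun_prod:
  assumes "\<And>x. x \<in> X \<Longrightarrow> f x \<in> poly_fun n l"
  shows "(\<lambda>A. \<Prod>x\<in>X. f x A) \<in> poly_fun n l"
  using assms by (induction X rule: infinite_finite_induct) (auto intro: poly_fun.intros)

lemma poly_fun_power:
  assumes "f \<in> poly_fun n l"
  shows "(\<lambda>A. f A ^ m) \<in> poly_fun n l"
  using assms by (induction m) (auto intro: poly_fun.intros)

lemma poly_fun_cong: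
  assumes "f \<in> poly_fun n l"
    and "\<And>i a b. i \<in> {1..l} \<Longrightarrow> a < n \<Longrightarrow> b < n \<Longrightarrow> A i $$ (a, b) = B i $$ (a, b)"
  shows "f A = f B"
  using assms(1) by induction (simp_all add: assms(2))

lemma poly_fun_substitute:
  assumes "f \<in> poly_fun n l"
    and "\<And>i a b. i \<in> {1..l} \<Longrightarrow> a < n \<Longrightarrow> b < n \<Longrightarrow> (\<lambda>A. s A i $$ (a, b)) \<in> poly_fun n l"
  shows "(\<lambda>A. f (s A)) \<in> poly_fun n l"
  using assms(1) by induction (auto intro: poly_fun.intros assms(2))

definition on_line :: "nat \<Rightarrow> (nat \<Rightarrow> complex mat) \<Rightarrow> (nat \<Rightarrow> complex mat) \<Rightarrow> complex \<Rightarrow> nat \<Rightarrow> complex mat" where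
  "on_line n A B t i = mat n n (\<lambda>(a, b). A i $$ (a, b) + t * (B i $$ (a, b) - A i $$ (a, b)))"

lemma poly_fun_on_line:
  assumes "f \<in> poly_fun n l"
  shows "\<exists>p. \<forall>t. f (on_line n A B t) = poly p t"
  using assms
proof induction
  case (const c)
  then show ?case by (intro exI[of _ "[:c:]"]) simp
next
  case (coord i a b)
  then show ?case
    by (intro exI[of _ "[:A i $$ (a, b), B i $$ (a, b) - A i $$ (a, b):]"]) (simp add: on_line_def)
next
  case (add f g)
  then obtain p q where "\<forall>t. f (on_line n A B t) = poly p t" "\<forall>t. g (on_line n A B t) = poly q t" by blast
  then show ?case by (intro exI[of _ "p + q"]) simp
next
  case (mult f g)
  then obtain p q where "\<forall>t. f (on_line n A B t) = poly p t" "\<forall>t. g (on_line n A B t) = poly q t" by blast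
  then show ?case by (intro exI[of _ "p * q"]) simp
qed

text \<open>
  On the line through \<open>A\<close> and \<open>B\<close>, both functions are polynomials in one variable, neither of them
  zero, so some point of the line is a zero of neither.
\<close>

lemma poly_fun_mult_nonzero:
  assumes f: "f \<in> poly_fun n l" "f A \<noteq> 0" and g: "g \<in> poly_fun n l" "g B \<noteq> 0"
  shows "\<exists>C. f C * g C \<noteq> 0"
proof -
  obtain p where p: "\<And>t. f (on_line n A B t) = poly p t" using poly_fun_on_line[OF f(1)] by blast
  obtain q where q: "\<And>t. g (on_line n A B t) = poly q t" using poly_fun_on_line[OF g(1)] by blast
  have "f (on_line n A B 0) = f A" by (rule poly_fun_cong[OF f(1)]) (simp add: on_line_def)
  then have "p \<noteq> 0" using p[of 0] f(2) by auto
  have "g (on_line n A B 1) = g B" by (rule poly_fun_cong[OF g(1)]) (simp add: on_line_def)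
  then have "q \<noteq> 0" using q[of 1] g(2) by auto
  with \<open>p \<noteq> 0\<close> have "p * q \<noteq> 0" by simp
  then obtain t where "poly (p * q) t \<noteq> 0" using poly_all_0_iff_0 by blast
  then have "f (on_line n A B t) * g (on_line n A B t) \<noteq> 0" by (simp add: p q)
  then show ?thesis by blast
qed

lemma poly_fun_prod_nonzero:
  assumes "finite S" "\<And>f. f \<in> S \<Longrightarrow> f \<in> poly_fun n l \<and> (\<exists>A. f A \<noteq> 0)"
  shows "\<exists>A. (\<Prod>f\<in>S. f A) \<noteq> 0"
  using assms
proof (induction S rule: finite_induct)
  case empty
  then show ?case by simp
next
  case (insert f S)
  obtain A where A: "(\<Prod>f\<in>S. f A) \<noteq> 0" using insert by auto
  obtain B where B: "f B \<noteq> 0" using insert.prems by blast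
  have "f \<in> poly_fun n l" "(\<lambda>A. \<Prod>f\<in>S. f A) \<in> poly_fun n l"
    using insert.prems by (auto intro!: poly_fun_prod)
  then obtain C where "f C * (\<Prod>f\<in>S. f C) \<noteq> 0"
    using poly_fun_mult_nonzero[where f = f and g = "\<lambda>A. \<Prod>f\<in>S. f A", OF _ B _ A] by blast
  then show ?case using insert.hyps by auto
qed

definition det_fun :: "nat \<Rightarrow> nat \<Rightarrow> (nat \<Rightarrow> complex mat) \<Rightarrow> complex" where
  "det_fun n i A = (\<Sum>p\<in>{p. p permutes {0..<n}}. signof p * (\<Prod>a\<in>{0..<n}. A i $$ (a, p a)))"

lemma det_fun_poly_fun:
  assumes "i \<in> {1..l}"
  shows "det_fun n i \<in> poly_fun n l"
proof -
  have "(\<lambda>A. \<Sum>p\<in>{p. p permutes {0..<n}}. signof p * (\<Prod>a\<in>{0..<n}. A i $$ (a, p a))) \<in> poly_fun n l"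
  proof (intro poly_fun_sum poly_fun.mult poly_fun.const poly_fun_prod)
    fix p a assume "p \<in> {p. p permutes {0..<n}}" "a \<in> {0..<n}"
    then have "a < n" "p a < n" using permutes_in_image[of p "{0..<n}" a] by auto
    then show "(\<lambda>A. A i $$ (a, p a)) \<in> poly_fun n l" using assms by (intro poly_fun.coord)
  qed
  then show ?thesis by (simp add: det_fun_def[abs_def])
qed

lemma det_fun_eq: "A i \<in> carrier_mat n n \<Longrightarrow> det_fun n i A = det (A i)"
  unfolding det_fun_def by (subst det_def') auto

lemma det_nonzero_invertible:
  assumes "A \<in> carrier_mat n n" "det A \<noteq> (0 :: complex)"
  shows "invertible_mat A"
proof -
  have "A \<in> Units (ring_mat TYPE(complex) n ())" using det_non_zero_imp_unit[OF assms] .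
  then obtain B where "B \<in> carrier_mat n n" "B * A = 1\<^sub>m n" "A * B = 1\<^sub>m n"
    by (auto simp: Units_def ring_mat_def)
  then show ?thesis using assms(1) by (auto simp: invertible_mat_def inverts_mat_def)
qed

lemma invertible_det_nonzero:
  fixes A :: "complex mat"
  assumes "A \<in> carrier_mat n n" "invertible_mat A"
  shows "det A \<noteq> 0"
proof -
  obtain B where "B \<in> carrier_mat n n" "A * B = 1\<^sub>m n" using invertible_inverse[OF assms] .
  then show ?thesis using det_mult[OF assms(1), of B] by auto
qed

text \<open>
  Including the determinants among the factors makes the common point a tuple of invertible matrices.
\<close>

lemma common_nonvanishing_poly_fun:
  assumes "finite S" "\<And>f. f \<in> S \<Longrightarrow> f \<in> poly_fun n l \<and> (\<exists>A. f A \<noteq> 0)"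
  shows "\<exists>h\<in>poly_fun n l. (\<exists>A\<in>GL_tuples n l. h A \<noteq> 0) \<and> (\<forall>A. h A \<noteq> 0 \<longrightarrow> (\<forall>f\<in>S. f A \<noteq> 0))"
proof -
  define S' where "S' = S \<union> det_fun n ` {1..l}"
  have "finite S'" using assms(1) by (simp add: S'_def)
  have S': "f \<in> poly_fun n l \<and> (\<exists>A. f A \<noteq> 0)" if f: "f \<in> S'" for f
  proof (cases "f \<in> S")
    case False
    then obtain i where i: "i \<in> {1..l}" "f = det_fun n i" using f by (auto simp: S'_def)
    have "f (\<lambda>_. 1\<^sub>m n) = 1" unfolding i(2) by (subst det_fun_eq) auto
    then have "f (\<lambda>_. 1\<^sub>m n) \<noteq> 0" by simp
    then show ?thesis using det_fun_poly_fun[OF i(1)] i(2) by blast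
  qed (rule assms(2))
  define h where "h A = (\<Prod>f\<in>S'. f A)" for A
  have h: "h \<in> poly_fun n l" unfolding h_def[abs_def] using S' by (intro poly_fun_prod) blast
  obtain A where A: "h A \<noteq> 0" using poly_fun_prod_nonzero[OF \<open>finite S'\<close> S'] by (auto simp: h_def)
  define B where "B = (\<lambda>i\<in>{1..l}. mat n n (\<lambda>(a, b). A i $$ (a, b)))"
  have "h B = h A" by (rule poly_fun_cong[OF h]) (simp add: B_def)
  then have hB: "h B \<noteq> 0" using A by simp
  have nz: "f C \<noteq> 0" if "h C \<noteq> 0" "f \<in> S'" for C f
    using that \<open>finite S'\<close> by (simp add: h_def)
  have "invertible_mat (B i)" if i: "i \<in> {1..l}" for i
  proof (rule det_nonzero_invertible)
    show Bc: "B i \<in> carrier_mat n n" using i by (simp add: B_def)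
    have "det_fun n i B \<noteq> 0" using i by (intro nz[OF hB]) (simp add: S'_def)
    then show "det (B i) \<noteq> 0" using det_fun_eq[of B i n] Bc by simp
  qed
  then have "B \<in> GL_tuples n l" by (auto simp: GL_tuples_def B_def)
  then show ?thesis using h hB nz by (intro bexI[of _ h] conjI bexI[of _ B]) (auto simp: S'_def)
qed

text \<open>
  Over a tuple of invertible matrices \<open>A\<^sub>i\<close>, a point of this set amounts to a common point \<open>H\<close> of the
  cells of the \<open>\<gamma>\<^sub>i\<close>: the \<open>P\<^sub>i\<close> are the echelon forms of \<open>H\<close>, and \<open>G\<^sub>i\<close> expresses the basis
  \<open>P\<^sub>i * A\<^sub>i\<close> of \<open>H\<close> by the basis \<open>P\<^sub>1 * A\<^sub>1\<close>.
\<close>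

definition incidence ::
    "nat \<Rightarrow> nat \<Rightarrow> nat \<Rightarrow> (nat \<Rightarrow> nat list) \<Rightarrow>
     ((nat \<Rightarrow> complex mat) \<times> (nat \<Rightarrow> complex mat) \<times> (nat \<Rightarrow> complex mat)) set" where
  "incidence n k l \<gamma> = {(A, P, G). (\<forall>i\<in>{1..l}. A i \<in> carrier_mat n n \<and> P i \<in> M n (\<gamma> i)) \<and>
     (\<forall>i\<in>{2..l}. G i \<in> carrier_mat k k \<and> P i * A i = G i * (P 1 * A 1))}"

text \<open>
  The first component of an index tells the kind of parameter: 0 for a coordinate of \<open>P\<^sub>i\<close>, 1 for an
  entry of \<open>A\<^sub>i\<close>, 2 for an entry of \<open>G\<^sub>i\<close>. The parameters include all entries of \<open>A\<^sub>1\<close>, but only the rows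
  of the other \<open>A\<^sub>i\<close> whose index is not a pivot.
\<close>

definition parameter_set :: "nat \<Rightarrow> nat \<Rightarrow> nat \<Rightarrow> (nat \<Rightarrow> nat list) \<Rightarrow> (nat \<times> nat \<times> nat \<times> nat) set" where
  "parameter_set n k l \<gamma> = {0} \<times> (SIGMA i:{1..l}. coords n (\<gamma> i)) \<union> {1} \<times> {1} \<times> {..<n} \<times> {..<n} \<union>
     {1} \<times> (SIGMA i:{2..l}. {a. a < n \<and> Suc a \<notin> set (\<gamma> i)} \<times> {..<n}) \<union> {2} \<times> {2..l} \<times> {..<k} \<times> {..<k}"

fun parameter :: "(nat \<Rightarrow> complex mat) \<times> (nat \<Rightarrow> complex mat) \<times> (nat \<Rightarrow> complex mat) \<Rightarrow>
    nat \<times> nat \<times> nat \<times> nat \<Rightarrow> complex" where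
  "parameter (A, P, G) (t, i, a, b) = (if t = 0 then P i else if t = 1 then A i else G i) $$ (a, b)"

lemma M_entry_cases:
  assumes "\<beta> \<in> increasing_lists n k" "P \<in> M n \<beta>" "i < k" "x < n" "(i, x) \<notin> coords n \<beta>"
  shows "P $$ (i, x) = (if Suc x = \<beta> ! i then 1 else 0)"
proof -
  have "(\<Sum>v\<in>coords n \<beta>. (if v = (i, x) then 1 else 0) * P $$ v) = 0"
    using assms(5) by (intro sum.neutral) auto
  then show ?thesis using M_entry_affine[OF assms(1-4)] by simp
qed

lemma card_nonpivots:
  assumes "\<beta> \<in> increasing_lists n k"
  shows "card {a. a < n \<and> Suc a \<notin> set \<beta>} = n - k"
proof -
  note b = increasing_listsD[OF assms]
  have sub: "set \<beta> \<subseteq> {1..n}" using assms by (simp add: increasing_lists_def)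
  have "bij_betw Suc {a. a < n \<and> Suc a \<notin> set \<beta>} ({1..n} - set \<beta>)"
    by (rule bij_betwI[of _ _ _ "\<lambda>x. x - 1"]) auto
  from bij_betw_same_card[OF this] show ?thesis using sub b
    by (simp add: card_Diff_subset distinct_card)
qed

context
  fixes n k l :: nat and \<gamma> :: "nat \<Rightarrow> nat list"
  assumes \<gamma>: "\<And>i. i \<in> {1..l} \<Longrightarrow> \<gamma> i \<in> increasing_lists n k" and kn: "k \<le> n" and l: "1 \<le> l"
begin

lemma finite_parameter_set: "finite (parameter_set n k l \<gamma>)"
  unfolding parameter_set_def using finite_coords[OF \<gamma>]
  by (intro finite_UnI finite_cartesian_product finite_SigmaI) auto

lemma card_parameter_set:
  "card (parameter_set n k l \<gamma>) \<le> (\<Sum>i=1..l. card (coords n (\<gamma> i))) + n * n + (l - 1) * (n * n - k * (n - k))"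
proof -
  have c1: "card ({0::nat} \<times> (SIGMA i:{1..l}. coords n (\<gamma> i))) = (\<Sum>i=1..l. card (coords n (\<gamma> i)))"
    using finite_coords[OF \<gamma>] by (simp add: card_cartesian_product card_SigmaI)
  have c2: "card ({1::nat} \<times> {1::nat} \<times> {..<n} \<times> {..<n}) = n * n" by (simp add: card_cartesian_product)
  have c3: "card ({1::nat} \<times> (SIGMA i:{2..l}. {a. a < n \<and> Suc a \<notin> set (\<gamma> i)} \<times> {..<n})) = (l - 1) * ((n - k) * n)"
  proof -
    have "card (SIGMA i:{2..l}. {a. a < n \<and> Suc a \<notin> set (\<gamma> i)} \<times> {..<n}) =
        (\<Sum>i\<in>{2..l}. card ({a. a < n \<and> Suc a \<notin> set (\<gamma> i)} \<times> {..<n}))"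
      by (intro card_SigmaI) auto
    also have "\<dots> = (\<Sum>i\<in>{2..l}. (n - k) * n)"
    proof (intro sum.cong refl)
      fix i assume "i \<in> {2..l}"
      then have "\<gamma> i \<in> increasing_lists n k" by (intro \<gamma>) simp
      then show "card ({a. a < n \<and> Suc a \<notin> set (\<gamma> i)} \<times> {..<n}) = (n - k) * n"
        by (simp add: card_cartesian_product card_nonpivots)
    qed
    finally show ?thesis by (simp add: card_cartesian_product)
  qed
  have c4: "card ({2::nat} \<times> {2..l} \<times> {..<k} \<times> {..<k}) = (l - 1) * (k * k)"
    by (simp add: card_cartesian_product)
  have "(n - k) * n + k * k = n * n - k * (n - k)"
  proof -
    obtain m where "n = k + m" using kn le_Suc_ex by blast
    then show ?thesis by (simp add: algebra_simps)
  qed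
  then have "(l - 1) * ((n - k) * n) + (l - 1) * (k * k) = (l - 1) * (n * n - k * (n - k))"
    by (metis distrib_left)
  moreover have "card (parameter_set n k l \<gamma>) \<le> (\<Sum>i=1..l. card (coords n (\<gamma> i))) + n * n +
      (l - 1) * ((n - k) * n) + (l - 1) * (k * k)"
    unfolding parameter_set_def c1[symmetric] c2[symmetric] c3[symmetric] c4[symmetric]
    by (intro order_trans[OF card_Un_le] add_mono order_refl)
  ultimately show ?thesis by simp
qed

abbreviation "incident_polys \<equiv> polys_on (incidence n k l \<gamma>) (parameter_set n k l \<gamma>) parameter"

lemma incident_P_entry:
  assumes "i \<in> {1..l}" "a < k" "x < n"
  shows "(\<lambda>(A, P, G). P i $$ (a, x)) \<in> incident_polys"
proof (cases "(a, x) \<in> coords n (\<gamma> i)")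
  case True
  then have "(\<lambda>p. parameter p (0, i, a, x)) \<in> incident_polys"
    using assms by (intro polys_on.gen) (simp add: parameter_set_def)
  then show ?thesis by (rule polys_on.cong) auto
next
  case False
  show ?thesis
  proof (rule polys_on.cong[OF polys_on.const])
    fix p assume "p \<in> incidence n k l \<gamma>"
    then obtain A P G where p: "p = (A, P, G)" "P i \<in> M n (\<gamma> i)"
      using assms(1) by (auto simp: incidence_def)
    show "(if Suc x = \<gamma> i ! a then 1 else 0) = (case p of (A, P, G) \<Rightarrow> P i $$ (a, x))"
      using M_entry_cases[OF \<gamma>[OF assms(1)] p(2) assms(2,3) False] p(1) by simp
  qed
qed

lemma incident_A1_entry:
  assumes "a < n" "b < n"
  shows "(\<lambda>(A, P, G). A 1 $$ (a, b)) \<in> incident_polys"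
proof -
  have "(\<lambda>p. parameter p (1, 1, a, b)) \<in> incident_polys"
    using assms by (intro polys_on.gen) (simp add: parameter_set_def)
  then show ?thesis by (rule polys_on.cong) auto
qed

text \<open>
  Row \<open>r\<close> of the equation \<open>P\<^sub>i * A\<^sub>i = G\<^sub>i * (P\<^sub>1 * A\<^sub>1)\<close>, solved for the only row of \<open>A\<^sub>i\<close> with a pivot
  index that occurs in it; its coefficient is the pivot entry 1.
\<close>

lemma incident_pivot_row:
  assumes i: "i \<in> {2..l}" and r: "r < k" and b: "b < n" and p: "(A, P, G) \<in> incidence n k l \<gamma>"
  shows "A i $$ (\<gamma> i ! r - 1, b) =
    (\<Sum>t<k. G i $$ (r, t) * (\<Sum>x<n. P 1 $$ (t, x) * A 1 $$ (x, b)))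
    - (\<Sum>x\<in>{x. x < n \<and> Suc x \<notin> set (\<gamma> i)}. P i $$ (r, x) * A i $$ (x, b))"
proof -
  have i1: "i \<in> {1..l}" "1 \<in> {1..l}" using i l by auto
  note g = increasing_listsD[OF \<gamma>[OF i1(1)]]
  have Pi: "P i \<in> M n (\<gamma> i)" and P1: "P 1 \<in> M n (\<gamma> 1)" and Ac: "A i \<in> carrier_mat n n" "A 1 \<in> carrier_mat n n"
    and Gc: "G i \<in> carrier_mat k k" and eq: "P i * A i = G i * (P 1 * A 1)"
    using p i i1 by (auto simp: incidence_def)
  note Pic = M_carrier[OF Pi g(1)] and P1c = M_carrier[OF P1 increasing_listsD(1)[OF \<gamma>[OF i1(2)]]]
  define D where "D = P 1 * A 1"
  have Dc: "D \<in> carrier_mat k n" using P1c Ac by (simp add: D_def)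
  have Dent: "D $$ (t, b) = (\<Sum>x<n. P 1 $$ (t, x) * A 1 $$ (x, b))" if "t < k" for t
    using that b P1c Ac by (simp add: D_def scalar_prod_def lessThan_atLeast0)
  have "(G i * D) $$ (r, b) = (\<Sum>t<k. G i $$ (r, t) * D $$ (t, b))"
    using Gc Dc r b by (simp add: scalar_prod_def lessThan_atLeast0)
  then have R: "(P i * A i) $$ (r, b) = (\<Sum>t<k. G i $$ (r, t) * (\<Sum>x<n. P 1 $$ (t, x) * A 1 $$ (x, b)))"
    using eq Dent by (simp add: D_def)
  have x0: "\<gamma> i ! r - 1 < n" "Suc (\<gamma> i ! r - 1) = \<gamma> i ! r" using g(2)[OF r] by auto
  have "(P i * A i) $$ (r, b) = (\<Sum>x<n. P i $$ (r, x) * A i $$ (x, b))"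
    using Pic Ac r b by (simp add: scalar_prod_def lessThan_atLeast0)
  also have "\<dots> = (\<Sum>x\<in>insert (\<gamma> i ! r - 1) {x. x < n \<and> Suc x \<notin> set (\<gamma> i)}. P i $$ (r, x) * A i $$ (x, b))"
  proof (rule sum.mono_neutral_right)
    show "\<forall>x\<in>{..<n} - insert (\<gamma> i ! r - 1) {x. x < n \<and> Suc x \<notin> set (\<gamma> i)}. P i $$ (r, x) * A i $$ (x, b) = 0"
    proof
      fix x assume x: "x \<in> {..<n} - insert (\<gamma> i ! r - 1) {x. x < n \<and> Suc x \<notin> set (\<gamma> i)}"
      then obtain s where s: "s < k" "Suc x = \<gamma> i ! s" using g(1) by (auto simp: in_set_conv_nth)
      have "s \<noteq> r" using x s x0 by auto
      then have "P i $$ (r, \<gamma> i ! s - 1) = 0" using M_pivot[OF Pi, of r s] r s g(1) by simp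
      moreover have "\<gamma> i ! s - 1 = x" using s(2) by simp
      ultimately show "P i $$ (r, x) * A i $$ (x, b) = 0" by simp
    qed
  qed (use x0 in auto)
  also have "\<dots> = P i $$ (r, \<gamma> i ! r - 1) * A i $$ (\<gamma> i ! r - 1, b) +
      (\<Sum>x\<in>{x. x < n \<and> Suc x \<notin> set (\<gamma> i)}. P i $$ (r, x) * A i $$ (x, b))"
    using x0 r g(1) by (subst sum.insert) auto
  also have "P i $$ (r, \<gamma> i ! r - 1) = 1" using M_pivot[OF Pi, of r r] r g(1) by simp
  finally show ?thesis using R by simp
qed

lemma incident_A_entry:
  assumes i: "i \<in> {1..l}" and a: "a < n" and b: "b < n"
  shows "(\<lambda>(A, P, G). A i $$ (a, b)) \<in> incident_polys"
proof (cases "i = 1")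
  case True
  then show ?thesis using incident_A1_entry[OF a b] by simp
next
  case False
  then have i2: "i \<in> {2..l}" using i by auto
  have nonpivot: "(\<lambda>(A, P, G). A i $$ (x, b)) \<in> incident_polys" if "x < n" "Suc x \<notin> set (\<gamma> i)" for x
  proof -
    have "(\<lambda>p. parameter p (1, i, x, b)) \<in> incident_polys"
      using that b i2 by (intro polys_on.gen) (simp add: parameter_set_def)
    then show ?thesis by (rule polys_on.cong) auto
  qed
  show ?thesis
  proof (cases "Suc a \<in> set (\<gamma> i)")
    case False
    then show ?thesis by (intro nonpivot a)
  next
    case True
    then obtain r where r: "r < k" "Suc a = \<gamma> i ! r"
      using increasing_listsD(1)[OF \<gamma>[OF i]] by (auto simp: in_set_conv_nth)
    have G: "(\<lambda>(A, P, G). G i $$ (r, t)) \<in> incident_polys" if "t < k" for t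
    proof -
      have "(\<lambda>p. parameter p (2, i, r, t)) \<in> incident_polys"
        using that r i2 by (intro polys_on.gen) (simp add: parameter_set_def)
      then show ?thesis by (rule polys_on.cong) auto
    qed
    have one: "1 \<in> {1..l}" using l by simp
    have "(\<lambda>p. (\<Sum>t<k. (\<lambda>(A, P, G). G i $$ (r, t)) p *
          (\<Sum>x<n. (\<lambda>(A, P, G). P 1 $$ (t, x)) p * (\<lambda>(A, P, G). A 1 $$ (x, b)) p))
        - (\<Sum>x\<in>{x. x < n \<and> Suc x \<notin> set (\<gamma> i)}. (\<lambda>(A, P, G). P i $$ (r, x)) p * (\<lambda>(A, P, G). A i $$ (x, b)) p))
        \<in> incident_polys" (is "?f \<in> _")
      by (intro polys_on_diff polys_on_sum polys_on.mult)
        (use G incident_P_entry[OF one] incident_A1_entry[OF _ b] incident_P_entry[OF i r(1)] nonpivot in auto)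
    then show ?thesis
    proof (rule polys_on.cong)
      fix p assume p: "p \<in> incidence n k l \<gamma>"
      obtain A P G where pe: "p = (A, P, G)" by (cases p) auto
      have "a = \<gamma> i ! r - 1" using r(2) by simp
      then show "?f p = (case p of (A, P, G) \<Rightarrow> A i $$ (a, b))"
        using incident_pivot_row[OF i2 r(1) b p[unfolded pe]] pe by simp
    qed
  qed
qed

definition entry_positions :: "(nat \<times> nat \<times> nat) set" where
  "entry_positions = {1..l} \<times> {..<n} \<times> {..<n}"

definition entry :: "(nat \<Rightarrow> complex mat) \<Rightarrow> nat \<times> nat \<times> nat \<Rightarrow> complex" where
  "entry A = (\<lambda>(i, a, b). A i $$ (a, b))"

lemma polynomial_in_entries:
  assumes "\<exists>e\<in>exponents entry_positions d. c e \<noteq> 0"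
  defines "f \<equiv> (\<lambda>A. \<Sum>e\<in>exponents entry_positions d. c e * monomial entry_positions (entry A) e)"
  shows "f \<in> poly_fun n l" and "\<exists>A. f A \<noteq> 0"
proof -
  have "(\<lambda>A. entry A j) \<in> poly_fun n l" if j: "j \<in> entry_positions" for j
  proof -
    obtain i a b where "j = (i, a, b)" "i \<in> {1..l}" "a < n" "b < n" using j by (auto simp: entry_positions_def)
    then show ?thesis by (simp add: entry_def poly_fun.coord)
  qed
  then show "f \<in> poly_fun n l"
    unfolding f_def monomial_def
    by (intro poly_fun_sum poly_fun.mult poly_fun.const poly_fun_prod poly_fun_power)
  have "finite entry_positions" by (simp add: entry_positions_def)
  then obtain v where v: "(\<Sum>e\<in>exponents entry_positions d. c e * monomial entry_positions v e) \<noteq> 0"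
    using polynomial_nonvanishing_point assms(1) by blast
  define A where "A i = mat n n (\<lambda>(a, b). v (i, a, b))" for i
  have "monomial entry_positions (entry A) e = monomial entry_positions v e" for e
    by (intro monomial_cong) (auto simp: entry_positions_def entry_def A_def)
  then have "f A \<noteq> 0" using v by (simp add: f_def)
  then show "\<exists>A. f A \<noteq> 0" by blast
qed

lemma card_entry_positions: "card entry_positions = l * (n * n)"
  by (simp add: entry_positions_def card_cartesian_product)

text \<open>
  The parameter count for \<open>\<Sum>i. dim (M n \<gamma>\<^sub>i) = (l - 1) * k * (n - k)\<close>, the value for a Schubert problem.
\<close>

lemma total_dimension: "(l - 1) * (k * (n - k)) + n * n + (l - 1) * (n * n - k * (n - k)) = l * (n * n)"
proof -
  have "k * (n - k) \<le> n * n" using kn by (intro mult_le_mono) auto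
  then have "(l - 1) * (k * (n - k)) + (l - 1) * (n * n - k * (n - k)) = (l - 1) * (n * n)"
    by (metis distrib_left le_add_diff_inverse)
  moreover have "(l - 1) * (n * n) + n * n = l * (n * n)" using l by (cases l) auto
  ultimately show ?thesis by linarith
qed

lemma incident_entry:
  assumes "j \<in> entry_positions"
  shows "(\<lambda>p. entry (fst p) j) \<in> incident_polys"
proof -
  obtain i a b where j: "j = (i, a, b)" "i \<in> {1..l}" "a < n" "b < n" using assms by (auto simp: entry_positions_def)
  show ?thesis using incident_A_entry[OF j(2-4)] by (rule polys_on.cong) (auto simp: j(1) entry_def)
qed

text \<open>
  The fibre over a tuple of the projection from the incidence variety is controlled through one entry of \<open>P\<^sub>1\<close> at a
  time. This suffices for finiteness, because \<open>P\<^sub>1\<close> and the tuple determine \<open>H\<close>.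
\<close>

lemma generic_finitely_many_incident:
  assumes dim: "(\<Sum>i=1..l. card (coords n (\<gamma> i))) \<le> (l - 1) * (k * (n - k))" and ab: "a < k" "b < n"
  shows "\<exists>f\<in>poly_fun n l. (\<exists>A. f A \<noteq> 0) \<and>
    (\<forall>A. f A \<noteq> 0 \<longrightarrow> finite {P 1 $$ (a, b) | P G. (A, P, G) \<in> incidence n k l \<gamma>})"
proof -
  have fin: "finite entry_positions" by (simp add: entry_positions_def)
  have card: "card (parameter_set n k l \<gamma>) \<le> card entry_positions"
    using card_parameter_set dim total_dimension by (simp add: card_entry_positions)
  (* Matrices are numbered from 1, so this index is free for the adjoined function. *)
  have j0: "(0, 0, 0) \<notin> entry_positions" by (simp add: entry_positions_def)
  have z: "(\<lambda>(A, P, G). P 1 $$ (a, b)) \<in> incident_polys"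
    using incident_P_entry[of 1 a b] l ab by simp
  have "\<exists>d c. (\<exists>e\<in>exponents entry_positions d. c e \<noteq> 0) \<and>
    (\<forall>v. (\<Sum>e\<in>exponents entry_positions d. c e * monomial entry_positions v e) \<noteq> 0 \<longrightarrow>
      finite {(\<lambda>(A, P, G). P 1 $$ (a, b)) p | p. p \<in> incidence n k l \<gamma> \<and> (\<forall>j\<in>entry_positions. entry (fst p) j = v j)})"
    by (rule generic_fibre_finite[OF finite_parameter_set fin card j0 _ z]) (rule incident_entry)
  then obtain d c where c: "\<exists>e\<in>exponents entry_positions d. c e \<noteq> 0" and
    fibre: "\<forall>v. (\<Sum>e\<in>exponents entry_positions d. c e * monomial entry_positions v e) \<noteq> 0 \<longrightarrow>
      finite {(\<lambda>(A, P, G). P 1 $$ (a, b)) p | p. p \<in> incidence n k l \<gamma> \<and> (\<forall>j\<in>entry_positions. entry (fst p) j = v j)}"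
    by (elim exE conjE)
  define f where "f = (\<lambda>A. \<Sum>e\<in>exponents entry_positions d. c e * monomial entry_positions (entry A) e)"
  have "finite {P 1 $$ (a, b) | P G. (A, P, G) \<in> incidence n k l \<gamma>}" if "f A \<noteq> 0" for A
  proof -
    have "finite {(\<lambda>(A, P, G). P 1 $$ (a, b)) p | p. p \<in> incidence n k l \<gamma> \<and>
        (\<forall>j\<in>entry_positions. entry (fst p) j = entry A j)}"
      using fibre[rule_format, of "entry A"] that by (simp add: f_def)
    moreover have "{P 1 $$ (a, b) | P G. (A, P, G) \<in> incidence n k l \<gamma>} \<subseteq>
        {(\<lambda>(A, P, G). P 1 $$ (a, b)) p | p. p \<in> incidence n k l \<gamma> \<and>
        (\<forall>j\<in>entry_positions. entry (fst p) j = entry A j)}"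
      by force
    ultimately show ?thesis by (rule finite_subset[rotated])
  qed
  moreover have "f \<in> poly_fun n l" "\<exists>A. f A \<noteq> 0" unfolding f_def by (rule polynomial_in_entries[OF c])+
  ultimately show ?thesis by blast
qed

lemma generic_not_incident:
  assumes dim: "(\<Sum>i=1..l. card (coords n (\<gamma> i))) < (l - 1) * (k * (n - k))"
  shows "\<exists>f\<in>poly_fun n l. (\<exists>A. f A \<noteq> 0) \<and> (\<forall>A. f A \<noteq> 0 \<longrightarrow> (\<forall>P G. (A, P, G) \<notin> incidence n k l \<gamma>))"
proof -
  have fin: "finite entry_positions" by (simp add: entry_positions_def)
  have card: "card (parameter_set n k l \<gamma>) < card entry_positions"
    using card_parameter_set dim total_dimension by (simp add: card_entry_positions)
  have "\<exists>d c. (\<exists>e\<in>exponents entry_positions d. c e \<noteq> 0) \<and> (\<forall>p\<in>incidence n k l \<gamma>.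
      (\<Sum>e\<in>exponents entry_positions d. c e * monomial entry_positions (entry (fst p)) e) = 0)"
    by (rule algebraic_dependence[OF finite_parameter_set fin card]) (rule incident_entry)
  then obtain d c where c: "\<exists>e\<in>exponents entry_positions d. c e \<noteq> 0" and
    rel: "\<forall>p\<in>incidence n k l \<gamma>.
      (\<Sum>e\<in>exponents entry_positions d. c e * monomial entry_positions (entry (fst p)) e) = 0"
    by (elim exE conjE)
  define f where "f = (\<lambda>A. \<Sum>e\<in>exponents entry_positions d. c e * monomial entry_positions (entry A) e)"
  have "f A = 0" if "(A, P, G) \<in> incidence n k l \<gamma>" for A P G
    using bspec[OF rel that] by (simp add: f_def)
  moreover have "f \<in> poly_fun n l" "\<exists>A. f A \<noteq> 0" unfolding f_def by (rule polynomial_in_entries[OF c])+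
  ultimately show ?thesis by blast
qed

end

section \<open>General flags\<close>

definition flag_of :: "nat \<Rightarrow> complex mat \<Rightarrow> complex vec set list" where
  "flag_of n A = map (\<lambda>j. row_comb A ` standard_flag n j) [0..<n + 1]"

lemma flag_of_nth: "j \<le> n \<Longrightarrow> flag_of n A ! j = row_comb A ` standard_flag n j"
  unfolding flag_of_def by (subst nth_map) (auto simp del: upt_Suc)

lemma standard_flag_mono: "i \<le> j \<Longrightarrow> standard_flag n i \<subseteq> standard_flag n j"
  by (auto simp: standard_flag_def)

lemma standard_flag_subspace: "VectorSpace.subspace class_ring (standard_flag n j) (space_V n)"
  by (auto simp: subspace_iff standard_flag_def)

lemma standard_flag_add_smult:
  assumes "v \<in> standard_flag n j" "w \<in> standard_flag n j"
  shows "v + t \<cdot>\<^sub>v w \<in> standard_flag n j" and "v - t \<cdot>\<^sub>v w \<in> standard_flag n j"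
proof -
  have "t \<cdot>\<^sub>v w \<in> standard_flag n j"
    using standard_flag_subspace[of n j] assms(2) unfolding subspace_iff by blast
  then show "v + t \<cdot>\<^sub>v w \<in> standard_flag n j" "v - t \<cdot>\<^sub>v w \<in> standard_flag n j"
    using standard_flag_subspace[of n j] assms(1) subspace_diff unfolding subspace_iff by blast+
qed

lemma represents_iff:
  assumes "A \<in> carrier_mat n n" "invertible_mat A"
  shows "represents n A F \<longleftrightarrow> (\<forall>j\<in>{1..n}. F ! j = row_comb A ` standard_flag n j)"
proof
  assume "represents n A F"
  then show "\<forall>j\<in>{1..n}. F ! j = row_comb A ` standard_flag n j"
    using represents_flag_member by auto
next
  assume R: "\<forall>j\<in>{1..n}. F ! j = row_comb A ` standard_flag n j"
  have "LinearCombinations.module.span class_ring (space_V n) (set (take j (rows A))) = F ! j"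
    if j: "j \<in> {1..n}" for j
  proof -
    have "rows (first_rows j A) = take j (rows A)"
      using assms j by (intro nth_equalityI) (auto simp: first_rows_def intro!: eq_vecI)
    then show ?thesis using R j row_span_first_rows[OF assms(1), of j] by (simp add: row_span_def)
  qed
  then show "represents n A F" using assms by (simp add: represents_def)
qed

lemma represents_flag_of:
  assumes "A \<in> carrier_mat n n" "invertible_mat A"
  shows "represents n A (flag_of n A)"
  unfolding represents_iff[OF assms] using flag_of_nth by auto

lemma flag_of_complete:
  assumes A: "A \<in> carrier_mat n n" "invertible_mat A"
  shows "flag_of n A \<in> complete_flags n"
proof -
  have "flag_of n A ! j \<in> Gr j n" if "j \<le> n" for j
    unfolding flag_of_nth[OF that]
    by (rule row_comb_standard_flag_Gr[OF A(1) that]) (rule invertible_row_comb_ker[OF A])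
  moreover have "flag_of n A ! j \<subseteq> flag_of n A ! Suc j" if "j < n" for j
    using that image_mono[OF standard_flag_mono[of j "Suc j" n]] by (simp add: flag_of_nth)
  moreover have "length (flag_of n A) = n + 1" by (simp add: flag_of_def)
  ultimately show ?thesis by (simp add: complete_flags_def)
qed

definition lower_triangular_mat :: "nat \<Rightarrow> complex mat \<Rightarrow> bool" where
  "lower_triangular_mat n b \<longleftrightarrow> b \<in> carrier_mat n n \<and> (\<forall>i<n. row b i \<in> standard_flag n (Suc i))"

lemma row_span_subset_imp_factor:
  assumes B: "B \<in> carrier_mat k n" and C: "C \<in> carrier_mat m n"
    and R: "\<And>i. i < k \<Longrightarrow> R i \<subseteq> carrier_vec m" and rows: "\<And>i. i < k \<Longrightarrow> row B i \<in> row_comb C ` R i"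
  shows "\<exists>g\<in>carrier_mat k m. B = g * C \<and> (\<forall>i<k. row g i \<in> R i)"
proof -
  have "\<forall>i. \<exists>c. i < k \<longrightarrow> c \<in> R i \<and> row B i = row_comb C c" using rows by blast
  then obtain c where c: "\<And>i. i < k \<Longrightarrow> c i \<in> R i" "\<And>i. i < k \<Longrightarrow> row B i = row_comb C (c i)" by metis
  have cm: "c i \<in> carrier_vec m" if "i < k" for i using c(1)[OF that] R[OF that] by blast
  define g where "g = mat k m (\<lambda>(i, t). c i $ t)"
  have g: "g \<in> carrier_mat k m" by (simp add: g_def)
  have rg: "row g i = c i" if "i < k" for i
    using cm[OF that] that by (intro eq_vecI) (auto simp: g_def)
  have "B = g * C"
  proof (rule eq_rowI)
    fix i assume "i < dim_row (g * C)"
    then have i: "i < k" using g by simp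
    have gC: "g * C \<in> carrier_mat k n" using g C by simp
    have "row (g * C) i = row_comb (g * C) (unit_vec k i)" by (rule row_comb_unit[OF gC i, symmetric])
    also have "\<dots> = row_comb C (row_comb g (unit_vec k i))" by (rule row_comb_mult[OF g C unit_vec_carrier])
    also have "\<dots> = row B i" unfolding row_comb_unit[OF g i] rg[OF i] c(2)[OF i] ..
    finally show "row B i = row (g * C) i" by simp
  qed (use B C g in auto)
  then show ?thesis using g rg c(1) by (intro bexI[of _ g]) auto
qed

text \<open>
  Row \<open>i\<close> of \<open>A'\<close> lies in the member of dimension \<open>i + 1\<close> of the flag, hence is a combination of the
  first \<open>i + 1\<close> rows of \<open>A\<close>.
\<close>

lemma same_flag_lower_triangular:
  assumes A: "represents n A F" and A': "represents n A' F"
  shows "\<exists>b. lower_triangular_mat n b \<and> A' = b * A"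
proof -
  have c: "A \<in> carrier_mat n n" "A' \<in> carrier_mat n n" using A A' by (auto simp: represents_def)
  have rows: "row A' i \<in> row_comb A ` standard_flag n (Suc i)" if "i < n" for i
  proof -
    have j: "1 \<le> Suc i" "Suc i \<le> n" using that by auto
    have "unit_vec n i \<in> standard_flag n (Suc i)" by (auto simp: standard_flag_def unit_vec_def)
    then have "row A' i \<in> F ! Suc i"
      unfolding represents_flag_member[OF A' j] using row_comb_unit[OF c(2) that] by (metis image_eqI)
    then show ?thesis unfolding represents_flag_member[OF A j] .
  qed
  have sub: "standard_flag n (Suc i) \<subseteq> carrier_vec n" for i by (auto simp: standard_flag_def)
  obtain b where "b \<in> carrier_mat n n" "A' = b * A" "\<forall>i<n. row b i \<in> standard_flag n (Suc i)"
    using row_span_subset_imp_factor[where R = "\<lambda>i. standard_flag n (Suc i)", OF c(2,1) sub rows] by blast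
  then show ?thesis unfolding lower_triangular_mat_def by blast
qed

text \<open>
  Forward substitution. The diagonal entries are nonzero: if row \<open>j\<close> had zero in position \<open>j\<close>, it
  would be in the span of the first \<open>j\<close> unit vectors, hence by induction a combination of the rows before it,
  against injectivity.
\<close>

lemma row_comb_lower_triangular:
  assumes b: "lower_triangular_mat n b"
    and inj: "\<And>c. c \<in> carrier_vec n \<Longrightarrow> row_comb b c = 0\<^sub>v n \<Longrightarrow> c = 0\<^sub>v n" and "j \<le> n"
  shows "row_comb b ` standard_flag n j = standard_flag n j"
  using \<open>j \<le> n\<close>
proof (induction j)
  case 0
  have bc: "b \<in> carrier_mat n n" using b by (simp add: lower_triangular_mat_def)
  have "v = 0\<^sub>v n" if "v \<in> standard_flag n 0" for v
    using that unfolding standard_flag_def by (intro eq_vecI) auto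
  moreover have "0\<^sub>v n \<in> standard_flag n 0" by (simp add: standard_flag_def)
  ultimately have "standard_flag n 0 = {0\<^sub>v n}" by blast
  moreover have "row_comb b (0\<^sub>v n) = 0\<^sub>v n" using bc by (intro eq_vecI) auto
  ultimately show ?case by simp
next
  case (Suc j)
  have bc: "b \<in> carrier_mat n n" using b by (simp add: lower_triangular_mat_def)
  have j: "j < n" using Suc.prems by simp
  have IH: "row_comb b ` standard_flag n j = standard_flag n j" using Suc by simp
  have step: "standard_flag n j \<subseteq> standard_flag n (Suc j)" by (intro standard_flag_mono) simp
  have rowj: "row b j \<in> standard_flag n (Suc j)" using b j by (simp add: lower_triangular_mat_def)
  have drop: "v \<in> standard_flag n j" if "v \<in> standard_flag n (Suc j)" "v $ j = 0" for v
  proof -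
    have "v $ i = 0" if i: "i < n" "j \<le> i" for i
      using i \<open>v \<in> standard_flag n (Suc j)\<close> \<open>v $ j = 0\<close> by (cases "i = j") (auto simp: standard_flag_def)
    moreover have "v \<in> carrier_vec n" using that(1) by (simp add: standard_flag_def)
    ultimately show ?thesis unfolding standard_flag_def by blast
  qed
  have unit: "unit_vec n j \<in> standard_flag n (Suc j)" by (auto simp: standard_flag_def unit_vec_def)
  have split: "\<exists>d\<in>standard_flag n j. v = d + v $ j \<cdot>\<^sub>v unit_vec n j" if v: "v \<in> standard_flag n (Suc j)" for v
  proof (rule bexI)
    have vc: "v \<in> carrier_vec n" using v by (simp add: standard_flag_def)
    show "v = (v - v $ j \<cdot>\<^sub>v unit_vec n j) + v $ j \<cdot>\<^sub>v unit_vec n j" using vc by (intro eq_vecI) auto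
    show "v - v $ j \<cdot>\<^sub>v unit_vec n j \<in> standard_flag n j"
    proof (rule drop)
      show "v - v $ j \<cdot>\<^sub>v unit_vec n j \<in> standard_flag n (Suc j)" by (rule standard_flag_add_smult(2)[OF v unit])
      show "(v - v $ j \<cdot>\<^sub>v unit_vec n j) $ j = 0" using vc j by simp
    qed
  qed
  have comb: "row_comb b (d + t \<cdot>\<^sub>v unit_vec n j) = row_comb b d + t \<cdot>\<^sub>v row b j" if d: "d \<in> carrier_vec n" for d t
  proof -
    have bt: "b\<^sup>T \<in> carrier_mat n n" using bc by simp
    show ?thesis using mult_add_distrib_mat_vec[OF bt d, of "t \<cdot>\<^sub>v unit_vec n j"]
        mult_mat_vec[OF bt unit_vec_carrier, of t j] row_comb_unit[OF bc j] by simp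
  qed
  have diag: "row b j $ j \<noteq> 0"
  proof
    assume "row b j $ j = 0"
    then have "row b j \<in> row_comb b ` standard_flag n j" using drop[OF rowj] IH by simp
    then obtain d where d: "d \<in> standard_flag n j" "row b j = row_comb b d" by auto
    have dc: "d \<in> carrier_vec n" using d by (simp add: standard_flag_def)
    have "row_comb b (unit_vec n j - d) = row b j - row_comb b d"
      unfolding row_comb_diff[OF bc unit_vec_carrier dc] row_comb_unit[OF bc j] ..
    also have "\<dots> = 0\<^sub>v n"
      unfolding d(2) using row_comb_carrier[OF bc, of d] by (intro eq_vecI) auto
    finally have "row_comb b (unit_vec n j - d) = 0\<^sub>v n" .
    moreover have "unit_vec n j - d \<in> carrier_vec n" using dc by simp
    ultimately have "unit_vec n j - d = 0\<^sub>v n" using inj by blast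
    then have "(unit_vec n j - d) $ j = 0" using j by simp
    then show False using d(1) dc j by (simp add: standard_flag_def)
  qed
  show ?case
  proof (intro equalityI subsetI)
    fix w assume "w \<in> row_comb b ` standard_flag n (Suc j)"
    then obtain v where v: "v \<in> standard_flag n (Suc j)" "w = row_comb b v" by auto
    obtain d where d: "d \<in> standard_flag n j" "v = d + v $ j \<cdot>\<^sub>v unit_vec n j" using split[OF v(1)] by blast
    have dc: "d \<in> carrier_vec n" using d(1) by (simp add: standard_flag_def)
    have "w = row_comb b d + v $ j \<cdot>\<^sub>v row b j" using comb[OF dc, of "v $ j"] d(2) v(2) by simp
    moreover have "row_comb b d \<in> standard_flag n (Suc j)" using IH d(1) step by blast
    ultimately show "w \<in> standard_flag n (Suc j)" using standard_flag_add_smult(1)[OF _ rowj] by simp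
  next
    fix w assume w: "w \<in> standard_flag n (Suc j)"
    have wc: "w \<in> carrier_vec n" using w by (simp add: standard_flag_def)
    define t where "t = w $ j / row b j $ j"
    have rc: "row b j \<in> carrier_vec n" using bc j by simp
    have "w - t \<cdot>\<^sub>v row b j \<in> standard_flag n j"
    proof (rule drop)
      show "w - t \<cdot>\<^sub>v row b j \<in> standard_flag n (Suc j)" by (rule standard_flag_add_smult(2)[OF w rowj])
      have "(w - t \<cdot>\<^sub>v row b j) $ j = w $ j - t * row b j $ j" using wc bc j by simp
      then show "(w - t \<cdot>\<^sub>v row b j) $ j = 0" using diag by (simp add: t_def)
    qed
    then have "w - t \<cdot>\<^sub>v row b j \<in> row_comb b ` standard_flag n j" using IH by simp
    then obtain d where d: "d \<in> standard_flag n j" "w - t \<cdot>\<^sub>v row b j = row_comb b d" by auto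
    have dc: "d \<in> carrier_vec n" using d by (simp add: standard_flag_def)
    have "w = (w - t \<cdot>\<^sub>v row b j) + t \<cdot>\<^sub>v row b j" using wc bc by (intro eq_vecI) auto
    also have "\<dots> = row_comb b (d + t \<cdot>\<^sub>v unit_vec n j)" using comb[OF dc] d(2) by simp
    finally have "w = row_comb b (d + t \<cdot>\<^sub>v unit_vec n j)" .
    moreover have "d + t \<cdot>\<^sub>v unit_vec n j \<in> standard_flag n (Suc j)"
      by (rule standard_flag_add_smult(1)[OF subsetD[OF step d(1)] unit])
    ultimately show "w \<in> row_comb b ` standard_flag n (Suc j)" by blast
  qed
qed

lemma lower_triangular_same_flag:
  assumes b: "lower_triangular_mat n b" and X: "X \<in> carrier_mat n n" "invertible_mat X"
    and bX: "invertible_mat (b * X)"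
  shows "represents n (b * X) (flag_of n X)"
proof -
  have bc: "b \<in> carrier_mat n n" using b by (simp add: lower_triangular_mat_def)
  have bXc: "b * X \<in> carrier_mat n n" using bc X by simp
  have inj: "c = 0\<^sub>v n" if c: "c \<in> carrier_vec n" "row_comb b c = 0\<^sub>v n" for c
  proof (rule invertible_row_comb_ker[OF bXc bX c(1)])
    have "row_comb (b * X) c = row_comb X (0\<^sub>v n)" using row_comb_mult[OF bc X(1) c(1)] c(2) by simp
    also have "\<dots> = 0\<^sub>v n" using X(1) by (intro eq_vecI) auto
    finally show "row_comb (b * X) c = 0\<^sub>v n" .
  qed
  show ?thesis unfolding represents_iff[OF bXc bX]
  proof
    fix j assume j: "j \<in> {1..n}"
    have "row_comb (b * X) ` standard_flag n j = row_comb X ` (row_comb b ` standard_flag n j)"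
      unfolding image_image
      by (intro image_cong refl row_comb_mult[OF bc X(1)]) (simp add: standard_flag_def)
    also have "row_comb b ` standard_flag n j = standard_flag n j"
      using j by (intro row_comb_lower_triangular[OF b inj]) auto
    finally show "flag_of n X ! j = row_comb (b * X) ` standard_flag n j"
      using j by (simp add: flag_of_nth)
  qed
qed

definition flags_of_nonvanishing :: "nat \<Rightarrow> nat \<Rightarrow> ((nat \<Rightarrow> complex mat) \<Rightarrow> complex) \<Rightarrow> (nat \<Rightarrow> complex vec set list) set" where
  "flags_of_nonvanishing n l h = {F \<in> {1..l} \<rightarrow>\<^sub>E complete_flags n.
     \<exists>A\<in>GL_tuples n l. h A \<noteq> 0 \<and> (\<forall>i\<in>{1..l}. represents n (A i) (F i))}"

lemma GL_tuplesD:
  assumes "A \<in> GL_tuples n l" "i \<in> {1..l}"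
  shows "A i \<in> carrier_mat n n" "invertible_mat (A i)"
  using assms by (auto simp: GL_tuples_def)

lemma flags_of_nonvanishing_nonempty:
  assumes "A \<in> GL_tuples n l" "h A \<noteq> 0"
  shows "flags_of_nonvanishing n l h \<noteq> {}"
proof -
  have "(\<lambda>i\<in>{1..l}. flag_of n (A i)) \<in> flags_of_nonvanishing n l h"
    using assms GL_tuplesD[OF assms(1)] represents_flag_of flag_of_complete
    by (auto simp: flags_of_nonvanishing_def intro!: bexI[of _ A])
  then show ?thesis by blast
qed

text \<open>
  The preimage \<open>V\<close> of this set of flags in \<open>GL\<^sub>n\<close>-tuples consists of the orbits, under lower triangular
  matrices, of the tuples at which \<open>h\<close> does not vanish. If \<open>A \<in> V\<close> and \<open>b * A\<close> is such a tuple, the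
  polynomial function \<open>X \<mapsto> h (b * X)\<close> does not vanish at \<open>A\<close>, and any \<open>X\<close> at which it does not vanish
  is in \<open>V\<close>, since \<open>X\<close> and \<open>b * X\<close> represent the same flags.
\<close>

lemma flags_of_nonvanishing_open:
  assumes h: "h \<in> poly_fun n l"
  shows "zariski_open_flags n l (flags_of_nonvanishing n l h)"
proof -
  define U where "U = flags_of_nonvanishing n l h"
  define V where "V = {A \<in> GL_tuples n l. \<exists>F\<in>U. \<forall>i\<in>{1..l}. represents n (A i) (F i)}"
  define S where "S = {g \<in> poly_fun n l. \<forall>X\<in>GL_tuples n l. g X \<noteq> 0 \<longrightarrow> X \<in> V}"
  have "V = {A \<in> GL_tuples n l. \<exists>f\<in>S. f A \<noteq> 0}"
  proof (intro equalityI subsetI)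
    fix A assume "A \<in> {A \<in> GL_tuples n l. \<exists>f\<in>S. f A \<noteq> 0}"
    then show "A \<in> V" by (auto simp: S_def)
  next
    fix A assume A: "A \<in> V"
    then obtain F where AG: "A \<in> GL_tuples n l" and F: "F \<in> U" "\<And>i. i \<in> {1..l} \<Longrightarrow> represents n (A i) (F i)"
      by (auto simp: V_def)
    from F(1) obtain A' where A': "A' \<in> GL_tuples n l" "h A' \<noteq> 0" "\<And>i. i \<in> {1..l} \<Longrightarrow> represents n (A' i) (F i)"
      by (auto simp: U_def flags_of_nonvanishing_def)
    have "\<forall>i. \<exists>b. i \<in> {1..l} \<longrightarrow> lower_triangular_mat n b \<and> A' i = b * A i"
      using same_flag_lower_triangular[OF F(2) A'(3)] by blast
    then obtain b where b: "\<And>i. i \<in> {1..l} \<Longrightarrow> lower_triangular_mat n (b i)"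
      "\<And>i. i \<in> {1..l} \<Longrightarrow> A' i = b i * A i" by metis
    have bc: "b i \<in> carrier_mat n n" if "i \<in> {1..l}" for i
      using b(1)[OF that] by (simp add: lower_triangular_mat_def)
    define s where "s X = (\<lambda>i\<in>{1..l}. mat n n (\<lambda>(x, y). \<Sum>t<n. b i $$ (x, t) * X i $$ (t, y)))"
      for X :: "nat \<Rightarrow> complex mat"
    have s: "s X i = b i * X i" if "i \<in> {1..l}" "X \<in> GL_tuples n l" for X i
      using bc[OF that(1)] GL_tuplesD[OF that(2,1)] that(1)
      by (intro eq_matI) (auto simp: s_def scalar_prod_def lessThan_atLeast0)
    define g where "g X = h (s X)" for X
    have "g \<in> poly_fun n l"
      unfolding g_def[abs_def]
    proof (rule poly_fun_substitute[OF h])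
      fix i x y assume i: "i \<in> {1..l}" "x < n" "y < n"
      have "(\<lambda>X. \<Sum>t<n. b i $$ (x, t) * X i $$ (t, y)) \<in> poly_fun n l"
        using i by (intro poly_fun_sum poly_fun.mult poly_fun.const poly_fun.coord) auto
      then show "(\<lambda>X. s X i $$ (x, y)) \<in> poly_fun n l" using i by (simp add: s_def)
    qed
    moreover have "X \<in> V" if X: "X \<in> GL_tuples n l" "g X \<noteq> 0" for X
    proof -
      note XD = GL_tuplesD[OF X(1)]
      define G where "G = (\<lambda>i\<in>{1..l}. flag_of n (X i))"
      have inv: "invertible_mat (s X i)" if i: "i \<in> {1..l}" for i
      proof -
        have "det (b i * A i) \<noteq> 0"
          using invertible_det_nonzero[OF GL_tuplesD[OF A'(1) i]] by (simp add: b(2)[OF i])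
        then have "det (b i) \<noteq> 0" using det_mult[OF bc[OF i] GL_tuplesD(1)[OF AG i]] by simp
        then have "det (b i * X i) \<noteq> 0"
          using det_mult[OF bc[OF i] XD(1)[OF i]] invertible_det_nonzero[OF XD[OF i]] by simp
        then show ?thesis unfolding s[OF i X(1)] using bc[OF i] XD(1)[OF i]
          by (intro det_nonzero_invertible[of _ n]) auto
      qed
      have "s X \<in> GL_tuples n l"
        using inv by (auto simp: GL_tuples_def s_def)
      moreover have "represents n (s X i) (G i)" if i: "i \<in> {1..l}" for i
        using lower_triangular_same_flag[OF b(1)[OF i] XD[OF i]] inv[OF i] i
        by (simp add: s[OF i X(1)] G_def)
      moreover have "G \<in> {1..l} \<rightarrow>\<^sub>E complete_flags n"
        using flag_of_complete[OF XD] by (auto simp: G_def)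
      ultimately have "G \<in> U" using X(2) by (auto simp: U_def flags_of_nonvanishing_def g_def)
      moreover have "\<forall>i\<in>{1..l}. represents n (X i) (G i)"
        using represents_flag_of[OF XD] by (simp add: G_def)
      ultimately show ?thesis using X(1) by (auto simp: V_def)
    qed
    moreover have "g A \<noteq> 0"
    proof -
      have "s A = A'"
      proof
        fix i show "s A i = A' i"
        proof (cases "i \<in> {1..l}")
          case True
          then show ?thesis using s[OF True AG] b(2) by simp
        next
          case False
          then show ?thesis using A'(1) unfolding s_def GL_tuples_def
            by (simp only: restrict_def PiE_def extensional_def) auto
        qed
      qed
      then show ?thesis using A'(2) by (simp add: g_def)
    qed
    ultimately show "A \<in> {A \<in> GL_tuples n l. \<exists>f\<in>S. f A \<noteq> 0}" using AG by (auto simp: S_def)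
  qed
  then have "zariski_open_GL n l V" unfolding zariski_open_GL_def by (intro exI[of _ S]) (auto simp: S_def)
  moreover have "U \<subseteq> {1..l} \<rightarrow>\<^sub>E complete_flags n" by (auto simp: U_def flags_of_nonvanishing_def)
  ultimately show ?thesis unfolding zariski_open_flags_def U_def[symmetric] V_def by blast
qed

lemma finite_matrices:
  assumes "X \<subseteq> carrier_mat k n" "\<And>a b. a < k \<Longrightarrow> b < n \<Longrightarrow> finite ((\<lambda>P. P $$ (a, b)) ` X)"
  shows "finite X"
proof -
  define I where "I = {..<k} \<times> {..<n}"
  define E where "E P = (\<lambda>(a, b)\<in>I. P $$ (a, b))" for P :: "'a mat"
  have "E ` X \<subseteq> (\<Pi>\<^sub>E v\<in>I. (\<lambda>P. P $$ v) ` X)" by (auto simp: E_def)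
  moreover have "finite (\<Pi>\<^sub>E v\<in>I. (\<lambda>P. P $$ v) ` X)"
    using assms(2) by (intro finite_PiE) (auto simp: I_def)
  ultimately have "finite (E ` X)" by (rule finite_subset)
  moreover have "inj_on E X"
  proof (rule inj_onI)
    fix P Q assume PQ: "P \<in> X" "Q \<in> X" "E P = E Q"
    have "P $$ (a, b) = Q $$ (a, b)" if "a < k" "b < n" for a b
      using fun_cong[OF PQ(3), of "(a, b)"] that by (simp add: E_def I_def)
    moreover have "P \<in> carrier_mat k n" "Q \<in> carrier_mat k n" using PQ(1,2) assms(1) by blast+
    ultimately show "P = Q" by (intro eq_matI) auto
  qed
  ultimately show ?thesis by (rule finite_imageD)
qed

lemma incidence_cong:
  assumes "\<And>i. i \<in> {1..l} \<Longrightarrow> \<gamma> i = \<gamma>' i"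
  shows "incidence n k l \<gamma> = incidence n k l \<gamma>'"
  using assms unfolding incidence_def by (intro Collect_cong) (auto split: prod.splits)

text \<open>
  The open condition behind the theorem. For \<open>\<gamma>\<^sub>i \<le> \<beta>\<^sub>i\<close>, the dimensions of the \<open>M n \<gamma>\<^sub>i\<close> add up to
  less than those of the \<open>M n \<beta>\<^sub>i\<close> unless all \<open>\<gamma>\<^sub>i = \<beta>\<^sub>i\<close>, so generically only the big cells meet.
\<close>

lemma generic_tuples:
  assumes kn: "k < n" and l: "1 \<le> l" and \<beta>: "schubert_problem n k l \<beta>"
  shows "\<exists>h\<in>poly_fun n l. (\<exists>A\<in>GL_tuples n l. h A \<noteq> 0) \<and>
    (\<forall>A. h A \<noteq> 0 \<longrightarrow> finite {P 1 | P G. (A, P, G) \<in> incidence n k l \<beta>} \<and>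
      (\<forall>\<gamma> P G. (\<forall>i\<in>{1..l}. \<gamma> i \<in> increasing_lists n k \<and> (\<forall>r<k. \<gamma> i ! r \<le> \<beta> i ! r)) \<longrightarrow>
        (A, P, G) \<in> incidence n k l \<gamma> \<longrightarrow> (\<forall>i\<in>{1..l}. \<gamma> i = \<beta> i)))"
proof -
  have inc: "\<beta> i \<in> increasing_lists n k" if "i \<in> {1..l}" for i
    using \<beta> that by (simp add: schubert_problem_def)
  have kn': "k \<le> n" using kn by simp
  have dim: "(\<Sum>i=1..l. card (coords n (\<beta> i))) = (l - 1) * (k * (n - k))"
    by (rule schubert_problem_sum_coords[OF \<beta> l])
  (* Restricting the families of pivot lists to extensional ones leaves finitely many of them. *)
  define \<Gamma> where "\<Gamma> = {\<gamma> \<in> {1..l} \<rightarrow>\<^sub>E increasing_lists n k.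
      (\<forall>i\<in>{1..l}. \<forall>r<k. \<gamma> i ! r \<le> \<beta> i ! r) \<and> (\<exists>i\<in>{1..l}. \<gamma> i \<noteq> \<beta> i)}"
  have "finite (increasing_lists n k)"
    by (rule finite_subset[OF _ finite_lists_length_eq[of "{1..n}" k]]) (auto simp: increasing_lists_def)
  then have "finite \<Gamma>" unfolding \<Gamma>_def by (intro finite_subset[OF _ finite_PiE[of "{1..l}"]]) auto
  have "\<exists>f. f \<in> poly_fun n l \<and> (\<exists>A. f A \<noteq> 0) \<and> (\<forall>A. f A \<noteq> 0 \<longrightarrow> (\<forall>P G. (A, P, G) \<notin> incidence n k l \<gamma>))"
    if \<gamma>: "\<gamma> \<in> \<Gamma>" for \<gamma>
    unfolding Bex_def[symmetric]
  proof (rule generic_not_incident[OF _ kn' l])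
    show g: "\<gamma> i \<in> increasing_lists n k" if "i \<in> {1..l}" for i using \<gamma> that by (auto simp: \<Gamma>_def)
    obtain i where i: "i \<in> {1..l}" "\<gamma> i \<noteq> \<beta> i" using \<gamma> by (auto simp: \<Gamma>_def)
    have le: "\<gamma> i ! r \<le> \<beta> i ! r" if "i \<in> {1..l}" "r < k" for i r using \<gamma> that by (auto simp: \<Gamma>_def)
    have "(\<Sum>i=1..l. card (coords n (\<gamma> i))) < (\<Sum>i=1..l. card (coords n (\<beta> i)))"
    proof (rule sum_strict_mono_ex1)
      show "\<forall>x\<in>{1..l}. card (coords n (\<gamma> x)) \<le> card (coords n (\<beta> x))"
        using card_coords_mono[OF g inc le] by blast
      show "\<exists>x\<in>{1..l}. card (coords n (\<gamma> x)) < card (coords n (\<beta> x))"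
        using card_coords_strict_mono[OF g[OF i(1)] inc[OF i(1)] le[OF i(1)] i(2)] i(1) by blast
    qed simp
    then show "(\<Sum>i=1..l. card (coords n (\<gamma> i))) < (l - 1) * (k * (n - k))" using dim by simp
  qed
  then have "\<forall>\<gamma>\<in>\<Gamma>. \<exists>f. f \<in> poly_fun n l \<and> (\<exists>A. f A \<noteq> 0) \<and>
      (\<forall>A. f A \<noteq> 0 \<longrightarrow> (\<forall>P G. (A, P, G) \<notin> incidence n k l \<gamma>))" by (rule ballI)
  from bchoice[OF this] obtain f where
    f0: "\<forall>\<gamma>\<in>\<Gamma>. f \<gamma> \<in> poly_fun n l \<and> (\<exists>A. f \<gamma> A \<noteq> 0) \<and>
      (\<forall>A. f \<gamma> A \<noteq> 0 \<longrightarrow> (\<forall>P G. (A, P, G) \<notin> incidence n k l \<gamma>))" ..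
  have f: "f \<gamma> \<in> poly_fun n l \<and> (\<exists>A. f \<gamma> A \<noteq> 0)"
    "\<And>A P G. f \<gamma> A \<noteq> 0 \<Longrightarrow> (A, P, G) \<notin> incidence n k l \<gamma>" if "\<gamma> \<in> \<Gamma>" for \<gamma>
    using bspec[OF f0 that] by simp_all
  have "\<exists>f. f \<in> poly_fun n l \<and> (\<exists>A. f A \<noteq> 0) \<and>
      (\<forall>A. f A \<noteq> 0 \<longrightarrow> finite {P 1 $$ v | P G. (A, P, G) \<in> incidence n k l \<beta>})"
    if v: "v \<in> {..<k} \<times> {..<n}" for v
  proof -
    obtain a b where ab: "v = (a, b)" "a < k" "b < n" using v by auto
    have "(\<Sum>i=1..l. card (coords n (\<beta> i))) \<le> (l - 1) * (k * (n - k))" using dim by simp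
    from generic_finitely_many_incident[OF inc kn' l this ab(2,3)] show ?thesis
      unfolding ab(1) Bex_def .
  qed
  then have "\<forall>v\<in>{..<k} \<times> {..<n}. \<exists>f. f \<in> poly_fun n l \<and> (\<exists>A. f A \<noteq> 0) \<and>
      (\<forall>A. f A \<noteq> 0 \<longrightarrow> finite {P 1 $$ v | P G. (A, P, G) \<in> incidence n k l \<beta>})" by (rule ballI)
  from bchoice[OF this] obtain g where
    g0: "\<forall>v\<in>{..<k} \<times> {..<n}. g v \<in> poly_fun n l \<and> (\<exists>A. g v A \<noteq> 0) \<and>
      (\<forall>A. g v A \<noteq> 0 \<longrightarrow> finite {P 1 $$ v | P G. (A, P, G) \<in> incidence n k l \<beta>})" ..
  have g: "g v \<in> poly_fun n l \<and> (\<exists>A. g v A \<noteq> 0)"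
    "\<And>A. g v A \<noteq> 0 \<Longrightarrow> finite {P 1 $$ v | P G. (A, P, G) \<in> incidence n k l \<beta>}"
    if "v \<in> {..<k} \<times> {..<n}" for v
    using bspec[OF g0 that] by blast+
  define S where "S = f ` \<Gamma> \<union> g ` ({..<k} \<times> {..<n})"
  have "finite S" using \<open>finite \<Gamma>\<close> by (simp add: S_def)
  moreover have "q \<in> poly_fun n l \<and> (\<exists>A. q A \<noteq> 0)" if "q \<in> S" for q
    using that f(1) g(1) unfolding S_def by blast
  ultimately have "\<exists>h\<in>poly_fun n l. (\<exists>A\<in>GL_tuples n l. h A \<noteq> 0) \<and> (\<forall>A. h A \<noteq> 0 \<longrightarrow> (\<forall>q\<in>S. q A \<noteq> 0))"
    by (rule common_nonvanishing_poly_fun)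
  then obtain h where h: "h \<in> poly_fun n l" "\<exists>A\<in>GL_tuples n l. h A \<noteq> 0"
    and hS': "\<forall>A. h A \<noteq> 0 \<longrightarrow> (\<forall>q\<in>S. q A \<noteq> 0)" by (elim bexE[where A = "poly_fun n l"] conjE)
  have hS: "q A \<noteq> 0" if "h A \<noteq> 0" "q \<in> S" for A q using hS' that by blast
  have fin: "finite {P 1 | P G. (A, P, G) \<in> incidence n k l \<beta>}" if A: "h A \<noteq> 0" for A
  proof (rule finite_matrices[where k = k and n = n])
    have one: "1 \<in> {1..l}" using l by simp
    have "P 1 \<in> M n (\<beta> 1)" if "(A, P, G) \<in> incidence n k l \<beta>" for P G
      using that one unfolding incidence_def by blast
    then show "{P 1 | P G. (A, P, G) \<in> incidence n k l \<beta>} \<subseteq> carrier_mat k n"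
      using M_carrier[OF _ increasing_listsD(1)[OF inc[OF one]]] by blast
  next
    fix a b assume "a < k" "b < n"
    then have "finite {P 1 $$ (a, b) | P G. (A, P, G) \<in> incidence n k l \<beta>}"
      using hS[OF A, of "g (a, b)"] by (intro g(2)) (auto simp: S_def)
    moreover have "(\<lambda>P. P $$ (a, b)) ` {P 1 | P G. (A, P, G) \<in> incidence n k l \<beta>} =
        {P 1 $$ (a, b) | P G. (A, P, G) \<in> incidence n k l \<beta>}" by blast
    ultimately show "finite ((\<lambda>P. P $$ (a, b)) ` {P 1 | P G. (A, P, G) \<in> incidence n k l \<beta>})" by simp
  qed
  have eq: "\<gamma> i = \<beta> i"
    if A: "h A \<noteq> 0" and \<gamma>: "\<forall>i\<in>{1..l}. \<gamma> i \<in> increasing_lists n k \<and> (\<forall>r<k. \<gamma> i ! r \<le> \<beta> i ! r)"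
      and D: "(A, P, G) \<in> incidence n k l \<gamma>" and i: "i \<in> {1..l}" for A \<gamma> P G i
  proof (rule ccontr)
    assume ne: "\<gamma> i \<noteq> \<beta> i"
    define \<gamma>' where "\<gamma>' = restrict \<gamma> {1..l}"
    have eq: "\<gamma>' j = \<gamma> j" if "j \<in> {1..l}" for j using that by (simp add: \<gamma>'_def)
    have "\<gamma>' \<in> \<Gamma>" unfolding \<Gamma>_def
    proof (intro CollectI conjI)
      show "\<gamma>' \<in> {1..l} \<rightarrow>\<^sub>E increasing_lists n k" using \<gamma> by (auto simp: \<gamma>'_def)
      show "\<forall>i\<in>{1..l}. \<forall>r<k. \<gamma>' i ! r \<le> \<beta> i ! r" using \<gamma> eq by simp
      show "\<exists>i\<in>{1..l}. \<gamma>' i \<noteq> \<beta> i" using i ne eq by auto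
    qed
    then have "(A, P, G) \<notin> incidence n k l \<gamma>'" using hS[OF A, of "f \<gamma>'"] by (intro f(2)) (auto simp: S_def)
    moreover have "incidence n k l \<gamma>' = incidence n k l \<gamma>" by (rule incidence_cong[OF eq])
    ultimately show False using D by simp
  qed
  show ?thesis
    by (intro bexI[OF _ h(1)] conjI h(2) allI impI ballI fin) (assumption, rule eq)
qed

lemma row_span_eq_imp_factor:
  assumes B: "B \<in> carrier_mat k n" and C: "C \<in> carrier_mat m n" and eq: "row_span n B = row_span n C"
  shows "\<exists>g\<in>carrier_mat k m. B = g * C"
proof -
  have "row B i \<in> row_comb C ` carrier_vec m" if "i < k" for i
    using row_in_row_span[OF B that] unfolding eq row_span_eq[OF C] .
  then show ?thesis using row_span_subset_imp_factor[where R = "\<lambda>_. carrier_vec m", OF B C] by blast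
qed

text \<open>
  Flags represented by a tuple \<open>A\<close> that satisfies the generic conditions. The matrices \<open>\<Phi>\<close> and \<open>\<Psi>\<^sub>i\<close> of
  the bilinear system are introduced separately, since they are arbitrary representatives.
\<close>

locale generic_flags =
  fixes n k l :: nat and \<beta> :: "nat \<Rightarrow> nat list" and F :: "nat \<Rightarrow> complex vec set list" and A :: "nat \<Rightarrow> complex mat"
  assumes kn: "k < n" and l: "1 \<le> l" and \<beta>: "\<And>i. i \<in> {1..l} \<Longrightarrow> \<beta> i \<in> increasing_lists n k"
    and A: "\<And>i. i \<in> {1..l} \<Longrightarrow> represents n (A i) (F i)"
    and finitely_many: "finite {P 1 | P G. (A, P, G) \<in> incidence n k l \<beta>}"
    and only_big_cells: "\<And>\<gamma> P G i. (\<And>i. i \<in> {1..l} \<Longrightarrow> \<gamma> i \<in> increasing_lists n k) \<Longrightarrow>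
      (\<And>i r. i \<in> {1..l} \<Longrightarrow> r < k \<Longrightarrow> \<gamma> i ! r \<le> \<beta> i ! r) \<Longrightarrow>
      (A, P, G) \<in> incidence n k l \<gamma> \<Longrightarrow> i \<in> {1..l} \<Longrightarrow> \<gamma> i = \<beta> i"
begin

lemma A_carrier: "i \<in> {1..l} \<Longrightarrow> A i \<in> carrier_mat n n" "i \<in> {1..l} \<Longrightarrow> invertible_mat (A i)"
  using A by (auto simp: represents_def)

text \<open>
  The pivots of \<open>H\<close> with respect to the \<open>A\<^sub>i\<close> lie below the \<open>\<beta>\<^sub>i\<close> by the Schubert conditions, and then
  genericity makes them equal.
\<close>

lemma instance_incident:
  assumes H: "H \<in> instance_of n k l \<beta> F"
  shows "\<exists>P G. (A, P, G) \<in> incidence n k l \<beta> \<and> (\<forall>i\<in>{1..l}. H = row_span n (P i * A i))"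
proof -
  have sch: "H \<in> schubert_variety n k (\<beta> i) (F i)" if "i \<in> {1..l}" for i
    using H that by (auto simp: instance_of_def)
  have HG: "H \<in> Gr k n" using sch[of 1] l by (auto simp: schubert_variety_def)
  have ech: "\<exists>\<gamma> P. \<gamma> \<in> increasing_lists n k \<and> P \<in> M n \<gamma> \<and> H = row_span n (P * A i)" if "i \<in> {1..l}" for i
    by (rule Gr_echelon_form[OF HG A_carrier(1)[OF that] A_carrier(2)[OF that]])
  define \<gamma> where "\<gamma> i = (SOME \<gamma>. \<gamma> \<in> increasing_lists n k \<and> (\<exists>P. P \<in> M n \<gamma> \<and> H = row_span n (P * A i)))" for i
  define P where "P i = (SOME P. P \<in> M n (\<gamma> i) \<and> H = row_span n (P * A i))" for i
  have \<gamma>': "\<gamma> i \<in> increasing_lists n k \<and> (\<exists>P. P \<in> M n (\<gamma> i) \<and> H = row_span n (P * A i))"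
    if "i \<in> {1..l}" for i
    unfolding \<gamma>_def by (rule someI_ex) (use ech[OF that] in blast)
  have P': "P i \<in> M n (\<gamma> i) \<and> H = row_span n (P i * A i)" if "i \<in> {1..l}" for i
    unfolding P_def by (rule someI_ex) (use \<gamma>'[OF that] in blast)
  have \<gamma>: "\<gamma> i \<in> increasing_lists n k" and P: "P i \<in> M n (\<gamma> i)" and HP: "H = row_span n (P i * A i)"
    if "i \<in> {1..l}" for i
    using \<gamma>'[OF that] P'[OF that] by blast+
  have PA: "P i * A i \<in> carrier_mat k n" if "i \<in> {1..l}" for i
    using M_carrier[OF P[OF that] increasing_listsD(1)[OF \<gamma>[OF that]]] A_carrier(1)[OF that] by simp
  have one: "1 \<in> {1..l}" using l by simp
  have "\<forall>i\<in>{1..l}. \<exists>g. g \<in> carrier_mat k k \<and> P i * A i = g * (P 1 * A 1)"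
  proof
    fix i assume i: "i \<in> {1..l}"
    have "row_span n (P i * A i) = row_span n (P 1 * A 1)" using HP[OF i] HP[OF one] by simp
    from row_span_eq_imp_factor[OF PA[OF i] PA[OF one] this]
    show "\<exists>g. g \<in> carrier_mat k k \<and> P i * A i = g * (P 1 * A 1)" unfolding Bex_def .
  qed
  from bchoice[OF this] obtain G where G: "\<forall>i\<in>{1..l}. G i \<in> carrier_mat k k \<and> P i * A i = G i * (P 1 * A 1)" ..
  have inc: "(A, P, G) \<in> incidence n k l \<gamma>"
    unfolding incidence_def mem_Collect_eq prod.case
  proof (intro conjI ballI)
    fix i assume i: "i \<in> {2..l}"
    then have "i \<in> {1..l}" by simp
    then show "G i \<in> carrier_mat k k" "P i * A i = G i * (P 1 * A 1)" using G by blast+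
  qed (rule A_carrier(1) P, assumption)+
  have le: "\<gamma> i ! r \<le> \<beta> i ! r" if i: "i \<in> {1..l}" and r: "r < k" for i r
    using schubert_variety_iff_pivots_le[OF \<gamma>[OF i] P[OF i] A[OF i] \<beta>[OF i]] sch[OF i] HP[OF i] r by simp
  have "\<gamma> i = \<beta> i" if "i \<in> {1..l}" for i
    by (rule only_big_cells[OF \<gamma> le inc that])
  then have "incidence n k l \<gamma> = incidence n k l \<beta>" by (rule incidence_cong)
  then show ?thesis using inc HP by blast
qed

text \<open>
  The pivots depend only on the flag: the Schubert conditions compare the pivots with respect to
  \<open>B\<close> and to \<open>A\<^sub>i\<close> in both directions.
\<close>

lemma instance_echelon_form:
  assumes H: "H \<in> instance_of n k l \<beta> F" and i: "i \<in> {1..l}" and B: "represents n B (F i)"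
  shows "\<exists>P\<in>M n (\<beta> i). H = row_span n (P * B)"
proof -
  have Bc: "B \<in> carrier_mat n n" "invertible_mat B" using B by (auto simp: represents_def)
  obtain P G where "(A, P, G) \<in> incidence n k l \<beta>" and HPA: "H = row_span n (P i * A i)"
    using instance_incident[OF H] i by blast
  then have Pi: "P i \<in> M n (\<beta> i)" using i unfolding incidence_def by blast
  have sch: "H \<in> schubert_variety n k (\<beta> i) (F i)" using H i by (auto simp: instance_of_def)
  then have "H \<in> Gr k n" by (simp add: schubert_variety_def)
  from Gr_echelon_form[OF this Bc] obtain \<gamma> Q where \<gamma>: "\<gamma> \<in> increasing_lists n k" and Q: "Q \<in> M n \<gamma>"
    and HQ: "H = row_span n (Q * B)" by blast
  have le1: "\<gamma> ! r \<le> \<beta> i ! r" if "r < k" for r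
    using schubert_variety_iff_pivots_le[OF \<gamma> Q B \<beta>[OF i]] sch HQ that by simp
  have "H \<in> schubert_variety n k \<gamma> (F i)"
    using schubert_variety_iff_pivots_le[OF \<gamma> Q B \<gamma>] HQ by simp
  then have le2: "\<beta> i ! r \<le> \<gamma> ! r" if "r < k" for r
    using schubert_variety_iff_pivots_le[OF \<beta>[OF i] Pi A[OF i] \<gamma>] HPA that by simp
  have "\<gamma> = \<beta> i"
    using increasing_listsD(1)[OF \<gamma>] increasing_listsD(1)[OF \<beta>[OF i]] le1 le2
    by (intro nth_equalityI) (auto intro: antisym)
  then show ?thesis using Q HQ by blast
qed

lemma finite_instance: "finite (instance_of n k l \<beta> F)"
proof (rule finite_subset)
  show "instance_of n k l \<beta> F \<subseteq> (\<lambda>P. row_span n (P * A 1)) ` {P 1 | P G. (A, P, G) \<in> incidence n k l \<beta>}"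
  proof
    fix H assume "H \<in> instance_of n k l \<beta> F"
    then obtain P G where PG: "(A, P, G) \<in> incidence n k l \<beta>" "\<forall>i\<in>{1..l}. H = row_span n (P i * A i)"
      using instance_incident by blast
    have "H = row_span n (P 1 * A 1)" using PG(2) l by simp
    then show "H \<in> (\<lambda>P. row_span n (P * A 1)) ` {P 1 | P G. (A, P, G) \<in> incidence n k l \<beta>}"
      using PG(1) by blast
  qed
qed (intro finite_imageI finitely_many)

context
  fixes \<Phi> :: "complex mat" and \<Psi> :: "nat \<Rightarrow> complex mat"
  assumes \<Phi>: "represents n \<Phi> (F 1)" and \<Psi>: "\<And>i. i \<in> {2..l} \<Longrightarrow> represents n (\<Psi> i) (dual_flag n (F i))"
begin

lemma frame_carriers:
  "\<Phi> \<in> carrier_mat n n" "invertible_mat \<Phi>"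
  "i \<in> {2..l} \<Longrightarrow> \<Psi> i \<in> carrier_mat n n" "i \<in> {2..l} \<Longrightarrow> invertible_mat (\<Psi> i)"
  using \<Phi> \<Psi> by (auto simp: represents_def)

lemma annihilator_echelon_form:
  assumes i: "i \<in> {2..l}" and \<gamma>: "\<gamma> \<in> increasing_lists n k" and P: "P \<in> M n \<gamma>"
    and H: "H = row_span n (P * A i)"
  shows "\<exists>Q\<in>M n (perp_list n \<gamma>). annihilator n H = row_span n (Q * \<Psi> i)"
proof -
  have i1: "i \<in> {1..l}" using i by simp
  have "H \<in> Gr k n" unfolding H by (rule M_mult_row_span_Gr[OF \<gamma> P A_carrier[OF i1]])
  from Gr_echelon_form[OF annihilator_Gr[OF this] frame_carriers(3,4)[OF i]]
  obtain \<delta> Q where \<delta>: "\<delta> \<in> increasing_lists n (n - k)" and Q: "Q \<in> M n \<delta>"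
    and HQ: "annihilator n H = row_span n (Q * \<Psi> i)" by blast
  have "P * A i \<in> carrier_mat k n" "Q * \<Psi> i \<in> carrier_mat (n - k) n"
    using M_carrier[OF P increasing_listsD(1)[OF \<gamma>]] M_carrier[OF Q increasing_listsD(1)[OF \<delta>]]
      A_carrier(1)[OF i1] frame_carriers(3)[OF i] by simp_all
  then have "(P * A i) * (Q * \<Psi> i)\<^sup>T = 0\<^sub>m k (n - k)"
    using orthogonal_iff_row_span_subset_annihilator HQ H by blast
  then have "\<delta> = perp_list n \<gamma>" by (rule orthogonal_echelon_forms[OF A[OF i1] \<Psi>[OF i] \<gamma> P \<delta> Q])
  then show ?thesis using Q HQ by blast
qed

lemma solution_carriers:
  assumes "(P, Q) \<in> affine_space n l \<beta>"
  shows "P \<in> M n (\<beta> 1)" "P * \<Phi> \<in> carrier_mat k n"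
    and "i \<in> {2..l} \<Longrightarrow> Q i \<in> M n (perp_list n (\<beta> i))" "i \<in> {2..l} \<Longrightarrow> Q i * \<Psi> i \<in> carrier_mat (n - k) n"
proof -
  have one: "1 \<in> {1..l}" using l by simp
  show P: "P \<in> M n (\<beta> 1)" using assms by (simp add: affine_space_def)
  show "P * \<Phi> \<in> carrier_mat k n"
    using M_carrier[OF P increasing_listsD(1)[OF \<beta>[OF one]]] frame_carriers(1) by simp
  assume i: "i \<in> {2..l}"
  then have i1: "i \<in> {1..l}" by simp
  show Q: "Q i \<in> M n (perp_list n (\<beta> i))" using assms i by (auto simp: affine_space_def)
  show "Q i * \<Psi> i \<in> carrier_mat (n - k) n"
    using M_carrier[OF Q increasing_listsD(1)[OF perp_list_increasing[OF \<beta>[OF i1]]]] frame_carriers(3)[OF i] by simp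
qed

text \<open>
  Orthogonality to \<open>Q\<^sub>i * \<Psi>\<^sub>i\<close>, whose pivots are dual to \<open>\<beta>\<^sub>i\<close>, forces \<open>H\<close> to have the pivots \<open>\<beta>\<^sub>i\<close> with
  respect to \<open>A\<^sub>i\<close>, which is more than the Schubert condition. The row space of \<open>Q\<^sub>i * \<Psi>\<^sub>i\<close> and the annihilator of
  \<open>H\<close>, in which it is contained, then have echelon forms with the same pivots and are equal.
\<close>

lemma solution_row_spaces:
  assumes sol: "(P, Q) \<in> solutions n k l \<beta> \<Phi> \<Psi>"
  shows "row_span n (P * \<Phi>) \<in> instance_of n k l \<beta> F"
    and "i \<in> {2..l} \<Longrightarrow> row_span n (Q i * \<Psi> i) = annihilator n (row_span n (P * \<Phi>))"
proof -
  have aff: "(P, Q) \<in> affine_space n l \<beta>"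
    and orth: "\<And>i. i \<in> {2..l} \<Longrightarrow> (P * \<Phi>) * (Q i * \<Psi> i)\<^sup>T = 0\<^sub>m k (n - k)"
    using sol by (auto simp: solutions_def block_def)
  note c = solution_carriers[OF aff]
  have one: "1 \<in> {1..l}" using l by simp
  define H where "H = row_span n (P * \<Phi>)"
  have HG: "H \<in> Gr k n"
    unfolding H_def by (rule M_mult_row_span_Gr[OF \<beta>[OF one] c(1) frame_carriers(1,2)])
  have ann: "row_span n (Q i * \<Psi> i) \<subseteq> annihilator n H" if "i \<in> {2..l}" for i
    using orthogonal_iff_row_span_subset_annihilator[OF c(2) c(4)[OF that]] orth[OF that] by (simp add: H_def)
  have pos: "\<exists>R. R \<in> M n (\<beta> i) \<and> H = row_span n (R * A i)" if i: "i \<in> {2..l}" for i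
  proof -
    have i1: "i \<in> {1..l}" using i by simp
    obtain \<gamma> R where \<gamma>: "\<gamma> \<in> increasing_lists n k" and R: "R \<in> M n \<gamma>" and HR: "H = row_span n (R * A i)"
      using Gr_echelon_form[OF HG A_carrier[OF i1]] by blast
    have RA: "R * A i \<in> carrier_mat k n"
      using M_carrier[OF R increasing_listsD(1)[OF \<gamma>]] A_carrier(1)[OF i1] by simp
    have "(R * A i) * (Q i * \<Psi> i)\<^sup>T = 0\<^sub>m k (n - k)"
      using orthogonal_iff_row_span_subset_annihilator[OF RA c(4)[OF i]] ann[OF i] HR by simp
    from orthogonal_echelon_forms[OF A[OF i1] \<Psi>[OF i] \<gamma> R perp_list_increasing[OF \<beta>[OF i1]] c(3)[OF i] this]
    have "\<beta> i = \<gamma>" by (rule perp_list_inj[OF \<beta>[OF i1] \<gamma>])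
    then show ?thesis using R HR by blast
  qed
  have "H \<in> schubert_variety n k (\<beta> i) (F i)" if i: "i \<in> {1..l}" for i
  proof (cases "i = 1")
    case True
    then show ?thesis unfolding H_def
      using schubert_variety_iff_pivots_le[OF \<beta>[OF one] c(1) \<Phi> \<beta>[OF one]] by simp
  next
    case False
    then obtain R where "R \<in> M n (\<beta> i)" "H = row_span n (R * A i)" using pos[of i] i by auto
    then show ?thesis using schubert_variety_iff_pivots_le[OF \<beta>[OF i] _ A[OF i] \<beta>[OF i]] by simp
  qed
  then show "row_span n (P * \<Phi>) \<in> instance_of n k l \<beta> F" by (simp add: instance_of_def H_def)
  assume i: "i \<in> {2..l}"
  then have i1: "i \<in> {1..l}" by simp
  obtain R where "R \<in> M n (\<beta> i)" "H = row_span n (R * A i)" using pos[OF i] by blast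
  from annihilator_echelon_form[OF i \<beta>[OF i1] this]
  obtain Q' where Q': "Q' \<in> M n (perp_list n (\<beta> i))" "annihilator n H = row_span n (Q' * \<Psi> i)" by blast
  have "Q i = Q'"
    by (rule echelon_form_unique[OF perp_list_increasing[OF \<beta>[OF i1]] c(3)[OF i] Q'(1) frame_carriers(3,4)[OF i]])
      (use ann[OF i] Q'(2) in simp)
  then show "row_span n (Q i * \<Psi> i) = annihilator n (row_span n (P * \<Phi>))" using Q'(2) by (simp add: H_def)
qed

lemma row_space_map_solution:
  assumes "(P, Q) \<in> solutions n k l \<beta> \<Phi> \<Psi>"
  shows "row_space_map n l \<Phi> \<Psi> (P, Q) = Delta n l (row_span n (P * \<Phi>))"
  unfolding row_space_map_def Delta_def prod.case
  by (intro arg_cong2[of _ _ _ _ Pair] refl restrict_ext) (rule solution_row_spaces(2)[OF assms])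

lemma solution_exists:
  assumes H: "H \<in> instance_of n k l \<beta> F"
  shows "\<exists>P Q. (P, Q) \<in> solutions n k l \<beta> \<Phi> \<Psi> \<and> H = row_span n (P * \<Phi>)"
proof -
  have one: "1 \<in> {1..l}" using l by simp
  obtain P where P: "P \<in> M n (\<beta> 1)" "H = row_span n (P * \<Phi>)"
    using instance_echelon_form[OF H one \<Phi>] by blast
  have "\<forall>i\<in>{2..l}. \<exists>Q. Q \<in> M n (perp_list n (\<beta> i)) \<and> annihilator n H = row_span n (Q * \<Psi> i)"
  proof
    fix i assume i: "i \<in> {2..l}"
    then have i1: "i \<in> {1..l}" by simp
    obtain R where "R \<in> M n (\<beta> i)" "H = row_span n (R * A i)"
      using instance_echelon_form[OF H i1 A[OF i1]] by blast
    from annihilator_echelon_form[OF i \<beta>[OF i1] this]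
    show "\<exists>Q. Q \<in> M n (perp_list n (\<beta> i)) \<and> annihilator n H = row_span n (Q * \<Psi> i)" by blast
  qed
  from bchoice[OF this] obtain Q0 where
    Q0: "\<forall>i\<in>{2..l}. Q0 i \<in> M n (perp_list n (\<beta> i)) \<and> annihilator n H = row_span n (Q0 i * \<Psi> i)" ..
  define Q where "Q = restrict Q0 {2..l}"
  have aff: "(P, Q) \<in> affine_space n l \<beta>" using P(1) Q0 by (simp add: affine_space_def Q_def)
  note c = solution_carriers[OF aff]
  have "(P * \<Phi>) * (Q i * \<Psi> i)\<^sup>T = 0\<^sub>m k (n - k)" if i: "i \<in> {2..l}" for i
  proof -
    have "row_span n (Q i * \<Psi> i) = annihilator n H" using Q0 i by (simp add: Q_def)
    then show ?thesis
      using orthogonal_iff_row_span_subset_annihilator[OF c(2) c(4)[OF i]] P(2) by simp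
  qed
  then have "(P, Q) \<in> solutions n k l \<beta> \<Phi> \<Psi>" using aff by (simp add: solutions_def block_def)
  then show ?thesis using P(2) by blast
qed

lemma row_space_map_inj: "inj_on (row_space_map n l \<Phi> \<Psi>) (solutions n k l \<beta> \<Phi> \<Psi>)"
proof (rule inj_onI, clarify)
  fix P Q P' Q'
  assume s: "(P, Q) \<in> solutions n k l \<beta> \<Phi> \<Psi>" "(P', Q') \<in> solutions n k l \<beta> \<Phi> \<Psi>"
    and eq: "row_space_map n l \<Phi> \<Psi> (P, Q) = row_space_map n l \<Phi> \<Psi> (P', Q')"
  have aff: "(P, Q) \<in> affine_space n l \<beta>" "(P', Q') \<in> affine_space n l \<beta>"
    using s by (auto simp: solutions_def)
  note c = solution_carriers[OF aff(1)] and c' = solution_carriers[OF aff(2)]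
  have one: "1 \<in> {1..l}" using l by simp
  have "row_span n (P * \<Phi>) = row_span n (P' * \<Phi>)" using eq by (simp add: row_space_map_def)
  then have "P = P'"
    by (intro echelon_form_unique[OF \<beta>[OF one] c(1) c'(1) frame_carriers(1,2)]) simp
  moreover have "Q i = Q' i" for i
  proof (cases "i \<in> {2..l}")
    case True
    have i1: "i \<in> {1..l}" using True by simp
    have "(\<lambda>i\<in>{2..l}. row_span n (Q i * \<Psi> i)) = (\<lambda>i\<in>{2..l}. row_span n (Q' i * \<Psi> i))"
      using eq by (simp add: row_space_map_def)
    from fun_cong[OF this, of i] have "row_span n (Q i * \<Psi> i) = row_span n (Q' i * \<Psi> i)" using True by simp
    then show ?thesis
      by (intro echelon_form_unique[OF perp_list_increasing[OF \<beta>[OF i1]] c(3)[OF True] c'(3)[OF True]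
          frame_carriers(3,4)[OF True]]) simp
  next
    case False
    have "Q \<in> extensional {2..l}" "Q' \<in> extensional {2..l}"
      using aff unfolding affine_space_def PiE_def by blast+
    then show ?thesis using False by (simp add: extensional_def)
  qed
  ultimately show "P = P' \<and> Q = Q'" by auto
qed

lemma row_space_map_bij:
  "bij_betw (row_space_map n l \<Phi> \<Psi>) (solutions n k l \<beta> \<Phi> \<Psi>) (Delta n l ` instance_of n k l \<beta> F)"
  unfolding bij_betw_def
proof (intro conjI row_space_map_inj equalityI subsetI)
  fix y assume "y \<in> row_space_map n l \<Phi> \<Psi> ` solutions n k l \<beta> \<Phi> \<Psi>"
  then obtain P Q where "(P, Q) \<in> solutions n k l \<beta> \<Phi> \<Psi>" "y = row_space_map n l \<Phi> \<Psi> (P, Q)" by auto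
  then show "y \<in> Delta n l ` instance_of n k l \<beta> F"
    using row_space_map_solution solution_row_spaces(1) by simp
next
  fix y assume "y \<in> Delta n l ` instance_of n k l \<beta> F"
  then obtain H where H: "H \<in> instance_of n k l \<beta> F" "y = Delta n l H" by auto
  obtain P Q where PQ: "(P, Q) \<in> solutions n k l \<beta> \<Phi> \<Psi>" "H = row_span n (P * \<Phi>)"
    using solution_exists[OF H(1)] by blast
  have "y = row_space_map n l \<Phi> \<Psi> (P, Q)" using row_space_map_solution[OF PQ(1)] PQ(2) H(2) by simp
  then show "y \<in> row_space_map n l \<Phi> \<Psi> ` solutions n k l \<beta> \<Phi> \<Psi>" using PQ(1) by blast
qed

lemma finite_solutions: "finite (solutions n k l \<beta> \<Phi> \<Psi>)"
  using bij_betw_finite[OF row_space_map_bij] finite_instance by blast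

end

end

theorem theorem2p7:
  fixes n k l :: nat and \<beta> :: "nat \<Rightarrow> nat list"
  assumes "1 \<le> k" and "k < n" and "1 \<le> l" and "schubert_problem n k l \<beta>"
  shows "\<exists>U. zariski_open_flags n l U \<and> U \<noteq> {} \<and>
    (\<forall>F\<in>U. \<forall>\<Phi> \<Psi>.
       represents n \<Phi> (F 1) \<and> (\<forall>i\<in>{2..l}. represents n (\<Psi> i) (dual_flag n (F i))) \<longrightarrow>
         card (equations n k l) = k * (n - k) * (l - 1) \<and>
         card (variables n l \<beta>) = k * (n - k) * (l - 1) \<and>
         (\<forall>(i, a, b) \<in> equations n k l. bilinear_in n l \<beta> i (lhs \<Phi> \<Psi> (i, a, b))) \<and>
         finite (solutions n k l \<beta> \<Phi> \<Psi>) \<and>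
         bij_betw (row_space_map n l \<Phi> \<Psi>) (solutions n k l \<beta> \<Phi> \<Psi>)
           (Delta n l ` instance_of n k l \<beta> F))"
proof -
  have \<beta>: "\<beta> i \<in> increasing_lists n k" if "i \<in> {1..l}" for i
    using assms(4) that by (simp add: schubert_problem_def)
  from generic_tuples[OF assms(2-4)] obtain h where h: "h \<in> poly_fun n l"
    and "\<exists>A\<in>GL_tuples n l. h A \<noteq> 0"
    and gen: "\<forall>A. h A \<noteq> 0 \<longrightarrow> finite {P 1 | P G. (A, P, G) \<in> incidence n k l \<beta>} \<and>
      (\<forall>\<gamma> P G. (\<forall>i\<in>{1..l}. \<gamma> i \<in> increasing_lists n k \<and> (\<forall>r<k. \<gamma> i ! r \<le> \<beta> i ! r)) \<longrightarrow>
        (A, P, G) \<in> incidence n k l \<gamma> \<longrightarrow> (\<forall>i\<in>{1..l}. \<gamma> i = \<beta> i))"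
    by (elim bexE[where A = "poly_fun n l"] conjE)
  then obtain A0 where A0: "A0 \<in> GL_tuples n l" "h A0 \<noteq> 0" by blast
  show ?thesis
  proof (intro exI[of _ "flags_of_nonvanishing n l h"] conjI ballI allI impI)
    show "zariski_open_flags n l (flags_of_nonvanishing n l h)" by (rule flags_of_nonvanishing_open[OF h])
    show "flags_of_nonvanishing n l h \<noteq> {}" by (rule flags_of_nonvanishing_nonempty[where h = h, OF A0])
    fix F \<Phi> \<Psi>
    assume F: "F \<in> flags_of_nonvanishing n l h"
      and rep: "represents n \<Phi> (F 1) \<and> (\<forall>i\<in>{2..l}. represents n (\<Psi> i) (dual_flag n (F i)))"
    from F obtain A where A: "h A \<noteq> 0" "\<And>i. i \<in> {1..l} \<Longrightarrow> represents n (A i) (F i)"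
      unfolding flags_of_nonvanishing_def by blast
    have fin: "finite {P 1 | P G. (A, P, G) \<in> incidence n k l \<beta>}" using gen A(1) by blast
    have big: "\<gamma> i = \<beta> i"
      if "\<And>i. i \<in> {1..l} \<Longrightarrow> \<gamma> i \<in> increasing_lists n k" "\<And>i r. i \<in> {1..l} \<Longrightarrow> r < k \<Longrightarrow> \<gamma> i ! r \<le> \<beta> i ! r"
        "(A, P, G) \<in> incidence n k l \<gamma>" "i \<in> {1..l}" for \<gamma> P G i
      using gen A(1) that by meson
    interpret generic_flags n k l \<beta> F A
      by (unfold_locales) (fact assms(2) assms(3) \<beta> A(2) fin big)+
    have \<Phi>: "represents n \<Phi> (F 1)" and \<Psi>: "\<And>i. i \<in> {2..l} \<Longrightarrow> represents n (\<Psi> i) (dual_flag n (F i))"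
      using rep by blast+
    show "card (equations n k l) = k * (n - k) * (l - 1)" by (rule card_equations)
    show "card (variables n l \<beta>) = k * (n - k) * (l - 1)" by (rule card_variables[OF assms(4,3)])
    show "finite (solutions n k l \<beta> \<Phi> \<Psi>)" by (rule finite_solutions[OF \<Phi> \<Psi>])
    show "bij_betw (row_space_map n l \<Phi> \<Psi>) (solutions n k l \<beta> \<Phi> \<Psi>) (Delta n l ` instance_of n k l \<beta> F)"
      by (rule row_space_map_bij[OF \<Phi> \<Psi>])
    show "case x of (i, a, b) \<Rightarrow> bilinear_in n l \<beta> i (lhs \<Phi> \<Psi> (i, a, b))" if "x \<in> equations n k l" for x
      using lhs_bilinear[OF \<beta> assms(3) frame_carriers(1,3)[OF \<Phi> \<Psi>]] that by (cases x) auto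
  qed
qed

end
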